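(* Let $\Sigma_L,\Sigma_R$ be two distinct parallel straight lines in $\mathbb{R}^2$. Let $R_C$ be the open strip between them, let $R_L$ be the open half-plane bounded by $\Sigma_L$ and not containing $\Sigma_R$, and let $R_R$ be the open half-plane bounded by $\Sigma_R$ and not containing $\Sigma_L$. Let $X_L,X_C,X_R$ be three linear (i.e. affine) Hamiltonian vector fields on $\mathbb{R}^2$, each of which has an isolated singular point (necessarily a center or a saddle, not required to lie in the corresponding zone). Consider the planar piecewise linear Hamiltonian differential system with three zones defined by $X_i$ on $\overline{R_i}$ for $i=L,C,R$, and suppose it is discontinuous, i.e. it is not the case that both $X_L(p)=X_C(p)$ for every $p\in\Sigma_L$ and $X_C(q)=X_R(q)$ for every $q\in\Sigma_R$. Then this piecewise system has at most one crossing limit cycle.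
   Context: A linear Hamiltonian vector field on $\mathbb{R}^2$ here means a vector field of the form $X(x,y)=(ax+by+\alpha,\; cx-ay+\beta)$ with $a,b,c,\alpha,\beta\in\mathbb{R}$. It is the Hamiltonian vector field $(\partial_y H,-\partial_x H)$ of $H(x,y)=\frac{b}{2}y^2-\frac{c}{2}x^2+axy+\alpha y-\beta x$. Its singular point is isolated if and only if $a^2+bc\neq 0$; it is then a center if $a^2+bc<0$ and a saddle if $a^2+bc>0$. The singular point of each vector field is considered in the whole plane, so it may lie outside the zone in which that vector field is used. Crossing, sliding and escaping sets. Write $\Sigma_L=h_L^{-1}(0)$ and $\Sigma_R=h_R^{-1}(0)$ with $h_L,h_R$ non-constant affine functions such that $h_L<0$ on $R_L$, $h_L>0$ on $R_C$, $h_R<0$ on $R_C$ and $h_R>0$ on $R_R$ (for example $\Sigma_L=\{x=-1\}$, $h_L=x+1$, $\Sigma_R=\{x=1\}$, $h_R=x-1$). For a vector field $X$ and a function $h$ put $Xh(p)=\langle X(p),\nabla h(p)\rangle$. On $\Sigma_L$, the crossing set is $\{p\in\Sigma_L: X_Lh_L(p)\cdot X_Ch_L(p)>0\}$, the sliding set is $\{p\in\Sigma_L: X_Lh_L(p)>0,\ X_Ch_L(p)<0\}$, and the escaping set is $\{p\in\Sigma_L: X_Lh_L(p)<0,\ X_Ch_L(p)>0\}$. The sets on $\Sigma_R$ are defined in the same way, with $X_C,X_R,h_R$ in place of $X_L,X_C,h_L$ respectively. Inside each closed zone trajectories follow the corresponding vector field, and at crossing points a trajectory passes from one zone to the adjacent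 one by concatenation of the corresponding orbit arcs. A limit cycle is a periodic orbit of the piecewise system that is isolated in the set of all its periodic orbits. It is a crossing limit cycle if it does not contain any segment of the sliding or escaping sets. *)

theory Defs
  imports "HOL-Analysis.Analysis"
begin

definition linear_hamiltonian :: "(real \<times> real \<Rightarrow> real \<times> real) \<Rightarrow> bool" where
  "linear_hamiltonian X \<longleftrightarrow>
     (\<exists>a b c \<alpha> \<beta>. \<forall>x y. X (x, y) = (a * x + b * y + \<alpha>, c * x - a * y + \<beta>))"

definition has_isolated_singular_point :: "(real \<times> real \<Rightarrow> real \<times> real) \<Rightarrow> bool" where
  "has_isolated_singular_point X \<longleftrightarrow> (\<exists>p. p isolated_in {q. X q = 0})"

text \<open>
  Two distinct parallel lines \<open>v \<bullet> p = lL\<close> and \<open>v \<bullet> p = lR\<close>, where \<open>v\<close> is a common normal vector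
  pointing from the left line to the right one. The locale itself has no assumptions: \<open>v \<noteq> 0\<close> and
  \<open>lL < lR\<close> are hypotheses of the theorem. With \<open>h p = v \<bullet> p - l\<close> the gradient of \<open>h\<close> is \<open>v\<close>, so the
  derivative of \<open>h\<close> along a vector field \<open>X\<close> is \<open>X p \<bullet> v\<close>.
\<close>

locale three_zones =
  fixes v :: "real \<times> real" and lL lR :: real
    and XL XC XR :: "real \<times> real \<Rightarrow> real \<times> real"
begin

definition line :: "real \<Rightarrow> (real \<times> real) set" where
  "line l = {p. v \<bullet> p = l}"

definition zoneL :: "(real \<times> real) set" where
  "zoneL = {p. v \<bullet> p < lL}"

definition zoneC :: "(real \<times> real) set" where
  "zoneC = {p. lL < v \<bullet> p \<and> v \<bullet> p < lR}"

definition zoneR :: "(real \<times> real) set" where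
  "zoneR = {p. lR < v \<bullet> p}"

definition discontinuous :: bool where
  "discontinuous \<longleftrightarrow> \<not> ((\<forall>p\<in>line lL. XL p = XC p) \<and> (\<forall>q\<in>line lR. XC q = XR q))"

text \<open>
  In the next three definitions, \<open>X\<close> is the field on the side
  \<open>v \<bullet> p < l\<close> of the line and \<open>Y\<close> the field on the side \<open>v \<bullet> p > l\<close>.
\<close>

definition sliding_set ::
  "real \<Rightarrow> (real \<times> real \<Rightarrow> real \<times> real) \<Rightarrow> (real \<times> real \<Rightarrow> real \<times> real) \<Rightarrow> (real \<times> real) set" where
  "sliding_set l X Y = {p \<in> line l. X p \<bullet> v > 0 \<and> Y p \<bullet> v < 0}"

definition escaping_set ::
  "real \<Rightarrow> (real \<times> real \<Rightarrow> real \<times> real) \<Rightarrow> (real \<times> real \<Rightarrow> real \<times> real) \<Rightarrow> (real \<times> real) set" where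
  "escaping_set l X Y = {p \<in> line l. X p \<bullet> v < 0 \<and> Y p \<bullet> v > 0}"

text \<open>
  Filippov's convention: on the sliding and escaping sets the motion follows the unique convex
  combination of the two fields that is tangent to the line.
\<close>

definition sliding_field ::
  "(real \<times> real \<Rightarrow> real \<times> real) \<Rightarrow> (real \<times> real \<Rightarrow> real \<times> real) \<Rightarrow> real \<times> real \<Rightarrow> real \<times> real" where
  "sliding_field X Y p =
     (1 / (Y p \<bullet> v - X p \<bullet> v)) *\<^sub>R ((Y p \<bullet> v) *\<^sub>R X p - (X p \<bullet> v) *\<^sub>R Y p)"

definition integral_arc ::
  "(real \<times> real) set \<Rightarrow> (real \<times> real \<Rightarrow> real \<times> real) \<Rightarrow> (real \<Rightarrow> real \<times> real) \<Rightarrow> real \<Rightarrow> real \<Rightarrow> bool" where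
  "integral_arc A X \<gamma> s e \<longleftrightarrow>
     (\<forall>t\<in>{s<..<e}. \<gamma> t \<in> A \<and> (\<gamma> has_vector_derivative X (\<gamma> t)) (at t))"

definition orbit_arc :: "(real \<Rightarrow> real \<times> real) \<Rightarrow> real \<Rightarrow> real \<Rightarrow> bool" where
  "orbit_arc \<gamma> s e \<longleftrightarrow>
     integral_arc (closure zoneL) XL \<gamma> s e \<or>
     integral_arc (closure zoneC) XC \<gamma> s e \<or>
     integral_arc (closure zoneR) XR \<gamma> s e \<or>
     integral_arc (sliding_set lL XL XC \<union> escaping_set lL XL XC) (sliding_field XL XC) \<gamma> s e \<or>
     integral_arc (sliding_set lR XC XR \<union> escaping_set lR XC XR) (sliding_field XC XR) \<gamma> s e"

text \<open>
  A trajectory is a finite concatenation of orbit arcs. No condition is imposed at the junctions: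
  continuity forces a junction of arcs in two adjacent zones to lie on the common line, and the arcs
  staying in their closed zones forces both fields to point weakly in the direction of passage. So
  the passage is at a crossing point (both normal components nonzero and of the same sign), or at a
  point where one of the fields is tangent to the line.
\<close>

definition trajectory :: "(real \<Rightarrow> real \<times> real) \<Rightarrow> real \<Rightarrow> bool" where
  "trajectory \<gamma> T \<longleftrightarrow>
     continuous_on {0..T} \<gamma> \<and>
     (\<exists>n (\<tau> :: nat \<Rightarrow> real). \<tau> 0 = 0 \<and> \<tau> n = T \<and>
        (\<forall>i<n. \<tau> i < \<tau> (Suc i) \<and> orbit_arc \<gamma> (\<tau> i) (\<tau> (Suc i))))"

text \<open>
  Periodic orbits are point sets. Trajectories of a discontinuous system need not be unique, so that
  a periodic orbit is a closed curve without self-intersections has to be required.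
\<close>

definition periodic_orbit :: "(real \<times> real) set \<Rightarrow> bool" where
  "periodic_orbit \<Gamma> \<longleftrightarrow>
     (\<exists>\<gamma> T. 0 < T \<and> trajectory \<gamma> T \<and> \<gamma> T = \<gamma> 0 \<and> inj_on \<gamma> {0..<T} \<and> \<Gamma> = \<gamma> ` {0..T})"

definition limit_cycle :: "(real \<times> real) set \<Rightarrow> bool" where
  "limit_cycle \<Gamma> \<longleftrightarrow>
     periodic_orbit \<Gamma> \<and>
     (\<exists>U. open U \<and> \<Gamma> \<subseteq> U \<and> (\<forall>\<Gamma>'. periodic_orbit \<Gamma>' \<and> \<Gamma>' \<subseteq> U \<longrightarrow> \<Gamma>' = \<Gamma>))"

definition crossing_limit_cycle :: "(real \<times> real) set \<Rightarrow> bool" where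
  "crossing_limit_cycle \<Gamma> \<longleftrightarrow>
     limit_cycle \<Gamma> \<and>
     (\<forall>A \<in> {sliding_set lL XL XC, escaping_set lL XL XC,
             sliding_set lR XC XR, escaping_set lR XC XR}.
        \<not> (\<exists>p q. p \<noteq> q \<and> closed_segment p q \<subseteq> \<Gamma> \<inter> A))"

end

end

theory Submission
  imports Defs
begin

text \<open>
  Let \<open>x = v \<bullet> p\<close> be the position of a point \<open>p\<close> across the
  strip. A linear Hamiltonian field with an isolated singular point \<open>c\<close> has the form
  \<open>X p = A (p - c)\<close> where \<open>A\<close> has trace zero and is invertible.
  Hence \<open>A\<^sup>2 = d I\<close> with \<open>d \<noteq> 0\<close>, and along every
  orbit \<open>x\<close> solves \<open>x'' = d (x - v \<bullet> c)\<close>. This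
  second-order equation has two consequences. The quantity
  \<open>x'\<^sup>2 - d (x - v \<bullet> c)\<^sup>2\<close> is constant along orbits; so an
  orbit of the middle field that crosses the strip with velocities \<open>z1\<close> and
  \<open>z2\<close> at its two lines satisfies \<open>z2\<^sup>2 = z1\<^sup>2 + D\<close>,
  where \<open>D\<close> depends on the field and the lines only
  (\<open>cross_end_velocity\<close>). And an orbit that leaves a line and comes back to it on the
  same side has opposite velocities at its two ends; so the sum of the two end points depends on
  the field and the line only (\<open>exc_sum\<close>).

  Consider a periodic orbit that consists of an excursion into the left zone from
  \<open>p0\<close> to \<open>p1\<close>, a crossing to \<open>p2\<close>, an excursion into the
  right zone to \<open>p3\<close> and a crossing back to \<open>p0\<close>. The velocities
  \<open>z0, z1, z2, z3\<close> of the middle field at these points satisfy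
  \<open>z0 + z1 = cL\<close>, \<open>z2 + z3 = cR\<close>,
  \<open>z2\<^sup>2 = z1\<^sup>2 + D\<close> and
  \<open>z3\<^sup>2 = z0\<^sup>2 + D\<close>, and they determine the orbit. If these equations
  have two solutions with the right signs, then \<open>cL = cR = 0\<close>, or
  \<open>cL = cR\<close> and \<open>D = 0\<close> (\<open>two_solutions_symmetric\<close>). In
  both cases the solutions come in a continuous family (\<open>symmetric_family\<close>), which is
  realised by periodic orbits that accumulate at the given one
  (\<open>three_zone_not_isolated\<close>). Therefore two isolated periodic orbits of this form
  coincide.

  It remains to see that an isolated periodic orbit without sliding and escaping segments has this
  form (\<open>isolated_cycle_is_three_zone\<close>). The orbit may be tangent to the lines, where
  orbits can branch, and a priori it may pass through the strip many times. But a simple closed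
  orbit turns only once, by an extremal argument: consider the end of an arc in the left half
  plane at which the velocity into the strip is largest. Conservation of energy shows that the
  orbit continues with the outermost crossing of the strip, and since the excursions into one zone
  are nested, it returns from the right half plane at the corresponding extreme end there
  (\<open>half_turn\<close>). After two such half turns the orbit is back at its starting point.
  The other shapes are not isolated. An orbit that belongs to a single field encircles a center
  and is accompanied by its homothetic images (\<open>closed_orbit_not_isolated\<close>). An orbit
  that meets the strip in a single excursion from one of its lines can be shrunk
  (\<open>two_zone_not_isolated\<close>). If an orbit moves along one of the lines, which is then
  an invariant line of a saddle, then one of the conditions \<open>z0 + z1 = cL\<close> and
  \<open>z2 + z3 = cR\<close> is absent, and there is again a continuous family of periodic
  orbits.
\<close>

section \<open>Linear Hamiltonian fields and their flows\<close>

type_synonym plane = "real \<times> real"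

text \<open>
  The linear part of a linear Hamiltonian field has trace zero, so that by Cayley and Hamilton its
  square is a multiple \<open>d\<close> of the identity. In this form the notion refers to no
  coordinates and is invariant under the reversal of time. The singular point \<open>c\<close> is
  a center for \<open>d < 0\<close> and a saddle for \<open>d > 0\<close>.
\<close>

definition central :: "(plane \<Rightarrow> plane) \<Rightarrow> plane \<Rightarrow> real \<Rightarrow> bool" where
  "central X c d \<longleftrightarrow> d \<noteq> 0 \<and> linear (\<lambda>q. X (c + q)) \<and> (\<forall>q. X (c + X (c + q)) = d *\<^sub>R q)"

definition hfield :: "(plane \<Rightarrow> plane) \<Rightarrow> bool" where
  "hfield X \<longleftrightarrow> (\<exists>c d. central X c d)"

definition centre :: "(plane \<Rightarrow> plane) \<Rightarrow> plane" where
  "centre X = (SOME c. \<exists>d. central X c d)"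

definition disc :: "(plane \<Rightarrow> plane) \<Rightarrow> real" where
  "disc X = (SOME d. central X (centre X) d)"

lemma hfield_central: "hfield X \<Longrightarrow> central X (centre X) (disc X)"
  unfolding hfield_def centre_def disc_def by (metis (mono_tags, lifting) someI_ex)

lemma hfield_disc: "hfield X \<Longrightarrow> disc X \<noteq> 0"
  using hfield_central central_def by blast

lemma hfield_linear: "hfield X \<Longrightarrow> linear (\<lambda>q. X (centre X + q))"
  using hfield_central central_def by blast

lemma hfield_square: "hfield X \<Longrightarrow> X (centre X + X p) = disc X *\<^sub>R (p - centre X)"
  using hfield_central[of X] unfolding central_def by (metis add.commute diff_add_cancel)

lemma hfield_affine:
  assumes "hfield X"
  shows "X (centre X + a *\<^sub>R q + b *\<^sub>R r) = a *\<^sub>R X (centre X + q) + b *\<^sub>R X (centre X + r)"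
proof -
  interpret linear "\<lambda>q. X (centre X + q)" using hfield_linear[OF assms] .
  show ?thesis using add[of "a *\<^sub>R q" "b *\<^sub>R r"] scale[of a q] scale[of b r] by (simp add: add.assoc)
qed

lemma hfield_zero: "hfield X \<Longrightarrow> X (centre X) = 0"
  using linear_0[OF hfield_linear, of X] by simp

lemma hfield_diff:
  assumes "hfield X" shows "X p - X q = X (centre X + (p - q))"
  using hfield_affine[OF assms, of 1 "p - centre X" "-1" "q - centre X"] by (simp add: algebra_simps)

lemma hfield_continuous: "hfield X \<Longrightarrow> continuous_on S X"
proof -
  assume "hfield X"
  then have "linear (\<lambda>q. X (centre X + q))" by (rule hfield_linear)
  then have "continuous_on UNIV (\<lambda>q. X (centre X + q))" by (rule linear_continuous_on[OF linear_conv_bounded_linear[THEN iffD1]])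
  then have "continuous_on UNIV (\<lambda>p. X (centre X + (p - centre X)))"
    by (rule continuous_on_compose2) (auto intro!: continuous_intros)
  then show ?thesis by (auto intro: continuous_on_subset)
qed

lemma hfield_minus: "hfield (\<lambda>p. - X p) \<longleftrightarrow> hfield X"
  and centre_minus: "centre (\<lambda>p. - X p) = centre X"
  and disc_minus: "disc (\<lambda>p. - X p) = disc X"
proof -
  have *: "central Y c d \<Longrightarrow> central (\<lambda>p. - Y p) c d" for Y c d
  proof -
    assume a: "central Y c d"
    then interpret linear "\<lambda>q. Y (c + q)" unfolding central_def by blast
    show "central (\<lambda>p. - Y p) c d"
      using a neg unfolding central_def by (simp add: linear_compose_neg)
  qed
  have "central (\<lambda>p. - X p) c d = central X c d" for c d
    using *[of X c d] *[of "\<lambda>p. - X p" c d] by auto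
  then have "central (\<lambda>p. - X p) = central X" by (intro ext)
  then show "hfield (\<lambda>p. - X p) \<longleftrightarrow> hfield X" "centre (\<lambda>p. - X p) = centre X" "disc (\<lambda>p. - X p) = disc X"
    unfolding hfield_def centre_def disc_def by simp_all
qed

lemma not_isolated_on_line:
  fixes p w :: "'a::real_normed_vector"
  assumes "w \<noteq> 0" and line: "\<And>s. p + s *\<^sub>R w \<in> S"
  shows "\<not> p isolated_in S"
proof
  assume "p isolated_in S"
  then obtain T where T: "open T" "T \<inter> S = {p}"
    unfolding isolated_in_def by blast
  then obtain e where e: "e > 0" "ball p e \<subseteq> T"
    using open_contains_ball by (metis Int_iff insertI1)
  define s where "s = e / (2 * norm w)"
  have s: "s > 0" "s * norm w < e" using e assms(1) by (simp_all add: s_def)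
  have "dist p (p + s *\<^sub>R w) = s * norm w" using s by (simp add: dist_norm)
  then have "p + s *\<^sub>R w \<in> T \<inter> S" using e s line by auto
  then show False using T s assms(1) by simp
qed

text \<open>
  The square of the linear part is \<open>a\<^sup>2 + b c\<close> times the identity. If this
  number were zero, the linear part would have a kernel, and the singular points would fill a
  line.
\<close>

lemma linear_hamiltonian_hfield:
  assumes "linear_hamiltonian X" "has_isolated_singular_point X"
  shows "hfield X"
proof -
  obtain a b c al be where X: "\<And>x y. X (x, y) = (a * x + b * y + al, c * x - a * y + be)"
    using assms(1) unfolding linear_hamiltonian_def by blast
  define d where "d = a * a + b * c"
  obtain x y where p: "(x, y) isolated_in {q. X q = 0}"
    using assms(2) unfolding has_isolated_singular_point_def by (metis surj_pair)
  then have z: "a * x + b * y + al = 0" "c * x - a * y + be = 0"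
    unfolding isolated_in_def by (simp_all add: X zero_prod_def)
  have "d \<noteq> 0"
  proof
    assume d: "d = 0"
    \<comment> \<open>a nonzero kernel vector of the linear part gives a line of zeros\<close>
    obtain k l where kl: "(k, l) \<noteq> (0, 0)" "a * k + b * l = 0" "c * k - a * l = 0"
    proof (cases "a = 0 \<and> b = 0")
      case True
      show ?thesis
      proof (cases "c = 0")
        case True
        then show ?thesis using that[of 1 0] \<open>a = 0 \<and> b = 0\<close> by simp
      next
        case False
        then show ?thesis using that[of 0 1] \<open>a = 0 \<and> b = 0\<close> by simp
      qed
    next
      case False
      then show ?thesis using that[of b "-a"] d by (auto simp: d_def algebra_simps)
    qed
    have line: "X ((x, y) + s *\<^sub>R (k, l)) = 0" for s
    proof -
      have "a * (x + s * k) + b * (y + s * l) + al = (a * x + b * y + al) + s * (a * k + b * l)"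
        "c * (x + s * k) - a * (y + s * l) + be = (c * x - a * y + be) + s * (c * k - a * l)"
        by (simp_all add: algebra_simps)
      then show ?thesis using z kl by (simp add: X zero_prod_def)
    qed
    have "(k, l) \<noteq> 0" using kl by (simp add: zero_prod_def)
    then show False using not_isolated_on_line[of "(k, l)" "(x, y)" "{q. X q = 0}"] line p by blast
  qed
  have lin: "X ((x, y) + (q1, q2)) = (a * q1 + b * q2, c * q1 - a * q2)" for q1 q2
    using z by (simp add: X algebra_simps)
  have lin': "(\<lambda>q. X ((x, y) + q)) = (\<lambda>q. (a * fst q + b * snd q, c * fst q - a * snd q))"
    by (intro ext) (metis lin prod.collapse)
  have "linear (\<lambda>q. X ((x, y) + q))"
    unfolding lin' by (rule linearI) (auto simp: algebra_simps)
  moreover have "X ((x, y) + X ((x, y) + q)) = d *\<^sub>R q" for q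
    unfolding fun_cong[OF lin'] by (cases q) (simp add: d_def algebra_simps)
  ultimately have "central X (x, y) d" unfolding central_def using \<open>d \<noteq> 0\<close> by blast
  then show ?thesis unfolding hfield_def by blast
qed

text \<open>
  The solutions of \<open>u'' = d u\<close> with initial data \<open>(1, 0)\<close> and
  \<open>(0, 1)\<close>, so that saddles and centers can be treated together. The second branches
  are meant for \<open>d < 0\<close>.
\<close>

definition gcos :: "real \<Rightarrow> real \<Rightarrow> real" where
  "gcos d t = (if d > 0 then cosh (sqrt d * t) else cos (sqrt (- d) * t))"

definition gsin :: "real \<Rightarrow> real \<Rightarrow> real" where
  "gsin d t = (if d > 0 then sinh (sqrt d * t) / sqrt d else sin (sqrt (- d) * t) / sqrt (- d))"

lemma gcos_0 [simp]: "gcos d 0 = 1" and gsin_0 [simp]: "gsin d 0 = 0"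
  and gcos_minus [simp]: "gcos d (- t) = gcos d t" and gsin_minus [simp]: "gsin d (- t) = - gsin d t"
  by (auto simp: gcos_def gsin_def)

lemma gcos_sq: "d \<noteq> 0 \<Longrightarrow> (gcos d t)\<^sup>2 - d * (gsin d t)\<^sup>2 = 1"
  using cosh_square_eq[of "sqrt d * t"] sin_cos_squared_add[of "sqrt (- d) * t"]
  by (auto simp: gcos_def gsin_def power_divide)

lemma gcos_add: "d \<noteq> 0 \<Longrightarrow> gcos d (s + t) = gcos d s * gcos d t + d * (gsin d s * gsin d t)"
  and gsin_add: "d \<noteq> 0 \<Longrightarrow> gsin d (s + t) = gsin d s * gcos d t + gcos d s * gsin d t"
proof -
  have r: "d > 0 \<Longrightarrow> sqrt d * sqrt d = d" "d < 0 \<Longrightarrow> sqrt (-d) * sqrt (-d) = - d" by simp_all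
  assume "d \<noteq> 0"
  then consider "d > 0" | "d < 0" by linarith
  then show "gcos d (s + t) = gcos d s * gcos d t + d * (gsin d s * gsin d t)"
    by cases (use r in \<open>auto simp: gcos_def gsin_def distrib_left cosh_add cos_add\<close>)
  show "gsin d (s + t) = gsin d s * gcos d t + gcos d s * gsin d t"
    by (auto simp: gcos_def gsin_def distrib_left sinh_add sin_add add_divide_distrib)
qed

lemma gcos_deriv [derivative_intros]:
  assumes "d \<noteq> 0" "(f has_real_derivative f') (at t within S)"
  shows "((\<lambda>t. gcos d (f t)) has_real_derivative d * gsin d (f t) * f') (at t within S)"
proof -
  have "(gcos d has_real_derivative d * gsin d u) (at u)" for u
  proof (cases "d > 0")
    case True
    have "((\<lambda>u. cosh (sqrt d * u)) has_real_derivative sinh (sqrt d * u) * sqrt d) (at u)"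
      by (auto intro!: derivative_eq_intros)
    moreover have "sinh (sqrt d * u) * sqrt d = d * gsin d u"
      using True by (simp add: gsin_def field_simps)
    ultimately show ?thesis using True by (simp add: gcos_def[abs_def])
  next
    case False
    with assms have "d < 0" by simp
    have "((\<lambda>u. cos (sqrt (-d) * u)) has_real_derivative - (sin (sqrt (-d) * u) * sqrt (-d))) (at u)"
      by (auto intro!: derivative_eq_intros)
    moreover have "sqrt (-d) * sqrt (-d) = - d" using \<open>d < 0\<close> by simp
    then have "- (sin (sqrt (-d) * u) * sqrt (-d)) * sqrt (-d) = d * sin (sqrt (-d) * u)"
      by (metis (no_types, opaque_lifting) minus_mult_minus mult.assoc mult.commute mult_minus_left)
    then have "- (sin (sqrt (-d) * u) * sqrt (-d)) = d * gsin d u"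
      using \<open>d < 0\<close> by (simp add: gsin_def eq_divide_eq)
    ultimately show ?thesis using False by (simp add: gcos_def[abs_def])
  qed
  from DERIV_chain2[OF this assms(2)] show ?thesis by simp
qed

lemma gsin_deriv [derivative_intros]:
  assumes "d \<noteq> 0" "(f has_real_derivative f') (at t within S)"
  shows "((\<lambda>t. gsin d (f t)) has_real_derivative gcos d (f t) * f') (at t within S)"
proof -
  have "(gsin d has_real_derivative gcos d u) (at u)" for u
  proof (cases "d > 0")
    case True
    have "((\<lambda>u. sinh (sqrt d * u) / sqrt d) has_real_derivative cosh (sqrt d * u) * sqrt d / sqrt d) (at u)"
      by (intro DERIV_cdivide) (auto intro!: derivative_eq_intros)
    then show ?thesis using True by (simp add: gcos_def gsin_def[abs_def])
  next
    case False
    have "((\<lambda>u. sin (sqrt (-d) * u) / sqrt (-d)) has_real_derivative cos (sqrt (-d) * u) * sqrt (-d) / sqrt (-d)) (at u)"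
      by (intro DERIV_cdivide) (auto intro!: derivative_eq_intros)
    then show ?thesis using False assms(1) by (simp add: gcos_def gsin_def[abs_def])
  qed
  from DERIV_chain2[OF this assms(2)] show ?thesis by simp
qed

lemma gcos_continuous [continuous_intros]:
  fixes f :: "'a::t2_space \<Rightarrow> real"
  shows "continuous_on S f \<Longrightarrow> continuous_on S (\<lambda>x. gcos d (f x))"
  and gsin_continuous [continuous_intros]:
  "continuous_on S f \<Longrightarrow> continuous_on S (\<lambda>x. gsin d (f x))"
proof -
  assume f: "continuous_on S f"
  have m: "continuous_on S (\<lambda>x. c * f x)" for c
    by (intro continuous_intros f)
  show "continuous_on S (\<lambda>x. gcos d (f x))"
    unfolding gcos_def
    using continuous_on_cosh[OF m[of "sqrt d"]] continuous_on_cos[OF m[of "sqrt (- d)"]]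
    by (cases "d > 0") (simp_all only: if_True if_False)
  have "continuous_on S (\<lambda>x. sin (sqrt (-d) * f x) * inverse (sqrt (-d)))"
       "continuous_on S (\<lambda>x. sinh (sqrt d * f x) * inverse (sqrt d))"
    by (intro continuous_on_mult_right continuous_on_sin continuous_on_sinh m)+
  then show "continuous_on S (\<lambda>x. gsin d (f x))"
    unfolding gsin_def divide_inverse by (cases "d > 0") (simp_all only: if_True if_False)
qed

text \<open>
  The exponential of \<open>t A\<close> for a linear map \<open>A\<close> with
  \<open>A\<^sup>2 = d I\<close>, applied to the vector from the singular point
  \<open>c\<close> to \<open>p\<close>.
\<close>

definition flow :: "(plane \<Rightarrow> plane) \<Rightarrow> real \<Rightarrow> plane \<Rightarrow> plane" where
  "flow X t p = centre X + gcos (disc X) t *\<^sub>R (p - centre X) + gsin (disc X) t *\<^sub>R X p"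

lemma flow_0 [simp]: "flow X 0 p = p"
  by (simp add: flow_def)

lemma flow_field:
  assumes "hfield X"
  shows "X (flow X t p) = gcos (disc X) t *\<^sub>R X p + (disc X * gsin (disc X) t) *\<^sub>R (p - centre X)"
  using hfield_affine[OF assms, of "gcos (disc X) t" "p - centre X" "gsin (disc X) t" "X p"] hfield_square[OF assms, of p]
  unfolding flow_def by (simp add: algebra_simps)

lemma flow_add:
  assumes "hfield X" shows "flow X (s + t) p = flow X s (flow X t p)"
  unfolding flow_def[of X s "flow X t p"] flow_field[OF assms]
  unfolding flow_def
  by (simp add: gcos_add gsin_add hfield_disc[OF assms] algebra_simps)

lemma flow_minus: "flow (\<lambda>p. - X p) t p = flow X (- t) p"
  by (simp add: flow_def centre_minus disc_minus)

lemma flow_deriv: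
  assumes "hfield X"
  shows "((\<lambda>t. flow X t p) has_vector_derivative X (flow X t p)) (at t within S)"
proof -
  let ?d = "disc X"
  have c: "(gcos ?d has_real_derivative ?d * gsin ?d t) (at t within S)"
    "(gsin ?d has_real_derivative gcos ?d t) (at t within S)"
    using gcos_deriv[of ?d "\<lambda>t. t" 1 t S] gsin_deriv[of ?d "\<lambda>t. t" 1 t S] hfield_disc[OF assms] by simp_all
  show ?thesis
    unfolding flow_field[OF assms] unfolding flow_def
    by (rule has_vector_derivative_eq_rhs,
        (rule has_vector_derivative_add has_vector_derivative_scaleR has_vector_derivative_const c)+, simp)
qed

lemma flow_continuous:
  fixes f :: "'a::t2_space \<Rightarrow> real"
  assumes X: "hfield X" and f: "continuous_on S f" and h: "continuous_on S h"
  shows "continuous_on S (\<lambda>x. flow X (f x) (h x))"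
proof -
  have "continuous_on S (\<lambda>x. X (h x))"
    by (rule continuous_on_compose2[OF hfield_continuous[OF X, of UNIV] h]) simp
  then show ?thesis
    unfolding flow_def by (intro continuous_intros f h)
qed

lemma flow_pos:
  "v \<bullet> flow X t p - v \<bullet> centre X
     = gcos (disc X) t * (v \<bullet> p - v \<bullet> centre X) + gsin (disc X) t * (v \<bullet> X p)"
  unfolding flow_def by (simp add: inner_add_right inner_diff_right)

lemma flow_vel:
  "hfield X \<Longrightarrow> v \<bullet> X (flow X t p)
     = gcos (disc X) t * (v \<bullet> X p) + disc X * gsin (disc X) t * (v \<bullet> p - v \<bullet> centre X)"
  unfolding flow_field by (simp add: inner_add_right inner_diff_right)

lemma flow_pos_deriv:
  assumes "hfield X"
  shows "((\<lambda>t. v \<bullet> flow X t p) has_real_derivative v \<bullet> X (flow X t p)) (at t within S)"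
  using bounded_linear.has_vector_derivative[OF bounded_linear_inner_right flow_deriv[OF assms], of v p t S]
  by (simp add: has_real_derivative_iff_has_vector_derivative)

lemma flow_vel_deriv:
  assumes "hfield X"
  shows "((\<lambda>t. v \<bullet> X (flow X t p)) has_real_derivative disc X * (v \<bullet> flow X t p - v \<bullet> centre X)) (at t within S)"
proof -
  let ?d = "disc X"
  have "((\<lambda>t. gcos ?d t * (v \<bullet> X p) + gsin ?d t * (?d * (v \<bullet> p - v \<bullet> centre X))) has_real_derivative
     ?d * gsin ?d t * (v \<bullet> X p) + gcos ?d t * (?d * (v \<bullet> p - v \<bullet> centre X))) (at t within S)"
    using gcos_deriv[of ?d "\<lambda>t. t" 1 t S] gsin_deriv[of ?d "\<lambda>t. t" 1 t S] hfield_disc[OF assms]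
    by (intro DERIV_add DERIV_cmult_right) simp_all
  then show ?thesis unfolding flow_vel[OF assms] flow_pos by (simp add: algebra_simps)
qed

lemma flow_pos_continuous: "hfield X \<Longrightarrow> continuous_on S (\<lambda>t. v \<bullet> flow X t p)"
  and flow_vel_continuous: "hfield X \<Longrightarrow> continuous_on S (\<lambda>t. v \<bullet> X (flow X t p))"
  by (rule DERIV_continuous_on[OF flow_pos_deriv], assumption)
     (rule DERIV_continuous_on[OF flow_vel_deriv], assumption)

text \<open>
  The first integral of the equation \<open>x'' = d (x - v \<bullet> c)\<close> for the
  position \<open>x = v \<bullet> p\<close> along an orbit.
\<close>

definition energy :: "plane \<Rightarrow> (plane \<Rightarrow> plane) \<Rightarrow> plane \<Rightarrow> real" where
  "energy v X p = (v \<bullet> X p)\<^sup>2 - disc X * (v \<bullet> p - v \<bullet> centre X)\<^sup>2"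

lemma energy_flow:
  assumes "hfield X" shows "energy v X (flow X t p) = energy v X p"
proof -
  let ?d = "disc X" let ?C = "gcos ?d t" let ?S = "gsin ?d t"
  let ?x = "v \<bullet> p - v \<bullet> centre X" and ?z = "v \<bullet> X p"
  have "energy v X (flow X t p) = (?C * ?z + ?d * ?S * ?x)\<^sup>2 - ?d * (?C * ?x + ?S * ?z)\<^sup>2"
    unfolding energy_def flow_pos flow_vel[OF assms] ..
  also have "\<dots> = (?C\<^sup>2 - ?d * ?S\<^sup>2) * (?z\<^sup>2 - ?d * ?x\<^sup>2)"
    by (simp add: power2_eq_square algebra_simps)
  also have "\<dots> = energy v X p"
    using gcos_sq[OF hfield_disc[OF assms]] unfolding energy_def by simp
  finally show ?thesis .
qed

text \<open>
  Uniqueness of solutions: a solution that is transported back to its starting time by the flow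
  has derivative zero.
\<close>

lemma solution_is_flow:
  assumes X: "hfield X" and g: "continuous_on {s..e} g"
    and d: "\<And>t. s < t \<Longrightarrow> t < e \<Longrightarrow> (g has_vector_derivative X (g t)) (at t)"
    and t: "t \<in> {s..e}"
  shows "g t = flow X (t - s) (g s)"
proof -
  let ?c = "centre X" and ?d = "disc X"
  define h where "h t = flow X (- t) (g t)" for t
  have hd: "(h has_vector_derivative 0) (at t)" if "s < t" "t < e" for t
  proof -
    have gd: "(g has_vector_derivative X (g t)) (at t)" using d that by simp
    have lin: "bounded_linear (\<lambda>q. X (?c + q))"
      using hfield_linear[OF X] linear_conv_bounded_linear by blast
    have gc: "((\<lambda>t. g t - ?c) has_vector_derivative X (g t)) (at t)"
      using gd by (auto intro!: derivative_eq_intros)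
    from bounded_linear.has_vector_derivative[OF lin gc]
    have Xd: "((\<lambda>t. X (g t)) has_vector_derivative ?d *\<^sub>R (g t - ?c)) (at t)"
      using hfield_square[OF X] by simp
    have um: "(uminus has_real_derivative -1) (at t)"
      using DERIV_minus[OF DERIV_ident, of t UNIV] by simp
    have cd: "((\<lambda>t. gcos ?d (- t)) has_real_derivative - (?d * gsin ?d (- t))) (at t)"
      "((\<lambda>t. gsin ?d (- t)) has_real_derivative - gcos ?d (- t)) (at t)"
      using gcos_deriv[OF hfield_disc[OF X] um] gsin_deriv[OF hfield_disc[OF X] um] by simp_all
    have "(h has_vector_derivative
       0 + (gcos ?d (- t) *\<^sub>R X (g t) + (- (?d * gsin ?d (- t))) *\<^sub>R (g t - ?c))
       + (gsin ?d (- t) *\<^sub>R (?d *\<^sub>R (g t - ?c)) + (- gcos ?d (- t)) *\<^sub>R X (g t))) (at t)"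
      unfolding h_def[abs_def] flow_def
      by (intro has_vector_derivative_add has_vector_derivative_scaleR has_vector_derivative_const cd Xd gc)
    then show ?thesis by (simp add: algebra_simps)
  qed
  have "h t = h s"
  proof (cases "s = t")
    case False
    have hc: "continuous_on {s..t} h"
      unfolding h_def using t g by (intro flow_continuous X continuous_intros) (auto intro: continuous_on_subset)
    have "\<exists>u\<in>{s<..<t}. norm (h t - h s) \<le> norm ((\<lambda>x. x *\<^sub>R (0::plane)) (t - s))"
      using False t hc hd
      by (intro mvt_general) (auto simp: has_vector_derivative_def)
    then show ?thesis by simp
  qed simp
  then have "flow X t (flow X (- t) (g t)) = flow X t (flow X (- s) (g s))"
    by (simp add: h_def)
  then show ?thesis by (simp add: flow_add[OF X, symmetric])
qed

lemma flow_return_shift: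
  assumes "hfield X" "flow X s p = flow X t p"
  shows "flow X (t - s) p = p"
proof -
  have "flow X (- s) (flow X t p) = flow X (- s) (flow X s p)" using assms by simp
  then show ?thesis by (simp add: flow_add[OF assms(1), symmetric])
qed

section \<open>Excursions and crossings\<close>

definition perp :: "plane \<Rightarrow> plane" where
  "perp v = (- snd v, fst v)"

lemma inner_perp [simp]: "v \<bullet> perp v = 0" "perp v \<bullet> v = 0" "perp v = 0 \<longleftrightarrow> v = 0"
  by (auto simp: perp_def inner_prod_def prod_eq_iff)

lemma perp_decomposition:
  assumes "v \<noteq> 0"
  shows "r = (v \<bullet> r / (v \<bullet> v)) *\<^sub>R v + (perp v \<bullet> r / (v \<bullet> v)) *\<^sub>R perp v"
proof -
  have n: "v \<bullet> v \<noteq> 0" using assms by simp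
  have "(v \<bullet> v) *\<^sub>R r = (v \<bullet> r) *\<^sub>R v + (perp v \<bullet> r) *\<^sub>R perp v"
    by (cases v; cases r) (simp add: perp_def algebra_simps)
  then have "inverse (v \<bullet> v) *\<^sub>R (v \<bullet> v) *\<^sub>R r = inverse (v \<bullet> v) *\<^sub>R ((v \<bullet> r) *\<^sub>R v + (perp v \<bullet> r) *\<^sub>R perp v)"
    by simp
  then show ?thesis using n by (simp add: scaleR_add_right divide_inverse mult.commute)
qed

text \<open>
  Position across the lines and velocity across the lines are coordinates of the plane. This fails
  exactly if the lines are permuted by the flow, because then the velocity is a function of the
  position.
\<close>

definition nondeg :: "plane \<Rightarrow> (plane \<Rightarrow> plane) \<Rightarrow> bool" where
  "nondeg v X \<longleftrightarrow> (\<forall>p q. v \<bullet> p = v \<bullet> q \<longrightarrow> v \<bullet> X p = v \<bullet> X q \<longrightarrow> p = q)"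

lemma nondegD: "nondeg v X \<Longrightarrow> v \<bullet> p = v \<bullet> q \<Longrightarrow> v \<bullet> X p = v \<bullet> X q \<Longrightarrow> p = q"
  unfolding nondeg_def by blast

lemma nondeg_minus [simp]: "nondeg (- v) X = nondeg v X" "nondeg v (\<lambda>p. - X p) = nondeg v X"
  unfolding nondeg_def by simp_all

lemma field_sum:
  assumes "hfield X" "p + q = p' + q'"
  shows "X p + X q = X p' + X q'"
proof -
  have "p - p' = q' - q" using assms(2) by (simp add: algebra_simps)
  then have "X p - X p' = X q' - X q" by (simp add: hfield_diff[OF assms(1)])
  then show ?thesis by (simp add: algebra_simps)
qed

lemma field_on_line:
  assumes "hfield X"
  shows "X (r + \<mu> *\<^sub>R w) = X r + \<mu> *\<^sub>R X (centre X + w)"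
  using hfield_diff[OF assms, of "r + \<mu> *\<^sub>R w" r] hfield_affine[OF assms, of \<mu> w 0 w] by (simp add: algebra_simps)

lemma nondeg_iff_perp:
  assumes X: "hfield X" and v: "v \<noteq> 0"
  shows "nondeg v X \<longleftrightarrow> v \<bullet> X (centre X + perp v) \<noteq> 0"
proof
  assume nd: "nondeg v X"
  show "v \<bullet> X (centre X + perp v) \<noteq> 0"
  proof
    assume "v \<bullet> X (centre X + perp v) = 0"
    then have "centre X + perp v = centre X"
      by (intro nondegD[OF nd]) (simp_all add: inner_add_right hfield_zero[OF X])
    then show False using v by simp
  qed
next
  assume nz: "v \<bullet> X (centre X + perp v) \<noteq> 0"
  show "nondeg v X"
    unfolding nondeg_def
  proof (intro allI impI)
    fix p q assume x: "v \<bullet> p = v \<bullet> q" and z: "v \<bullet> X p = v \<bullet> X q"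
    define \<mu> where "\<mu> = perp v \<bullet> (p - q) / (v \<bullet> v)"
    have pq: "p = q + \<mu> *\<^sub>R perp v"
      using perp_decomposition[OF v, of "p - q"] x by (simp add: \<mu>_def inner_diff_right algebra_simps)
    have "\<mu> * (v \<bullet> X (centre X + perp v)) = 0"
      using z unfolding pq field_on_line[OF X] by (simp add: inner_add_right)
    then show "p = q" using nz pq by simp
  qed
qed

lemma degenerate_velocity:
  assumes X: "hfield X" and v: "v \<noteq> 0" and deg: "\<not> nondeg v X"
  obtains k where "k \<noteq> 0" "\<And>p. v \<bullet> X p = k * (v \<bullet> p - v \<bullet> centre X)"
proof -
  define k where "k = v \<bullet> X (centre X + v) / (v \<bullet> v)"
  have vv: "v \<bullet> v \<noteq> 0" using v by simp
  have vel: "v \<bullet> X p = k * (v \<bullet> p - v \<bullet> centre X)" for p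
  proof -
    define a b where "a = v \<bullet> (p - centre X) / (v \<bullet> v)" and "b = perp v \<bullet> (p - centre X) / (v \<bullet> v)"
    have "p = centre X + a *\<^sub>R v + b *\<^sub>R perp v"
      using perp_decomposition[OF v, of "p - centre X"] unfolding a_def b_def by (metis add.commute add.left_commute diff_add_cancel)
    then have "v \<bullet> X p = a * (v \<bullet> X (centre X + v)) + b * (v \<bullet> X (centre X + perp v))"
      using hfield_affine[OF X, of a v b "perp v"] by (simp add: inner_add_right)
    also have "\<dots> = a * (v \<bullet> X (centre X + v))"
      using deg nondeg_iff_perp[OF X v] by simp
    also have "\<dots> = k * (v \<bullet> p - v \<bullet> centre X)"
      by (simp add: k_def a_def inner_diff_right)
    finally show ?thesis .
  qed
  have "k \<noteq> 0"
  proof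
    assume "k = 0"
    then have "v \<bullet> X (centre X + X (centre X + v)) = 0" using vel by simp
    then show False using hfield_square[OF X, of "centre X + v"] hfield_disc[OF X] vv by simp
  qed
  with vel that show ?thesis by blast
qed

text \<open>
  The point with position \<open>l\<close> and velocity \<open>z\<close>, found on the line by
  moving from its foot point in the direction of the line; the velocity is an affine function
  along the line.
\<close>

definition level_point :: "plane \<Rightarrow> (plane \<Rightarrow> plane) \<Rightarrow> real \<Rightarrow> real \<Rightarrow> plane" where
  "level_point v X l z = (l / (v \<bullet> v)) *\<^sub>R v
     + ((z - v \<bullet> X ((l / (v \<bullet> v)) *\<^sub>R v)) / (v \<bullet> X (centre X + perp v))) *\<^sub>R perp v"

lemma level_point:
  assumes X: "hfield X" and v: "v \<noteq> 0" and nd: "nondeg v X"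
  shows "v \<bullet> level_point v X l z = l" "v \<bullet> X (level_point v X l z) = z"
  using v nd unfolding nondeg_iff_perp[OF X v] level_point_def field_on_line[OF X]
  by (simp_all add: inner_add_right)

lemma level_point_unique:
  assumes "hfield X" "v \<noteq> 0" "nondeg v X"
  shows "p = level_point v X (v \<bullet> p) (v \<bullet> X p)"
  by (rule nondegD[OF assms(3)]) (simp_all add: level_point[OF assms])

lemma level_point_tendsto:
  assumes "(f \<longlongrightarrow> z) F"
  shows "((\<lambda>x. level_point v X l (f x)) \<longlongrightarrow> level_point v X l z) F"
  unfolding level_point_def divide_inverse by (intro tendsto_intros assms)

lemma energy_minus [simp]: "energy (- v) X = energy v X"
  by (rule ext) (simp add: energy_def power2_commute)

text \<open>
  An excursion into the half plane \<open>v \<bullet> p < l\<close>. Excursions into the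
  opposite half plane arise from the normal vector \<open>- v\<close> and the level
  \<open>- l\<close>.
\<close>

definition exc :: "plane \<Rightarrow> real \<Rightarrow> (plane \<Rightarrow> plane) \<Rightarrow> plane \<Rightarrow> real \<Rightarrow> bool" where
  "exc v l X p T \<longleftrightarrow> 0 < T \<and> v \<bullet> p = l \<and> v \<bullet> flow X T p = l \<and> (\<forall>t\<in>{0<..<T}. v \<bullet> flow X t p < l)"

text \<open>
  A crossing of the strip from the level \<open>l\<close> to the level \<open>m\<close>. Crossings
  in the opposite direction have normal vector \<open>- v\<close> and lead from
  \<open>- m\<close> to \<open>- l\<close>.
\<close>

definition cross :: "plane \<Rightarrow> real \<Rightarrow> real \<Rightarrow> (plane \<Rightarrow> plane) \<Rightarrow> plane \<Rightarrow> real \<Rightarrow> bool" where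
  "cross v l m X p T \<longleftrightarrow> 0 < T \<and> v \<bullet> p = l \<and> v \<bullet> flow X T p = m
     \<and> (\<forall>t\<in>{0<..<T}. l < v \<bullet> flow X t p \<and> v \<bullet> flow X t p < m)"

text \<open>
  Conservation of energy determines the final velocity up to its sign, and an orbit on one side of
  the line leaves it with velocity at most zero and comes back with velocity at least zero.
\<close>

lemma exc_velocity:
  assumes X: "hfield X" and e: "exc v l X p T"
  shows "v \<bullet> X p \<le> 0" "v \<bullet> X (flow X T p) = - (v \<bullet> X p)"
proof -
  have T: "0 < T" and ends: "v \<bullet> p = l" "v \<bullet> flow X T p = l"
    and lt: "\<And>t. 0 < t \<Longrightarrow> t < T \<Longrightarrow> v \<bullet> flow X t p < l"
    using e unfolding exc_def by auto
  note D = flow_pos_deriv[OF X, of v p _ UNIV]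
  show le: "v \<bullet> X p \<le> 0"
  proof (rule ccontr)
    assume "\<not> ?thesis"
    then obtain d where d: "d > 0" "\<And>h. 0 < h \<Longrightarrow> h < d \<Longrightarrow> v \<bullet> flow X 0 p < v \<bullet> flow X (0 + h) p"
      using DERIV_pos_inc_right[OF D[of 0]] by auto
    define h where "h = min (d / 2) (T / 2)"
    have "0 < h" "h < d" "h < T" using d(1) T by (auto simp: h_def)
    then show False using d(2)[of h] lt[of h] ends by simp
  qed
  have ge: "v \<bullet> X (flow X T p) \<ge> 0"
  proof (rule ccontr)
    assume "\<not> ?thesis"
    then obtain d where d: "d > 0" "\<And>h. 0 < h \<Longrightarrow> h < d \<Longrightarrow> v \<bullet> flow X T p < v \<bullet> flow X (T - h) p"
      using DERIV_neg_dec_left[OF D[of T]] by auto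
    define h where "h = min (d / 2) (T / 2)"
    have "0 < h" "h < d" "h < T" using d(1) T by (auto simp: h_def)
    then show False using d(2)[of h] lt[of "T - h"] ends by simp
  qed
  have "(v \<bullet> X (flow X T p))\<^sup>2 = (v \<bullet> X p)\<^sup>2"
    using energy_flow[OF X, of v T p] ends unfolding energy_def by simp
  then show "v \<bullet> X (flow X T p) = - (v \<bullet> X p)"
    using le ge by (auto simp: power2_eq_iff)
qed

text \<open>
  An excursion that starts tangentially to the line also ends tangentially, at the same level. As
  the level is not that of the singular point, the time of the excursion is a period of the flow.
\<close>

lemma exc_closed:
  assumes X: "hfield X" and e: "exc v l X p T" and z: "v \<bullet> X p = 0"
  shows "flow X T p = p"
proof -
  let ?d = "disc X"
  have T: "0 < T" and ends: "v \<bullet> p = l" "v \<bullet> flow X T p = l"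
    and lt: "\<And>t. 0 < t \<Longrightarrow> t < T \<Longrightarrow> v \<bullet> flow X t p < l"
    using e unfolding exc_def by auto
  have "l \<noteq> v \<bullet> centre X"
    using lt[of "T / 2"] T flow_pos[of v X "T / 2" p] ends z by auto
  moreover have "l - v \<bullet> centre X = gcos ?d T * (l - v \<bullet> centre X)"
    using flow_pos[of v X T p] ends z by simp
  ultimately have c: "gcos ?d T = 1" by simp
  then have "gsin ?d T = 0"
    using gcos_sq[OF hfield_disc[OF X], of T] hfield_disc[OF X] by simp
  with c show ?thesis by (simp add: flow_def)
qed

text \<open>
  In the degenerate case the velocity depends on the position only, so that the opposite end
  velocities vanish. The line then contains the singular point and is invariant.
\<close>

lemma exc_nondeg:
  assumes X: "hfield X" and v: "v \<noteq> 0" and e: "exc v l X p T"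
  shows "nondeg v X"
proof (rule ccontr)
  assume "\<not> nondeg v X"
  then obtain k where k: "k \<noteq> 0" "\<And>p. v \<bullet> X p = k * (v \<bullet> p - v \<bullet> centre X)"
    using degenerate_velocity[OF X v] by blast
  have T: "0 < T" and ends: "v \<bullet> p = l" "v \<bullet> flow X T p = l"
    and lt: "v \<bullet> flow X (T / 2) p < l"
    using e unfolding exc_def by auto
  have "v \<bullet> X p = 0" using exc_velocity(2)[OF X e] k(2) ends by simp
  then have "l = v \<bullet> centre X" using k ends by simp
  then have "v \<bullet> flow X (T / 2) p = l"
    using flow_pos[of v X "T / 2" p] \<open>v \<bullet> X p = 0\<close> ends by simp
  with lt show False by simp
qed

text \<open>
  By affinity the reflected point \<open>p + flow X T p - p'\<close> has the velocity of
  the end of the second excursion, and it lies on the same line.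
\<close>

lemma exc_sum:
  assumes X: "hfield X" and v: "v \<noteq> 0" and e: "exc v l X p T" "exc v l X p' T'"
  shows "p + flow X T p = p' + flow X T' p'"
proof -
  have "flow X T' p' = p + flow X T p - p'"
  proof (rule nondegD[OF exc_nondeg[OF X v e(1)]])
    show "v \<bullet> flow X T' p' = v \<bullet> (p + flow X T p - p')"
      using e unfolding exc_def by (simp add: inner_diff_right inner_add_right)
    have "X (p + flow X T p - p') + X p' = X p + X (flow X T p)"
      by (rule field_sum[OF X]) simp
    then have "v \<bullet> X (p + flow X T p - p') + v \<bullet> X p' = v \<bullet> X p + v \<bullet> X (flow X T p)"
      by (metis inner_add_right)
    then show "v \<bullet> X (flow X T' p') = v \<bullet> X (p + flow X T p - p')"
      using exc_velocity(2)[OF X e(1)] exc_velocity(2)[OF X e(2)] by simp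
  qed
  then show ?thesis by simp
qed

lemma exc_turning_time:
  assumes X: "hfield X" and e: "exc v l X p T"
  obtains t where "0 < t" "t < T" "v \<bullet> X (flow X t p) = 0"
proof -
  have T: "0 < T" and ends: "v \<bullet> flow X 0 p = v \<bullet> flow X T p"
    using e unfolding exc_def by auto
  have D: "((\<lambda>t. v \<bullet> flow X t p) has_derivative (\<lambda>h. v \<bullet> X (flow X t p) * h)) (at t)" for t
    using flow_pos_deriv[OF X, of v p t UNIV] by (simp add: has_field_derivative_def)
  obtain t where "0 < t" "t < T" "(\<lambda>h. v \<bullet> X (flow X t p) * h) = (\<lambda>h. 0)"
    using Rolle_deriv[OF T ends flow_pos_continuous[OF X] D] by blast
  then have "v \<bullet> X (flow X t p) = 0" by (metis mult.right_neutral)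
  with that \<open>0 < t\<close> \<open>t < T\<close> show ?thesis by blast
qed

lemma turning_energy:
  assumes X: "hfield X" and z: "v \<bullet> X (flow X t p) = 0"
  shows "energy v X p + disc X * (v \<bullet> flow X t p - v \<bullet> centre X)\<^sup>2 = 0"
  using energy_flow[OF X, of v t p] z unfolding energy_def by simp

text \<open>
  The position along an orbit is an even function of the time that has passed since a turning
  point.
\<close>

lemma flow_turning_symmetric:
  assumes X: "hfield X" and z: "v \<bullet> X (flow X t p) = 0"
  shows "v \<bullet> flow X (t + s) p = v \<bullet> flow X (t - s) p"
proof -
  have "flow X (t + s) p = flow X s (flow X t p)" "flow X (t - s) p = flow X (- s) (flow X t p)"
    by (simp_all add: flow_add[OF X, symmetric] add.commute)
  then show ?thesis using flow_pos[of v X s "flow X t p"] flow_pos[of v X "- s" "flow X t p"] z by simp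
qed

text \<open>
  If the orbit turned at some time inside the strip, the symmetry about this time would carry the
  nearer of the two ends to an interior time, or exchange the two ends.
\<close>

lemma cross_velocity:
  assumes X: "hfield X" and lm: "l < m" and c: "cross v l m X p T"
  shows "\<And>t. 0 < t \<Longrightarrow> t < T \<Longrightarrow> v \<bullet> X (flow X t p) > 0"
    and "v \<bullet> X p \<ge> 0" "v \<bullet> X (flow X T p) \<ge> 0"
proof -
  have T: "0 < T" and ends: "v \<bullet> p = l" "v \<bullet> flow X T p = m"
    and lt: "\<And>t. 0 < t \<Longrightarrow> t < T \<Longrightarrow> l < v \<bullet> flow X t p \<and> v \<bullet> flow X t p < m"
    using c unfolding cross_def by auto
  have nz: "v \<bullet> X (flow X t p) \<noteq> 0" if t: "0 < t" "t < T" for t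
  proof
    assume z: "v \<bullet> X (flow X t p) = 0"
    note sym = flow_turning_symmetric[OF X z]
    show False
    proof (cases "t \<le> T - t")
      case True
      then have "v \<bullet> flow X (t + t) p = l" using sym[of t] ends by simp
      then show False using lt[of "t + t"] t True ends lm by (cases "t + t = T") auto
    next
      case False
      then have "v \<bullet> flow X (t - (T - t)) p = m" using sym[of "T - t"] ends by simp
      then show False using lt[of "t - (T - t)"] t False by auto
    qed
  qed
  obtain t0 where t0: "0 < t0" "t0 < T" "m - l = (T - 0) * (v \<bullet> X (flow X t0 p))"
    using MVT2[OF T, of "\<lambda>t. v \<bullet> flow X t p" "\<lambda>t. v \<bullet> X (flow X t p)"] flow_pos_deriv[OF X] ends by auto
  then have p0: "v \<bullet> X (flow X t0 p) > 0"
    using lm T by (metis diff_gt_0_iff_gt diff_zero zero_less_mult_pos)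
  show pos: "v \<bullet> X (flow X t p) > 0" if t: "0 < t" "t < T" for t
  proof (rule ccontr)
    assume "\<not> ?thesis"
    then have neg: "v \<bullet> X (flow X t p) \<le> 0" by simp
    have cont: "continuous_on S (\<lambda>t. v \<bullet> X (flow X t p))" for S by (rule flow_vel_continuous[OF X])
    have "\<exists>s. min t t0 \<le> s \<and> s \<le> max t t0 \<and> v \<bullet> X (flow X s p) = 0"
    proof (cases "t \<le> t0")
      case True
      then show ?thesis using IVT'[OF neg _ True cont] p0 by auto
    next
      case False
      then show ?thesis using IVT2'[OF neg _ _ cont, of t0] p0 by auto
    qed
    then show False using nz t t0 by (metis less_le_trans le_less_trans max_def min_def)
  qed
  have cont: "continuous_on {0..T} (\<lambda>t. v \<bullet> X (flow X t p))" by (rule flow_vel_continuous[OF X])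
  have "v \<bullet> X (flow X t p) \<ge> 0" if "t \<in> {0..T}" for t
    using continuous_ge_on_Ioo[OF cont _ T that, of 0] pos by force
  from this[of 0] this[of T] T show "v \<bullet> X p \<ge> 0" "v \<bullet> X (flow X T p) \<ge> 0" by auto
qed

lemma cross_barrier:
  assumes X: "hfield X" and c: "cross v l m X p T" and xi: "l < \<xi>" "\<xi> < m"
  shows "energy v X p + disc X * (\<xi> - v \<bullet> centre X)\<^sup>2 > 0"
proof -
  have lm: "l < m" using xi by simp
  have T: "0 < T" and ends: "v \<bullet> flow X 0 p = l" "v \<bullet> flow X T p = m"
    using c unfolding cross_def by auto
  obtain t where t: "0 \<le> t" "t \<le> T" "v \<bullet> flow X t p = \<xi>"
    using IVT'[OF _ _ _ flow_pos_continuous[OF X], of v 0 p \<xi> T] T ends xi by auto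
  then have "t \<noteq> 0" "t \<noteq> T" using ends xi by auto
  then have "v \<bullet> X (flow X t p) > 0" using cross_velocity(1)[OF X lm c] t by simp
  then have "(v \<bullet> X (flow X t p))\<^sup>2 > 0" by simp
  moreover have "energy v X p = (v \<bullet> X (flow X t p))\<^sup>2 - disc X * (\<xi> - v \<bullet> centre X)\<^sup>2"
    using energy_flow[OF X, of v t p] t(3) unfolding energy_def by simp
  ultimately show ?thesis by simp
qed

text \<open>
  An excursion into the strip turns back at an interior level, at which no kinetic energy is left,
  whereas a crossing passes this level with a velocity other than zero.
\<close>

lemma exc_energy_less_cross:
  assumes X: "hfield X" and e: "exc v l X p T" and lo: "\<And>t. 0 < t \<Longrightarrow> t < T \<Longrightarrow> m < v \<bullet> flow X t p"
    and c: "cross v m l X q S \<or> cross (- v) (- l) (- m) X q S"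
  shows "energy v X p < energy v X q"
proof -
  obtain t where t: "0 < t" "t < T" "v \<bullet> X (flow X t p) = 0" by (rule exc_turning_time[OF X e])
  let ?x = "v \<bullet> flow X t p"
  have x: "m < ?x" "?x < l" using lo t e unfolding exc_def by auto
  have "energy v X q + disc X * (?x - v \<bullet> centre X)\<^sup>2 > 0"
    using c
  proof
    assume "cross v m l X q S" then show ?thesis by (rule cross_barrier[OF X _ x])
  next
    assume "cross (- v) (- l) (- m) X q S"
    from cross_barrier[OF X this, of "- ?x"] x show ?thesis by (simp add: power2_commute)
  qed
  with turning_energy[OF X t(3)] show ?thesis by simp
qed

lemma cross_end_velocity:
  assumes X: "hfield X" and c: "cross v l m X p T"
  shows "(v \<bullet> X (flow X T p))\<^sup>2
    = (v \<bullet> X p)\<^sup>2 + disc X * ((m - v \<bullet> centre X)\<^sup>2 - (l - v \<bullet> centre X)\<^sup>2)"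
  using energy_flow[OF X, of v T p] c unfolding energy_def cross_def by (simp add: algebra_simps)

section \<open>Perturbation of excursions, crossings and glides\<close>

lemma first_hit:
  fixes f :: "real \<Rightarrow> real"
  assumes cont: "continuous_on {0..b} f" and a: "0 < a" "\<And>t. 0 < t \<Longrightarrow> t < a \<Longrightarrow> f t < l"
    and b: "0 < b" "l \<le> f b"
  obtains T where "0 < T" "T \<le> b" "f T = l" "\<And>t. 0 < t \<Longrightarrow> t < T \<Longrightarrow> f t < l"
proof -
  have ab: "a \<le> b" using a(2)[of b] b by linarith
  define S where "S = {t \<in> {a..b}. l \<le> f t}"
  have "closedin (top_of_set {a..b}) ({a..b} \<inter> f -` {l..})"
    by (intro continuous_closedin_preimage continuous_on_subset[OF cont]) (use a in auto)
  moreover have "{a..b} \<inter> f -` {l..} = S" by (auto simp: S_def)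
  ultimately have "compact S" by (metis closedin_compact compact_Icc)
  moreover have "S \<noteq> {}" using ab b by (auto simp: S_def)
  ultimately obtain T where T: "T \<in> S" "\<And>t. t \<in> S \<Longrightarrow> T \<le> t" by (meson compact_attains_inf)
  have lt: "f t < l" if "0 < t" "t < T" for t
  proof (rule ccontr)
    assume "\<not> f t < l"
    then have "\<not> t < a" using that a(2)[of t] by blast
    then have "t \<in> S" using that T(1) \<open>\<not> f t < l\<close> by (simp add: S_def)
    then show False using T(2)[of t] that by simp
  qed
  have T0: "0 < T" "T \<le> b" "l \<le> f T" using T(1) a(1) by (simp_all add: S_def)
  have "f T \<le> l"
  proof -
    have "continuous_on {0..T} (\<lambda>t. - f t)"
      by (intro continuous_on_minus continuous_on_subset[OF cont]) (use T0 in auto)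
    from continuous_ge_on_Ioo[OF this, of "- l" T] T0(1) lt show ?thesis
      by (auto intro: less_imp_le)
  qed
  then have "f T = l" using T0 by simp
  with that T0 lt show ?thesis by blast
qed

lemma energy_at:
  assumes X: "hfield X" and xi: "v \<bullet> flow X t p = \<xi>"
  shows "energy v X p + disc X * (\<xi> - v \<bullet> centre X)\<^sup>2 = (v \<bullet> X (flow X t p))\<^sup>2"
  using energy_flow[OF X, of v t p] xi unfolding energy_def by simp

lemma flow_pos_ivt:
  assumes X: "hfield X" and "a \<le> b" "v \<bullet> flow X a p \<le> \<xi>" "\<xi> \<le> v \<bullet> flow X b p"
  shows "\<exists>t\<ge>a. t \<le> b \<and> v \<bullet> flow X t p = \<xi>"
  using IVT'[of "\<lambda>s. v \<bullet> flow X s p", OF assms(3,4,2) flow_pos_continuous[OF X]] .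

lemma flow_tendsto:
  assumes X: "hfield X"
  shows "((\<lambda>p. flow X t p) \<longlongrightarrow> flow X t q) (nhds q)"
    and "((\<lambda>p. v \<bullet> X (flow X t p)) \<longlongrightarrow> v \<bullet> X (flow X t q)) (nhds q)"
    and "((\<lambda>p. v \<bullet> X p) \<longlongrightarrow> v \<bullet> X q) (nhds q)"
proof -
  have nhds: "(f \<longlongrightarrow> f r) (nhds r)" if "continuous_on UNIV f" for f :: "plane \<Rightarrow> plane" and r
    using that unfolding continuous_on_eq_continuous_at[OF open_UNIV] isCont_def tendsto_at_iff_tendsto_nhds by blast
  have "continuous_on UNIV (\<lambda>p. flow X t p)"
    by (intro flow_continuous[OF X] continuous_intros)
  then show *: "((\<lambda>p. flow X t p) \<longlongrightarrow> flow X t q) (nhds q)" by (rule nhds)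
  have Xt: "(X \<longlongrightarrow> X r) (nhds r)" for r by (rule nhds[OF hfield_continuous[OF X]])
  show "((\<lambda>p. v \<bullet> X p) \<longlongrightarrow> v \<bullet> X q) (nhds q)"
    by (intro tendsto_intros Xt)
  show "((\<lambda>p. v \<bullet> X (flow X t p)) \<longlongrightarrow> v \<bullet> X (flow X t q)) (nhds q)"
    by (intro tendsto_intros filterlim_compose[OF Xt *])
qed

text \<open>
  Compactness of the time interval gives one neighbourhood for all times.
\<close>

lemma flow_tube:
  assumes X: "hfield X" and W: "open W" and sub: "\<And>t. t \<in> {0..S} \<Longrightarrow> flow X t q \<in> W"
  shows "\<forall>\<^sub>F p in nhds q. \<forall>t\<in>{0..S}. flow X t p \<in> W"
proof -
  have c: "continuous_on UNIV (\<lambda>x. flow X (snd x) (fst x))"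
    by (intro flow_continuous[OF X] continuous_intros)
  have "open ((\<lambda>x. flow X (snd x) (fst x)) -` W)"
    using c W by (simp add: continuous_on_open_vimage)
  moreover have "{q} \<times> {0..S} \<subseteq> (\<lambda>x. flow X (snd x) (fst x)) -` W"
    using sub by auto
  ultimately have "\<exists>N. q \<in> N \<and> open N \<and> N \<times> {0..S} \<subseteq> (\<lambda>x. flow X (snd x) (fst x)) -` W"
    by (rule Elementary_Topology.tube_lemma[OF compact_Icc])
  then obtain N where N: "q \<in> N" "open N" "N \<times> {0..S} \<subseteq> (\<lambda>x. flow X (snd x) (fst x)) -` W"
    by blast
  have "\<forall>p\<in>N. \<forall>t\<in>{0..S}. flow X t p \<in> W" using N(3) by auto
  then show ?thesis unfolding eventually_nhds using N(1,2) by blast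
qed

lemma flow_extend:
  assumes X: "hfield X" and U: "open U" and sub: "\<forall>t\<in>{0..T}. flow X t p \<in> U" and T: "0 \<le> T"
  obtains e where "e > 0" "\<And>h t. 0 \<le> h \<Longrightarrow> h < e \<Longrightarrow> t \<in> {0..T + h} \<Longrightarrow> flow X t p \<in> U"
proof -
  have "continuous_on UNIV (\<lambda>t. flow X t p)"
    by (intro flow_continuous[OF X] continuous_intros)
  then have "open ((\<lambda>t. flow X t p) -` U)" using U by (simp add: continuous_on_open_vimage)
  moreover have "T \<in> (\<lambda>t. flow X t p) -` U" using sub T by simp
  ultimately obtain e where e: "e > 0" "ball T e \<subseteq> (\<lambda>t. flow X t p) -` U"
    by (meson open_contains_ball)
  have "flow X t p \<in> U" if "0 \<le> h" "h < e" "t \<in> {0..T + h}" for h t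
  proof (cases "t \<le> T")
    case True then show ?thesis using that sub by simp
  next
    case False
    then have "t \<in> ball T e" using that by (simp add: dist_real_def)
    then show ?thesis using e by auto
  qed
  with e that show ?thesis by blast
qed

text \<open>
  The excursion meets the line transversally at its end, so that it continues to the other side.
  Nearby orbits do the same and return to the line shortly before or after.
\<close>

lemma exc_perturb:
  assumes X: "hfield X" and e: "exc v l X p T" and neg: "v \<bullet> X p < 0"
    and U: "open U" and sub: "\<forall>t\<in>{0..T}. flow X t p \<in> U"
  shows "\<forall>\<^sub>F p' in nhds p. v \<bullet> p' = l \<longrightarrow>
    (\<exists>T'. exc v l X p' T' \<and> (\<forall>t\<in>{0..T'}. flow X t p' \<in> U))"
proof -
  have T: "0 < T" and ends: "v \<bullet> flow X T p = l" using e unfolding exc_def by auto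
  have vT: "v \<bullet> X (flow X T p) > 0" using exc_velocity(2)[OF X e] neg by simp
  obtain d where d: "d > 0" "\<And>h. 0 < h \<Longrightarrow> h < d \<Longrightarrow> v \<bullet> flow X T p < v \<bullet> flow X (T + h) p"
    using DERIV_pos_inc_right[OF flow_pos_deriv[OF X, of v p T] vT] by blast
  obtain e where e: "e > 0" "\<And>h t. 0 \<le> h \<Longrightarrow> h < e \<Longrightarrow> t \<in> {0..T + h} \<Longrightarrow> flow X t p \<in> U"
    using flow_extend[OF X U sub] T by (metis less_imp_le)
  define S where "S = T + min (d / 2) (e / 2)"
  have S: "S > T" "v \<bullet> flow X S p > l" "\<And>t. t \<in> {0..S} \<Longrightarrow> flow X t p \<in> U"
    using d(2)[of "S - T"] e(2)[of "S - T"] d(1) e(1) ends by (auto simp: S_def)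
  have "\<forall>\<^sub>F p' in nhds p. v \<bullet> flow X S p' > l"
    by (rule order_tendstoD(1)[OF _ S(2)]) (intro tendsto_intros flow_tendsto(1)[OF X])
  moreover have "\<forall>\<^sub>F p' in nhds p. v \<bullet> X p' < 0"
    by (rule order_tendstoD(2)[OF flow_tendsto(3)[OF X] neg])
  moreover have "\<forall>\<^sub>F p' in nhds p. \<forall>t\<in>{0..S}. flow X t p' \<in> U"
    by (rule flow_tube[OF X U S(3)])
  ultimately show ?thesis
  proof eventually_elim
    case (elim p')
    show ?case
    proof
      assume l: "v \<bullet> p' = l"
      have "v \<bullet> X (flow X 0 p') < 0" using elim by simp
      from DERIV_neg_dec_right[OF flow_pos_deriv[OF X] this]
      obtain a where a: "a > 0" "\<And>t. 0 < t \<Longrightarrow> t < a \<Longrightarrow> v \<bullet> flow X t p' < l" using l by auto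
      obtain T' where T': "0 < T'" "T' \<le> S" "v \<bullet> flow X T' p' = l" "\<And>t. 0 < t \<Longrightarrow> t < T' \<Longrightarrow> v \<bullet> flow X t p' < l"
        using first_hit[OF flow_pos_continuous[OF X] a, of S] elim(1) S(1) T by auto
      then have "exc v l X p' T'" unfolding exc_def using l by auto
      moreover have "\<forall>t\<in>{0..T'}. flow X t p' \<in> U" using elim(3) T'(2) by auto
      ultimately show "\<exists>T'. exc v l X p' T' \<and> (\<forall>t\<in>{0..T'}. flow X t p' \<in> U)" by blast
    qed
  qed
qed

text \<open>
  The bound on the position separates the perturbed arc from the turning point of the given one.
  It keeps the perturbed arc inside the strip even if the given arc touches the far line, and
  shows that the two arcs differ.
\<close>

lemma turn_perturb_inward:
  assumes X: "hfield X" and e: "exc (- v) (- l) X p T" and pos: "v \<bullet> X p > 0"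
    and U: "open U" and sub: "\<forall>t\<in>{0..T}. flow X t p \<in> U"
  obtains t where "0 < t" "t < T"
    "\<forall>\<^sub>F p' in nhds p. v \<bullet> p' = l \<and> 0 < v \<bullet> X p' \<and> v \<bullet> X p' < v \<bullet> X p \<longrightarrow>
      (\<exists>T'. exc (- v) (- l) X p' T' \<and> (\<forall>s\<in>{0..T'}. flow X s p' \<in> U \<and> v \<bullet> flow X s p' < v \<bullet> flow X t p))"
proof -
  obtain t where t: "0 < t" "t < T" "- v \<bullet> X (flow X t p) = 0" by (rule exc_turning_time[OF X e])
  define m where "m = v \<bullet> flow X t p"
  have vp: "v \<bullet> p = l" and lm: "l < m" using e t unfolding exc_def m_def by auto
  have E: "energy v X p + disc X * (m - v \<bullet> centre X)\<^sup>2 = 0"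
    using turning_energy[OF X t(3)] by (simp add: m_def power2_commute)
  have "- v \<bullet> X p < 0" using pos by simp
  from exc_perturb[OF X e this U sub]
  have "\<forall>\<^sub>F p' in nhds p. v \<bullet> p' = l \<and> 0 < v \<bullet> X p' \<and> v \<bullet> X p' < v \<bullet> X p \<longrightarrow>
      (\<exists>T'. exc (- v) (- l) X p' T' \<and> (\<forall>s\<in>{0..T'}. flow X s p' \<in> U \<and> v \<bullet> flow X s p' < m))"
  proof eventually_elim
    case (elim p')
    show ?case
    proof
      assume p': "v \<bullet> p' = l \<and> 0 < v \<bullet> X p' \<and> v \<bullet> X p' < v \<bullet> X p"
      then obtain T' where T': "exc (- v) (- l) X p' T'" "\<forall>t\<in>{0..T'}. flow X t p' \<in> U" using elim by auto
      have "(v \<bullet> X p')\<^sup>2 < (v \<bullet> X p)\<^sup>2" using p' by (intro power_strict_mono) auto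
      then have less: "energy v X p' < energy v X p" unfolding energy_def using p' vp by simp
      \<comment> \<open>the energy of the inner orbit is too small to reach the old turning point\<close>
      have no: "v \<bullet> flow X s p' \<noteq> m" for s
      proof
        assume "v \<bullet> flow X s p' = m"
        from energy_at[OF X this] E less
        show False using zero_le_power2[of "v \<bullet> X (flow X s p')"] by linarith
      qed
      have "v \<bullet> flow X s p' < m" if "s \<in> {0..T'}" for s
      proof (rule ccontr)
        assume "\<not> ?thesis"
        then have "m \<le> v \<bullet> flow X s p'" by simp
        moreover have "v \<bullet> flow X 0 p' \<le> m" "0 \<le> s" using that p' lm by simp_all
        ultimately obtain u where "v \<bullet> flow X u p' = m"
          using flow_pos_ivt[OF X, of 0 s v p' m] by blast
        then show False using no by blast
      qed
      with T' show "\<exists>T'. exc (- v) (- l) X p' T' \<and> (\<forall>s\<in>{0..T'}. flow X s p' \<in> U \<and> v \<bullet> flow X s p' < m)"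
        by blast
    qed
  qed
  with t that show ?thesis unfolding m_def by blast
qed

text \<open>
  The crossing may be tangent to both lines. An orbit that starts with a larger velocity has more
  energy, which is enough to pass every level of the strip; this is why only outward perturbations
  are considered.
\<close>

lemma cross_perturb_outward:
  assumes X: "hfield X" and lm: "l < m" and c: "cross v l m X p T"
    and U: "open U" and sub: "\<forall>t\<in>{0..T}. flow X t p \<in> U"
  shows "\<forall>\<^sub>F p' in nhds p. v \<bullet> p' = l \<and> v \<bullet> X p < v \<bullet> X p' \<longrightarrow>
    (\<exists>T'. cross v l m X p' T' \<and> (\<forall>t\<in>{0..T'}. flow X t p' \<in> U))"
proof -
  note dp = flow_pos_deriv[OF X, of v p T UNIV] and dv = flow_vel_deriv[OF X, of v p T UNIV]
  have T: "0 < T" and ends: "v \<bullet> p = l" "v \<bullet> flow X T p = m" using c unfolding cross_def by auto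
  have btw: "\<And>t. 0 < t \<Longrightarrow> t < T \<Longrightarrow> l < v \<bullet> flow X t p \<and> v \<bullet> flow X t p < m"
    using c unfolding cross_def by auto
  note vel = cross_velocity[OF X lm c]
  have barrier: "energy v X p + disc X * (\<xi> - v \<bullet> centre X)\<^sup>2 \<ge> 0" if "l \<le> \<xi>" "\<xi> \<le> m" for \<xi>
  proof -
    have "0 \<le> T" "v \<bullet> flow X 0 p \<le> \<xi>" "\<xi> \<le> v \<bullet> flow X T p" using that ends T by simp_all
    from flow_pos_ivt[OF X this] obtain t where t: "v \<bullet> flow X t p = \<xi>" by blast
    show ?thesis unfolding energy_at[OF X t] by (rule zero_le_power2)
  qed
  have "\<exists>d>0. \<forall>h. 0 < h \<longrightarrow> h < d \<longrightarrow> v \<bullet> flow X (T + h) p > m \<or> v \<bullet> X (flow X (T + h) p) < 0"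
  proof (cases "v \<bullet> X (flow X T p) = 0")
    case False
    then have "v \<bullet> X (flow X T p) > 0" using vel(3) by linarith
    from DERIV_pos_inc_right[OF dp this] show ?thesis unfolding ends(2) by blast
  next
    case True
    define a where "a = disc X * (v \<bullet> flow X T p - v \<bullet> centre X)"
    \<comment> \<open>the orbit touches the exit line, so that the acceleration points inward there\<close>
    have "a < 0"
    proof (rule ccontr)
      assume "\<not> a < 0"
      then consider "a > 0" | "a = 0" by linarith
      then show False
      proof cases
        case 1
        then obtain d where d: "d > 0" "\<And>h. 0 < h \<Longrightarrow> h < d \<Longrightarrow> v \<bullet> X (flow X (T - h) p) < 0"
          using DERIV_pos_inc_left[OF dv] True unfolding a_def by metis
        define h where "h = min (d / 2) (T / 2)"
        have h: "0 < h" "h < d" "h < T" using d(1) T by (simp_all add: h_def min_less_iff_disj)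
        then show False using d(2)[of h] vel(1)[of "T - h"] by linarith
      next
        case 2
        then have x0: "v \<bullet> flow X T p = v \<bullet> centre X" using hfield_disc[OF X] by (simp add: a_def)
        have "flow X (T / 2) p = flow X (- (T / 2)) (flow X T p)"
          by (simp add: flow_add[OF X, symmetric])
        then have "v \<bullet> flow X (T / 2) p = m"
          using flow_pos[of v X "- (T / 2)" "flow X T p"] x0 True ends by simp
        then show False using btw[of "T / 2"] T by simp
      qed
    qed
    from DERIV_neg_dec_right[OF dv this[unfolded a_def]] show ?thesis unfolding True by blast
  qed
  then obtain d where d: "d > 0" "\<And>h. 0 < h \<Longrightarrow> h < d \<Longrightarrow> v \<bullet> flow X (T + h) p > m \<or> v \<bullet> X (flow X (T + h) p) < 0"
    by blast
  obtain e where e: "e > 0" "\<And>h t. 0 \<le> h \<Longrightarrow> h < e \<Longrightarrow> t \<in> {0..T + h} \<Longrightarrow> flow X t p \<in> U"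
    using flow_extend[OF X U sub] T by (metis less_imp_le)
  define S where "S = T + min (d / 2) (e / 2)"
  have S: "S > T" "v \<bullet> flow X S p > m \<or> v \<bullet> X (flow X S p) < 0" "\<And>t. t \<in> {0..S} \<Longrightarrow> flow X t p \<in> U"
    using d(2)[of "S - T"] e(2)[of "S - T"] d(1) e(1) ends by (auto simp: S_def)
  have "\<forall>\<^sub>F p' in nhds p. v \<bullet> flow X S p' > m \<or> v \<bullet> X (flow X S p') < 0"
    using S(2)
  proof
    assume a: "v \<bullet> flow X S p > m"
    have "\<forall>\<^sub>F p' in nhds p. v \<bullet> flow X S p' > m"
      by (rule order_tendstoD(1)[OF _ a]) (intro tendsto_intros flow_tendsto(1)[OF X])
    then show ?thesis by eventually_elim simp
  next
    assume "v \<bullet> X (flow X S p) < 0"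
    then have "\<forall>\<^sub>F p' in nhds p. v \<bullet> X (flow X S p') < 0"
      by (rule order_tendstoD(2)[OF flow_tendsto(2)[OF X]])
    then show ?thesis by eventually_elim simp
  qed
  moreover have "\<forall>\<^sub>F p' in nhds p. \<forall>t\<in>{0..S}. flow X t p' \<in> U"
    by (rule flow_tube[OF X U S(3)])
  ultimately show ?thesis
  proof eventually_elim
    case (elim p')
    show ?case
    proof
      assume p': "v \<bullet> p' = l \<and> v \<bullet> X p < v \<bullet> X p'"
      have "(v \<bullet> X p)\<^sup>2 < (v \<bullet> X p')\<^sup>2" using p' vel(2) by (intro power_strict_mono) auto
      then have E: "energy v X p < energy v X p'" unfolding energy_def using p' ends by simp
      have v0: "0 < v \<bullet> X p'" using p' vel(2) by simp
      note dp' = flow_pos_deriv[OF X, of v p' _ UNIV]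
      note contp = flow_pos_continuous[OF X, of _ v p'] and contv = flow_vel_continuous[OF X, of _ v p']
      have key: "0 < v \<bullet> X (flow X t p')" if t: "0 \<le> t" "\<And>s. 0 \<le> s \<Longrightarrow> s \<le> t \<Longrightarrow> v \<bullet> flow X s p' \<le> m" for t
      proof (rule ccontr)
        assume n: "\<not> ?thesis"
        obtain a where a: "a > 0" "\<And>s. 0 < s \<Longrightarrow> s < a \<Longrightarrow> - (v \<bullet> X (flow X s p')) < 0"
        proof -
          have "((\<lambda>s. v \<bullet> X (flow X s p')) \<longlongrightarrow> v \<bullet> X (flow X 0 p')) (at_right 0)"
            using contv[of UNIV] by (simp only: continuous_on_eq_continuous_at[OF open_UNIV] isCont_def filterlim_at_split ball_UNIV)
          from order_tendstoD(1)[OF this, of 0] v0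
          have "\<forall>\<^sub>F s in at_right 0. - (v \<bullet> X (flow X s p')) < 0" by simp
          then show ?thesis unfolding eventually_at_right_field using that by blast
        qed
        have "t \<noteq> 0" using n v0 by auto
        then obtain r where r: "0 < r" "r \<le> t" "- (v \<bullet> X (flow X r p')) = 0" "\<And>s. 0 < s \<Longrightarrow> s < r \<Longrightarrow> - (v \<bullet> X (flow X s p')) < 0"
          using first_hit[OF continuous_on_minus[OF contv] a, of t] t(1) n by auto
        have "v \<bullet> flow X 0 p' < v \<bullet> flow X r p'"
          by (rule DERIV_pos_imp_increasing_open[OF r(1) _ contp]) (use dp' r(4) in force)
        then have "0 \<le> energy v X p + disc X * (v \<bullet> flow X r p' - v \<bullet> centre X)\<^sup>2"
          using barrier t(2)[of r] r p' by simp
        also have "\<dots> < energy v X p' + disc X * (v \<bullet> flow X r p' - v \<bullet> centre X)\<^sup>2" using E by simp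
        also have "\<dots> = 0" using turning_energy[OF X, of v r p'] r(3) by simp
        finally show False by simp
      qed
      have "\<exists>b. 0 < b \<and> b \<le> S \<and> m \<le> v \<bullet> flow X b p'"
      proof (rule ccontr)
        assume "\<not> ?thesis"
        then have lt: "v \<bullet> flow X s p' < m" if "0 \<le> s" "s \<le> S" for s
          using that p' lm by (cases "s = 0") force+
        have "0 \<le> S" using S(1) T by simp
        then have "0 < v \<bullet> X (flow X S p')" by (rule key) (rule less_imp_le[OF lt])
        then show False using lt[of S] elim(1) \<open>0 \<le> S\<close> by linarith
      qed
      then obtain b where b: "0 < b" "b \<le> S" "m \<le> v \<bullet> flow X b p'" by blast
      obtain a where a: "a > 0" "\<And>s. 0 < s \<Longrightarrow> s < a \<Longrightarrow> v \<bullet> flow X s p' < m"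
      proof -
        have "((\<lambda>s. v \<bullet> flow X s p') \<longlongrightarrow> v \<bullet> flow X 0 p') (at_right 0)"
          using contp[of UNIV] by (simp only: continuous_on_eq_continuous_at[OF open_UNIV] isCont_def filterlim_at_split ball_UNIV)
        from order_tendstoD(2)[OF this, of m] p' lm
        have "\<forall>\<^sub>F s in at_right 0. v \<bullet> flow X s p' < m" by simp
        then show ?thesis unfolding eventually_at_right_field using that by blast
      qed
      obtain T' where T': "0 < T'" "T' \<le> b" "v \<bullet> flow X T' p' = m" "\<And>t. 0 < t \<Longrightarrow> t < T' \<Longrightarrow> v \<bullet> flow X t p' < m"
        using first_hit[OF contp a b(1,3)] by blast
      have le: "v \<bullet> flow X s p' \<le> m" if "0 \<le> s" "s \<le> T'" for s
        using T'(3) T'(4)[of s] that p' lm by (cases "s = 0 \<or> s = T'") auto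
      have "l < v \<bullet> flow X t p'" if t: "0 < t" "t < T'" for t
      proof -
        have "v \<bullet> flow X 0 p' < v \<bullet> flow X t p'"
          by (rule DERIV_pos_imp_increasing_open[OF t(1) _ contp]) (use dp' key le t in force)
        then show ?thesis using p' by simp
      qed
      then have "cross v l m X p' T'" unfolding cross_def using T' p' by auto
      moreover have "\<forall>t\<in>{0..T'}. flow X t p' \<in> U" using elim(2) T'(2) b(2) by auto
      ultimately show "\<exists>T'. cross v l m X p' T' \<and> (\<forall>t\<in>{0..T'}. flow X t p' \<in> U)" by blast
    qed
  qed
qed

text \<open>
  A motion along the line itself.
\<close>

definition glide :: "plane \<Rightarrow> real \<Rightarrow> (plane \<Rightarrow> plane) \<Rightarrow> plane \<Rightarrow> real \<Rightarrow> bool" where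
  "glide v l X p T \<longleftrightarrow> 0 < T \<and> (\<forall>t\<in>{0..T}. v \<bullet> flow X t p = l)"

lemma gcos_gsin_exp:
  assumes "\<rho> \<noteq> 0"
  shows "gcos (\<rho>\<^sup>2) t + \<rho> * gsin (\<rho>\<^sup>2) t = exp (\<rho> * t)"
proof (cases "\<rho> > 0")
  case True
  then show ?thesis unfolding gcos_def gsin_def using cosh_plus_sinh[of "\<rho> * t"] by simp
next
  case False
  then have r: "\<rho> < 0" using assms by simp
  then have "gcos (\<rho>\<^sup>2) t + \<rho> * gsin (\<rho>\<^sup>2) t = cosh (- (\<rho> * t)) - sinh (- (\<rho> * t))"
    unfolding gcos_def gsin_def using assms by (simp add: power2_eq_square[symmetric])
  also have "\<dots> = exp (\<rho> * t)" using cosh_minus_sinh[of "- (\<rho> * t)"] by simp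
  finally show ?thesis .
qed

text \<open>
  Along an orbit that stays on a line, velocity and acceleration across the line vanish. So the
  line contains the singular point, and its direction is an eigenvector of the linear part, with
  an eigenvalue \<open>\<rho>\<close> such that \<open>\<rho>\<^sup>2 = d\<close>.
\<close>

lemma glide_exp:
  assumes X: "hfield X" and v: "v \<noteq> 0" and g: "glide v l X p T" and ne: "flow X T p \<noteq> p"
  obtains \<rho> where "\<rho> \<noteq> 0" "v \<bullet> centre X = l" "p \<noteq> centre X"
    "\<And>r. v \<bullet> r = l \<Longrightarrow> v \<bullet> X r = 0"
    "\<And>r t. v \<bullet> r = l \<Longrightarrow> flow X t r = centre X + exp (\<rho> * t) *\<^sub>R (r - centre X)"
proof -
  let ?c = "centre X" and ?d = "disc X"
  have T: "0 < T" and on: "\<And>t. 0 \<le> t \<Longrightarrow> t \<le> T \<Longrightarrow> v \<bullet> flow X t p = l" using g unfolding glide_def by auto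
  have vel0: "v \<bullet> X (flow X t p) = 0" if t: "0 < t" "t < T" for t
  proof (rule DERIV_local_const[OF flow_pos_deriv[OF X, of v p t UNIV], of "min t (T - t)"])
    show "0 < min t (T - t)" using t by simp
    show "\<forall>y. \<bar>t - y\<bar> < min t (T - t) \<longrightarrow> v \<bullet> flow X t p = v \<bullet> flow X y p"
      using on t by (auto simp: abs_if split: if_splits)
  qed
  have "?d * (v \<bullet> flow X (T/2) p - v \<bullet> ?c) = 0"
  proof (rule DERIV_local_const[OF flow_vel_deriv[OF X, of v p "T/2" UNIV], of "T/2"])
    show "0 < T/2" using T by simp
    show "\<forall>y. \<bar>T/2 - y\<bar> < T/2 \<longrightarrow> v \<bullet> X (flow X (T/2) p) = v \<bullet> X (flow X y p)"
      using vel0 T by (auto simp: abs_if split: if_splits)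
  qed
  then have x0: "v \<bullet> ?c = l" using on[of "T/2"] T hfield_disc[OF X] by simp
  have zp: "v \<bullet> X p = 0"
  proof (rule ccontr)
    assume z: "v \<bullet> X p \<noteq> 0"
    have "gsin ?d (T/2) = 0" using flow_pos[of v X "T/2" p] on[of 0] on[of "T/2"] T x0 z by simp
    moreover have "gcos ?d (T/2) = 0" using flow_vel[OF X, of v "T/2" p] vel0[of "T/2"] on[of 0] T x0 z by simp
    ultimately show False using gcos_sq[OF hfield_disc[OF X], of "T/2"] by simp
  qed
  have pc: "p \<noteq> ?c"
  proof
    assume "p = ?c"
    then have "flow X T p = p" using hfield_zero[OF X] by (simp add: flow_def)
    with ne show False by simp
  qed
  define w where "w = p - ?c"
  have w: "w \<noteq> 0" "v \<bullet> w = 0" using pc on[of 0] T x0 by (auto simp: w_def inner_diff_right)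
  have par: "\<exists>a. r = a *\<^sub>R w" if "v \<bullet> r = 0" for r
  proof -
    have a: "r = (perp v \<bullet> r / (v \<bullet> v)) *\<^sub>R perp v" "w = (perp v \<bullet> w / (v \<bullet> v)) *\<^sub>R perp v"
      using perp_decomposition[OF v, of r] perp_decomposition[OF v, of w] that w by simp_all
    then have nz: "perp v \<bullet> w / (v \<bullet> v) \<noteq> 0" using w(1) by auto
    have "inverse (perp v \<bullet> w / (v \<bullet> v)) *\<^sub>R w
        = inverse (perp v \<bullet> w / (v \<bullet> v)) *\<^sub>R ((perp v \<bullet> w / (v \<bullet> v)) *\<^sub>R perp v)"
      using a(2) by (rule arg_cong)
    also have "\<dots> = perp v" unfolding scaleR_scaleR left_inverse[OF nz] by simp
    finally show ?thesis using a(1) by (metis scaleR_scaleR)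
  qed
  obtain \<rho> where rho: "X p = \<rho> *\<^sub>R w" using par[OF zp] by blast
  have Xr: "X r = \<rho> *\<^sub>R (r - ?c)" if "v \<bullet> r = l" for r
  proof -
    have "v \<bullet> (r - ?c) = 0" using that x0 by (simp add: inner_diff_right)
    then obtain a where a: "r - ?c = a *\<^sub>R w" using par by blast
    have "r = ?c + a *\<^sub>R w" using a by (metis add.commute diff_add_cancel)
    then have "X r = a *\<^sub>R X (?c + w)"
      using hfield_affine[OF X, of a w 0 w] by simp
    then show ?thesis using rho a by (simp add: w_def)
  qed
  have "?d *\<^sub>R w = \<rho>\<^sup>2 *\<^sub>R w"
  proof -
    have "?d *\<^sub>R w = X (?c + X p)" using hfield_square[OF X, of p] by (simp add: w_def)
    also have "\<dots> = \<rho> *\<^sub>R (X p)"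
      using Xr[of "?c + X p"] x0 zp by (simp add: inner_add_right)
    finally show ?thesis using rho by (simp add: power2_eq_square)
  qed
  then have d: "?d = \<rho>\<^sup>2" using w(1) by simp
  then have r0: "\<rho> \<noteq> 0" using hfield_disc[OF X] by auto
  have "flow X t r = ?c + exp (\<rho> * t) *\<^sub>R (r - ?c)" if "v \<bullet> r = l" for r t
    unfolding flow_def Xr[OF that] d gcos_gsin_exp[OF r0, of t, symmetric] by (simp add: algebra_simps)
  moreover have "v \<bullet> X r = 0" if "v \<bullet> r = l" for r
    using Xr[OF that] that x0 by (simp add: inner_diff_right)
  ultimately show ?thesis using that r0 x0 pc by blast
qed

text \<open>
  On an invariant line the motion is exponential. Both ends of a glide can be prescribed
  independently of each other, since the duration adapts to them.
\<close>

lemma glide_perturb: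
  assumes X: "hfield X" and v: "v \<noteq> 0" and g: "glide v l X p T" and ne: "flow X T p \<noteq> p"
    and U: "open U" and sub: "\<forall>t\<in>{0..T}. flow X t p \<in> U"
  shows "\<forall>\<^sub>F x in nhds p \<times>\<^sub>F nhds (flow X T p). v \<bullet> fst x = l \<and> v \<bullet> snd x = l \<longrightarrow>
    (\<exists>T'. glide v l X (fst x) T' \<and> flow X T' (fst x) = snd x \<and> (\<forall>t\<in>{0..T'}. flow X t (fst x) \<in> U)
       \<and> (\<forall>t\<in>{0<..T'}. flow X t (fst x) \<noteq> fst x))"
proof -
  let ?c = "centre X" and ?q = "flow X T p"
  obtain \<rho> where r0: "\<rho> \<noteq> 0" and x0: "v \<bullet> ?c = l" and pc: "p \<noteq> ?c"
    and "\<And>r. v \<bullet> r = l \<Longrightarrow> v \<bullet> X r = 0"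
    and fl: "\<And>r t. v \<bullet> r = l \<Longrightarrow> flow X t r = ?c + exp (\<rho> * t) *\<^sub>R (r - ?c)"
    by (rule glide_exp[OF X v g ne]) (rule that)
  have T: "0 < T" and vp: "v \<bullet> p = l" using g unfolding glide_def by (auto dest: bspec[of _ _ 0])
  define w where "w = perp v"
  define \<alpha> where "\<alpha> r = w \<bullet> (r - ?c)" for r
  have on: "r = ?c + (\<alpha> r / (v \<bullet> v)) *\<^sub>R w" if "v \<bullet> r = l" for r
    using perp_decomposition[OF v, of "r - ?c"] that x0 unfolding \<alpha>_def w_def
    by (simp add: inner_diff_right algebra_simps)
  have ap: "\<alpha> p \<noteq> 0" using on[OF vp] pc by auto
  have aq: "\<alpha> ?q = exp (\<rho> * T) * \<alpha> p" unfolding fl[OF vp] \<alpha>_def by simp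
  \<comment> \<open>the time that the exponential motion needs from one given point to another\<close>
  define \<tau> where "\<tau> x = ln (\<alpha> (snd x) / \<alpha> (fst x)) / \<rho>" for x
  have tf: "(fst \<longlongrightarrow> p) (nhds p \<times>\<^sub>F nhds ?q)" "(snd \<longlongrightarrow> ?q) (nhds p \<times>\<^sub>F nhds ?q)"
    by (rule filterlim_fst, rule filterlim_snd)
  have quot: "((\<lambda>x. \<alpha> (snd x) / \<alpha> (fst x)) \<longlongrightarrow> \<alpha> ?q / \<alpha> p) (nhds p \<times>\<^sub>F nhds ?q)"
    unfolding \<alpha>_def by (intro tendsto_intros tf) (use ap in \<open>simp add: \<alpha>_def\<close>)
  have qv: "\<alpha> ?q / \<alpha> p = exp (\<rho> * T)" using ap aq by simp
  have "(\<tau> \<longlongrightarrow> ln (exp (\<rho> * T)) / \<rho>) (nhds p \<times>\<^sub>F nhds ?q)"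
    unfolding \<tau>_def[abs_def] by (intro tendsto_intros quot[unfolded qv]) (use r0 in auto)
  then have lim: "(\<tau> \<longlongrightarrow> T) (nhds p \<times>\<^sub>F nhds ?q)" using r0 by simp
  obtain e where e: "e > 0" "\<And>h t. 0 \<le> h \<Longrightarrow> h < e \<Longrightarrow> t \<in> {0..T + h} \<Longrightarrow> flow X t p \<in> U"
    using flow_extend[OF X U sub] T by (metis less_imp_le)
  define S where "S = T + e / 2"
  have S: "S > T" "\<And>t. t \<in> {0..S} \<Longrightarrow> flow X t p \<in> U" using e(2)[of "e / 2"] e(1) by (auto simp: S_def)
  have "\<forall>\<^sub>F x in nhds p \<times>\<^sub>F nhds ?q. \<forall>t\<in>{0..S}. flow X t (fst x) \<in> U"
    using flow_tube[OF X U S(2)] tf(1) by (rule eventually_compose_filterlim)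
  moreover have "\<forall>\<^sub>F x in nhds p \<times>\<^sub>F nhds ?q. \<tau> x > 0" by (rule order_tendstoD(1)[OF lim T])
  moreover have "\<forall>\<^sub>F x in nhds p \<times>\<^sub>F nhds ?q. \<tau> x < S" by (rule order_tendstoD(2)[OF lim S(1)])
  moreover have "\<forall>\<^sub>F x in nhds p \<times>\<^sub>F nhds ?q. \<alpha> (snd x) / \<alpha> (fst x) > 0"
    by (rule order_tendstoD(1)[OF quot]) (simp add: qv)
  ultimately show ?thesis
  proof eventually_elim
    case (elim x)
    show ?case
    proof
      assume l: "v \<bullet> fst x = l \<and> v \<bullet> snd x = l"
      have a0: "\<alpha> (fst x) \<noteq> 0" using elim(4) by auto
      have "exp (\<rho> * \<tau> x) = \<alpha> (snd x) / \<alpha> (fst x)" using r0 elim(4) by (simp add: \<tau>_def)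
      then have "flow X (\<tau> x) (fst x) = ?c + (\<alpha> (snd x) / \<alpha> (fst x)) *\<^sub>R (fst x - ?c)"
        using fl l by simp
      also have "fst x - ?c = (\<alpha> (fst x) / (v \<bullet> v)) *\<^sub>R w" using on[of "fst x"] l by (metis add_diff_cancel_left')
      also have "?c + (\<alpha> (snd x) / \<alpha> (fst x)) *\<^sub>R ((\<alpha> (fst x) / (v \<bullet> v)) *\<^sub>R w) = snd x"
        using a0 on[of "snd x"] l by simp
      finally have end_eq: "flow X (\<tau> x) (fst x) = snd x" .
      have "glide v l X (fst x) (\<tau> x)"
        unfolding glide_def using elim(2) fl l x0 by (simp add: inner_add_right inner_diff_right)
      moreover have "\<forall>t\<in>{0..\<tau> x}. flow X t (fst x) \<in> U" using elim by auto
      moreover have "flow X t (fst x) \<noteq> fst x" if "t \<in> {0<..\<tau> x}" for t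
      proof
        assume "flow X t (fst x) = fst x"
        then have "exp (\<rho> * t) *\<^sub>R (fst x - ?c) = 1 *\<^sub>R (fst x - ?c)"
          using fl l by (metis add_diff_cancel_left' scaleR_one)
        moreover have "fst x - ?c \<noteq> 0" using a0 by (auto simp: \<alpha>_def)
        ultimately have "exp (\<rho> * t) = 1" by (metis scaleR_right_imp_eq)
        then show False using r0 that by simp
      qed
      ultimately show "\<exists>T'. glide v l X (fst x) T' \<and> flow X T' (fst x) = snd x \<and> (\<forall>t\<in>{0..T'}. flow X t (fst x) \<in> U)
       \<and> (\<forall>t\<in>{0<..T'}. flow X t (fst x) \<noteq> fst x)" using end_eq by blast
    qed
  qed
qed

lemma exc_no_return:
  assumes X: "hfield X" and e: "exc v l X p T" and ne: "flow X T p \<noteq> p"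
  shows "\<forall>t\<in>{0<..T}. flow X t p \<noteq> p"
  using e ne unfolding exc_def by (metis greaterThanAtMost_iff greaterThanLessThan_iff less_irrefl order_le_less)

text \<open>
  The arcs by which a periodic orbit that leaves the strip at a line can return to it.
\<close>

definition link :: "plane \<Rightarrow> real \<Rightarrow> (plane \<Rightarrow> plane) \<Rightarrow> plane \<Rightarrow> real \<Rightarrow> bool" where
  "link v l X p T \<longleftrightarrow> (exc v l X p T \<or> glide v l X p T) \<and> flow X T p \<noteq> p"

lemma exc_velocity_neg:
  assumes X: "hfield X" and e: "exc v l X p T" and ne: "flow X T p \<noteq> p"
  shows "v \<bullet> X p < 0"
  using exc_velocity(1)[OF X e] exc_closed[OF X e] ne by (cases "v \<bullet> X p = 0") auto

text \<open>
  The ends of a perturbed excursion are subject to one condition, namely the invariance of their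
  sum, whereas the ends of a glide are free.
\<close>

lemma link_perturb:
  assumes X: "hfield X" and v: "v \<noteq> 0" and lk: "link v l X p T"
    and U: "open U" and sub: "\<forall>t\<in>{0..T}. flow X t p \<in> U"
  shows "\<forall>\<^sub>F x in nhds p \<times>\<^sub>F nhds (flow X T p). v \<bullet> fst x = l \<and> v \<bullet> snd x = l \<longrightarrow>
    (exc v l X p T \<longrightarrow> fst x + snd x = p + flow X T p) \<longrightarrow>
    (\<exists>T'. (if exc v l X p T then exc v l X (fst x) T' else glide v l X (fst x) T')
       \<and> flow X T' (fst x) = snd x \<and> (\<forall>t\<in>{0..T'}. flow X t (fst x) \<in> U)
       \<and> (\<forall>t\<in>{0<..T'}. flow X t (fst x) \<noteq> fst x))"
proof (cases "exc v l X p T")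
  case False
  then have g: "glide v l X p T" and ne: "flow X T p \<noteq> p" using lk unfolding link_def by auto
  from glide_perturb[OF X v g ne U sub] show ?thesis by (rule eventually_mono) (use False in auto)
next
  case True
  have ne: "flow X T p \<noteq> p" using lk unfolding link_def by auto
  let ?q = "flow X T p"
  have tf: "(fst \<longlongrightarrow> p) (nhds p \<times>\<^sub>F nhds ?q)" "(snd \<longlongrightarrow> ?q) (nhds p \<times>\<^sub>F nhds ?q)"
    by (rule filterlim_fst, rule filterlim_snd)
  have "\<forall>\<^sub>F x in nhds p \<times>\<^sub>F nhds ?q. v \<bullet> fst x = l \<longrightarrow>
    (\<exists>T'. exc v l X (fst x) T' \<and> (\<forall>t\<in>{0..T'}. flow X t (fst x) \<in> U))"
    using exc_perturb[OF X True exc_velocity_neg[OF X True ne] U sub] tf(1) by (rule eventually_compose_filterlim)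
  moreover have "((\<lambda>x. dist (fst x) (snd x)) \<longlongrightarrow> dist p ?q) (nhds p \<times>\<^sub>F nhds ?q)"
    by (intro tendsto_intros tf)
  then have "\<forall>\<^sub>F x in nhds p \<times>\<^sub>F nhds ?q. dist (fst x) (snd x) > 0"
    by (rule order_tendstoD(1)) (use ne in auto)
  ultimately show ?thesis
  proof eventually_elim
    case (elim x)
    show ?case
    proof (intro impI)
      assume l: "v \<bullet> fst x = l \<and> v \<bullet> snd x = l" and s: "exc v l X p T \<longrightarrow> fst x + snd x = p + ?q"
      then obtain T' where T': "exc v l X (fst x) T'" "\<forall>t\<in>{0..T'}. flow X t (fst x) \<in> U" using elim by auto
      have "fst x + snd x = fst x + flow X T' (fst x)"
        using s True exc_sum[OF X v T'(1) True] by simp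
      then have end_eq: "flow X T' (fst x) = snd x" by simp
      have "flow X T' (fst x) \<noteq> fst x" using elim(2) end_eq by auto
      from exc_no_return[OF X T'(1) this] T' end_eq True
      show "\<exists>T'. (if exc v l X p T then exc v l X (fst x) T' else glide v l X (fst x) T')
       \<and> flow X T' (fst x) = snd x \<and> (\<forall>t\<in>{0..T'}. flow X t (fst x) \<in> U)
       \<and> (\<forall>t\<in>{0<..T'}. flow X t (fst x) \<noteq> fst x)" by auto
    qed
  qed
qed

section \<open>Loops composed of arcs\<close>

text \<open>
  The predicate \<open>adm X S\<close> tells that a motion inside the set \<open>S\<close> may
  follow the field \<open>X\<close>. Keeping it abstract makes it possible to exchange the two
  half planes, and to regard a half plane as the middle zone of another system.
\<close>

definition arc_on :: "((plane \<Rightarrow> plane) \<Rightarrow> plane set \<Rightarrow> bool) \<Rightarrow> (real \<Rightarrow> plane) \<Rightarrow> real \<Rightarrow> real \<Rightarrow> bool" where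
  "arc_on adm \<gamma> a b \<longleftrightarrow> (\<exists>X. adm X (\<gamma> ` {a<..<b}) \<and> (\<forall>t\<in>{a<..<b}. (\<gamma> has_vector_derivative X (\<gamma> t)) (at t)))"

text \<open>
  The finite concatenations of arcs. The second rule makes them closed under composition, without
  any bookkeeping of the junctions.
\<close>

inductive itinerary :: "((plane \<Rightarrow> plane) \<Rightarrow> plane set \<Rightarrow> bool) \<Rightarrow> (real \<Rightarrow> plane) \<Rightarrow> real \<Rightarrow> real \<Rightarrow> bool"
  for adm \<gamma> where
  single: "a < b \<Longrightarrow> arc_on adm \<gamma> a b \<Longrightarrow> itinerary adm \<gamma> a b"
| trans: "itinerary adm \<gamma> a b \<Longrightarrow> itinerary adm \<gamma> b c \<Longrightarrow> itinerary adm \<gamma> a c"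

lemma itinerary_less: "itinerary adm \<gamma> a b \<Longrightarrow> a < b"
  by (induction rule: itinerary.induct) auto

lemma arc_on_shift:
  assumes "arc_on adm \<gamma> a b" and eq: "\<And>t. a < t \<Longrightarrow> t < b \<Longrightarrow> \<gamma>' (t + c) = \<gamma> t"
  shows "arc_on adm \<gamma>' (a + c) (b + c)"
proof -
  obtain X where X: "adm X (\<gamma> ` {a<..<b})" "\<And>t. t \<in> {a<..<b} \<Longrightarrow> (\<gamma> has_vector_derivative X (\<gamma> t)) (at t)"
    using assms(1) unfolding arc_on_def by blast
  have im: "\<gamma>' ` {a + c<..<b + c} = \<gamma> ` {a<..<b}"
  proof
    show "\<gamma>' ` {a + c<..<b + c} \<subseteq> \<gamma> ` {a<..<b}"
    proof
      fix y assume "y \<in> \<gamma>' ` {a + c<..<b + c}"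
      then obtain t where t: "t \<in> {a + c<..<b + c}" "y = \<gamma>' t" by blast
      then have "y = \<gamma> (t - c)" using eq[of "t - c"] by simp
      then show "y \<in> \<gamma> ` {a<..<b}" using t by auto
    qed
    show "\<gamma> ` {a<..<b} \<subseteq> \<gamma>' ` {a + c<..<b + c}"
    proof
      fix y assume "y \<in> \<gamma> ` {a<..<b}"
      then obtain t where t: "t \<in> {a<..<b}" "y = \<gamma> t" by blast
      then have "y = \<gamma>' (t + c)" using eq[of t] by simp
      then show "y \<in> \<gamma>' ` {a + c<..<b + c}" using t by auto
    qed
  qed
  have "(\<gamma>' has_vector_derivative X (\<gamma>' t)) (at t)" if t: "t \<in> {a + c<..<b + c}" for t
  proof -
    have t': "t - c \<in> {a<..<b}" using t by auto
    have "((\<lambda>t. t - c) has_vector_derivative 1) (at t)"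
      by (auto intro!: derivative_eq_intros)
    from vector_diff_chain_at[OF this X(2)[OF t']]
    have "((\<lambda>t. \<gamma> (t - c)) has_vector_derivative X (\<gamma> (t - c))) (at t)" by (simp add: o_def)
    moreover have "\<gamma> (s - c) = \<gamma>' s" if "s \<in> {a + c<..<b + c}" for s
      using that eq[of "s - c"] by simp
    ultimately show ?thesis
      using has_vector_derivative_transform_within_open[OF _ _ t, of "\<lambda>t. \<gamma> (t - c)" _ \<gamma>'] t by auto
  qed
  then show ?thesis unfolding arc_on_def im using X(1) by blast
qed

lemma itinerary_shift:
  "itinerary adm \<gamma> a b \<Longrightarrow> (\<And>t. a < t \<Longrightarrow> t < b \<Longrightarrow> \<gamma>' (t + c) = \<gamma> t) \<Longrightarrow> itinerary adm \<gamma>' (a + c) (b + c)"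
proof (induction rule: itinerary.induct)
  case (single a b)
  then show ?case by (intro itinerary.single arc_on_shift[of adm \<gamma>]) auto
next
  case (trans a b d)
  then show ?case using itinerary_less[of adm \<gamma>] by (intro itinerary.trans[of _ _ "a + c" "b + c" "d + c"]) force+
qed

text \<open>
  The traces of simple curves from \<open>p\<close> to \<open>q\<close>.
\<close>

definition tarc :: "((plane \<Rightarrow> plane) \<Rightarrow> plane set \<Rightarrow> bool) \<Rightarrow> plane set \<Rightarrow> plane \<Rightarrow> plane \<Rightarrow> bool" where
  "tarc adm S p q \<longleftrightarrow> (\<exists>\<gamma> T. itinerary adm \<gamma> 0 T \<and> continuous_on {0..T} \<gamma> \<and> inj_on \<gamma> {0..T}
     \<and> \<gamma> 0 = p \<and> \<gamma> T = q \<and> S = \<gamma> ` {0..T})"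

text \<open>
  The traces of simple closed curves.
\<close>

definition loop :: "((plane \<Rightarrow> plane) \<Rightarrow> plane set \<Rightarrow> bool) \<Rightarrow> plane set \<Rightarrow> bool" where
  "loop adm \<Gamma> \<longleftrightarrow> (\<exists>\<gamma> T. itinerary adm \<gamma> 0 T \<and> continuous_on {0..T} \<gamma> \<and> inj_on \<gamma> {0..<T}
     \<and> \<gamma> T = \<gamma> 0 \<and> \<Gamma> = \<gamma> ` {0..T})"

definition orbit :: "(plane \<Rightarrow> plane) \<Rightarrow> plane \<Rightarrow> real \<Rightarrow> plane set" where
  "orbit X p T = (\<lambda>t. flow X t p) ` {0..T}"

lemma flow_itinerary:
  assumes X: "hfield X" and T: "0 < T" and adm: "\<And>S. S \<subseteq> orbit X p T \<Longrightarrow> adm X S"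
  shows "itinerary adm (\<lambda>t. flow X t p) 0 T"
proof (rule itinerary.single[OF T])
  have "(\<lambda>t. flow X t p) ` {0<..<T} \<subseteq> orbit X p T" unfolding orbit_def by (intro image_mono) auto
  then have "adm X ((\<lambda>t. flow X t p) ` {0<..<T})" by (rule adm)
  then show "arc_on adm (\<lambda>t. flow X t p) 0 T"
    unfolding arc_on_def using flow_deriv[OF X] by blast
qed

lemma flow_tarc:
  assumes X: "hfield X" and T: "0 < T" and nr: "\<forall>t\<in>{0<..T}. flow X t p \<noteq> p"
    and adm: "\<And>S. S \<subseteq> orbit X p T \<Longrightarrow> adm X S"
  shows "tarc adm (orbit X p T) p (flow X T p)"
proof -
  have inj: "False" if "s < t" "0 \<le> s" "t \<le> T" "flow X s p = flow X t p" for s t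
  proof -
    have "flow X (t - s) p = p" by (rule flow_return_shift[OF X that(4)])
    moreover have "t - s \<in> {0<..T}" using that by auto
    ultimately show False using nr by blast
  qed
  have "inj_on (\<lambda>t. flow X t p) {0..T}"
  proof (rule inj_onI)
    fix s t assume "s \<in> {0..T}" "t \<in> {0..T}" "flow X s p = flow X t p"
    then show "s = t" using inj[of s t] inj[of t s] by (cases s t rule: linorder_cases) auto
  qed
  moreover have "continuous_on {0..T} (\<lambda>t. flow X t p)"
    by (intro flow_continuous[OF X] continuous_intros)
  moreover have "itinerary adm (\<lambda>t. flow X t p) 0 T"
    by (rule flow_itinerary[OF X T]) (rule adm)
  ultimately show ?thesis
    unfolding tarc_def orbit_def
    by (intro exI[of _ "\<lambda>t. flow X t p"] exI[of _ T]) simp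
qed

lemma join_curves:
  assumes i1: "itinerary adm \<gamma>1 0 a" and c1: "continuous_on {0..a} \<gamma>1"
    and i2: "itinerary adm \<gamma>2 0 b" and c2: "continuous_on {0..b} \<gamma>2"
    and eq: "\<gamma>1 a = \<gamma>2 0" and \<gamma>_def: "\<gamma> = (\<lambda>t. if t \<le> a then \<gamma>1 t else \<gamma>2 (t - a))"
  shows "itinerary adm \<gamma> 0 (a + b)" "continuous_on {0..a + b} \<gamma>" "\<gamma> ` {0..a + b} = \<gamma>1 ` {0..a} \<union> \<gamma>2 ` {0..b}"
    "\<gamma> 0 = \<gamma>1 0" "\<gamma> (a + b) = \<gamma>2 b"
proof -
  have ab: "0 < a" "0 < b" using itinerary_less i1 i2 by blast+
  have "itinerary adm \<gamma> (0 + 0) (a + 0)"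
    by (rule itinerary_shift[OF i1]) (simp add: \<gamma>_def)
  moreover have "itinerary adm \<gamma> (0 + a) (b + a)"
    by (rule itinerary_shift[OF i2]) (simp add: \<gamma>_def)
  ultimately show "itinerary adm \<gamma> 0 (a + b)"
    using itinerary.trans[of adm \<gamma> 0 a "a + b"] by (simp add: add.commute)
  have eq2: "\<gamma> t = \<gamma>2 (t - a)" if "a \<le> t" for t using that eq by (auto simp: \<gamma>_def)
  have "continuous_on ({0..a} \<union> {a..a+b}) \<gamma>"
  proof (rule continuous_on_closed_Un)
    show "continuous_on {0..a} \<gamma>" using c1 by (rule continuous_on_cong[THEN iffD1, rotated 2]) (auto simp: \<gamma>_def)
    have "continuous_on {a..a+b} (\<lambda>t. \<gamma>2 (t - a))"
      by (rule continuous_on_compose2[OF c2]) (auto intro!: continuous_intros)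
    then show "continuous_on {a..a+b} \<gamma>"
      by (rule continuous_on_cong[THEN iffD1, rotated 2]) (auto simp: eq2)
  qed auto
  moreover have un: "{0..a} \<union> {a..a+b} = {0..a+b}" using ab by auto
  ultimately show "continuous_on {0..a + b} \<gamma>" by simp
  have "\<gamma> ` {a..a+b} = \<gamma>2 ` {0..b}"
  proof -
    have "\<gamma> ` {a..a+b} = \<gamma> ` ((+) a ` {0..b})" by (simp add: add.commute)
    also have "\<dots> = \<gamma>2 ` {0..b}" unfolding image_image by (intro image_cong refl) (simp add: eq2)
    finally show ?thesis .
  qed
  moreover have "\<gamma> ` {0..a} = \<gamma>1 ` {0..a}" by (intro image_cong) (auto simp: \<gamma>_def)
  ultimately show "\<gamma> ` {0..a + b} = \<gamma>1 ` {0..a} \<union> \<gamma>2 ` {0..b}"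
    unfolding un[symmetric] image_Un by simp
  show "\<gamma> 0 = \<gamma>1 0" "\<gamma> (a + b) = \<gamma>2 b" using ab by (simp_all add: \<gamma>_def)
qed

lemma tarc_join:
  assumes "tarc adm S p q" "tarc adm S' q r" and int: "S \<inter> S' \<subseteq> {q}"
  shows "tarc adm (S \<union> S') p r"
proof -
  obtain \<gamma>1 a where 1: "itinerary adm \<gamma>1 0 a" "continuous_on {0..a} \<gamma>1" "inj_on \<gamma>1 {0..a}"
    "\<gamma>1 0 = p" "\<gamma>1 a = q" "S = \<gamma>1 ` {0..a}" using assms(1) unfolding tarc_def by blast
  obtain \<gamma>2 b where 2: "itinerary adm \<gamma>2 0 b" "continuous_on {0..b} \<gamma>2" "inj_on \<gamma>2 {0..b}"
    "\<gamma>2 0 = q" "\<gamma>2 b = r" "S' = \<gamma>2 ` {0..b}" using assms(2) unfolding tarc_def by blast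
  have ab: "0 < a" "0 < b" using itinerary_less 1 2 by blast+
  define \<gamma> where "\<gamma> = (\<lambda>t. if t \<le> a then \<gamma>1 t else \<gamma>2 (t - a))"
  have eq: "\<gamma>1 a = \<gamma>2 0" using 1 2 by simp
  note J = join_curves[OF 1(1,2) 2(1,2) eq \<gamma>_def]
  have mix: "False" if "0 \<le> s" "s \<le> a" "a < t" "t \<le> a + b" "\<gamma>1 s = \<gamma>2 (t - a)" for s t
  proof -
    have "\<gamma>1 s \<in> S" unfolding 1(6) using that by (intro imageI) simp
    moreover have "\<gamma>2 (t - a) \<in> S'" unfolding 2(6) using that by (intro imageI) simp
    ultimately have "\<gamma>2 (t - a) \<in> S \<inter> S'" using that(5) by simp
    then have "\<gamma>2 (t - a) = \<gamma>2 0" using int 2(4) by blast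
    then have "t - a = 0" using inj_onD[OF 2(3), of "t - a" 0] that ab by auto
    then show False using that by simp
  qed
  have "inj_on \<gamma> {0..a + b}"
  proof (rule inj_onI)
    fix s t assume st: "s \<in> {0..a+b}" "t \<in> {0..a+b}" and e: "\<gamma> s = \<gamma> t"
    show "s = t"
    proof (cases "s \<le> a"; cases "t \<le> a")
      assume "s \<le> a" "t \<le> a"
      then show ?thesis using e st inj_onD[OF 1(3), of s t] by (simp add: \<gamma>_def)
    next
      assume "s \<le> a" "\<not> t \<le> a"
      then show ?thesis using e st mix[of s t] by (simp add: \<gamma>_def)
    next
      assume "\<not> s \<le> a" "t \<le> a"
      then show ?thesis using e st mix[of t s] by (simp add: \<gamma>_def)
    next
      assume "\<not> s \<le> a" "\<not> t \<le> a"
      then show ?thesis using e st inj_onD[OF 2(3), of "s - a" "t - a"] by (simp add: \<gamma>_def)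
    qed
  qed
  with J 1(4,6) 2(5,6) show ?thesis
    unfolding tarc_def by (intro exI[of _ \<gamma>] exI[of _ "a + b"]) simp
qed

lemma tarc_close:
  assumes "tarc adm S p q" "tarc adm S' q p" and int: "S \<inter> S' \<subseteq> {p, q}"
  shows "loop adm (S \<union> S')"
proof -
  obtain \<gamma>1 a where 1: "itinerary adm \<gamma>1 0 a" "continuous_on {0..a} \<gamma>1" "inj_on \<gamma>1 {0..a}"
    "\<gamma>1 0 = p" "\<gamma>1 a = q" "S = \<gamma>1 ` {0..a}" using assms(1) unfolding tarc_def by blast
  obtain \<gamma>2 b where 2: "itinerary adm \<gamma>2 0 b" "continuous_on {0..b} \<gamma>2" "inj_on \<gamma>2 {0..b}"
    "\<gamma>2 0 = q" "\<gamma>2 b = p" "S' = \<gamma>2 ` {0..b}" using assms(2) unfolding tarc_def by blast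
  have ab: "0 < a" "0 < b" using itinerary_less 1 2 by blast+
  define \<gamma> where "\<gamma> = (\<lambda>t. if t \<le> a then \<gamma>1 t else \<gamma>2 (t - a))"
  have eq: "\<gamma>1 a = \<gamma>2 0" using 1 2 by simp
  note J = join_curves[OF 1(1,2) 2(1,2) eq \<gamma>_def]
  have mix: "False" if "0 \<le> s" "s \<le> a" "a < t" "t < a + b" "\<gamma>1 s = \<gamma>2 (t - a)" for s t
  proof -
    have "\<gamma>1 s \<in> S" unfolding 1(6) using that by (intro imageI) simp
    moreover have "\<gamma>2 (t - a) \<in> S'" unfolding 2(6) using that by (intro imageI) simp
    ultimately have "\<gamma>2 (t - a) \<in> S \<inter> S'" using that(5) by simp
    then have "\<gamma>2 (t - a) = \<gamma>2 0 \<or> \<gamma>2 (t - a) = \<gamma>2 b" using int 2(4,5) by blast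
    then have "t - a = 0 \<or> t - a = b"
      using inj_onD[OF 2(3), of "t - a" 0] inj_onD[OF 2(3), of "t - a" b] that ab by auto
    then show False using that by auto
  qed
  have "inj_on \<gamma> {0..<a + b}"
  proof (rule inj_onI)
    fix s t assume st: "s \<in> {0..<a+b}" "t \<in> {0..<a+b}" and e: "\<gamma> s = \<gamma> t"
    show "s = t"
    proof (cases "s \<le> a"; cases "t \<le> a")
      assume "s \<le> a" "t \<le> a"
      then show ?thesis using e st inj_onD[OF 1(3), of s t] by (simp add: \<gamma>_def)
    next
      assume "s \<le> a" "\<not> t \<le> a"
      then show ?thesis using e st mix[of s t] by (simp add: \<gamma>_def)
    next
      assume "\<not> s \<le> a" "t \<le> a"
      then show ?thesis using e st mix[of t s] by (simp add: \<gamma>_def)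
    next
      assume "\<not> s \<le> a" "\<not> t \<le> a"
      then show ?thesis using e st inj_onD[OF 2(3), of "s - a" "t - a"] by (simp add: \<gamma>_def)
    qed
  qed
  with J 1(4,6) 2(5,6) show ?thesis
    unfolding loop_def by (intro exI[of _ \<gamma>] exI[of _ "a + b"]) simp
qed

definition isolated_loop :: "((plane \<Rightarrow> plane) \<Rightarrow> plane set \<Rightarrow> bool) \<Rightarrow> plane set \<Rightarrow> bool" where
  "isolated_loop adm \<Gamma> \<longleftrightarrow> (\<exists>U. open U \<and> \<Gamma> \<subseteq> U \<and> (\<forall>\<Gamma>'. loop adm \<Gamma>' \<and> \<Gamma>' \<subseteq> U \<longrightarrow> \<Gamma>' = \<Gamma>))"

text \<open>
  The homotheties with centre at the singular point commute with the flow, so that the images of a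
  closed orbit are closed orbits. Those with ratio less than one stay in the zone, because the
  zone is convex and reaches the level of the singular point.
\<close>

lemma closed_orbit_not_isolated:
  assumes X: "hfield X" and T: "0 < T" and cl: "flow X T p = p" and nr: "\<forall>t\<in>{0<..<T}. flow X t p \<noteq> p"
    and I: "is_interval (I :: real set)" and inI: "\<forall>t\<in>{0..T}. v \<bullet> flow X t p \<in> I"
    and adm: "\<And>S. (\<forall>q\<in>S. v \<bullet> q \<in> I) \<Longrightarrow> adm X S"
  shows "\<not> isolated_loop adm (orbit X p T)"
proof
  let ?c = "centre X"
  assume "isolated_loop adm (orbit X p T)"
  then obtain U where U: "open U" "orbit X p T \<subseteq> U" "\<And>\<Gamma>'. loop adm \<Gamma>' \<Longrightarrow> \<Gamma>' \<subseteq> U \<Longrightarrow> \<Gamma>' = orbit X p T"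
    unfolding isolated_loop_def by blast
  \<comment> \<open>the velocity is periodic, so that its derivative vanishes somewhere, and there the orbit has the abscissa of the centre\<close>
  have D: "((\<lambda>t. v \<bullet> X (flow X t p)) has_derivative (\<lambda>h. (disc X * (v \<bullet> flow X t p - v \<bullet> ?c)) * h)) (at t)" for t
    using flow_vel_deriv[OF X, of v p t UNIV] by (simp add: has_field_derivative_def)
  have "v \<bullet> X (flow X 0 p) = v \<bullet> X (flow X T p)" using cl by simp
  then obtain t where t: "0 < t" "t < T" "(\<lambda>h. (disc X * (v \<bullet> flow X t p - v \<bullet> ?c)) * h) = (\<lambda>h. 0)"
    using Rolle_deriv[OF T _ flow_vel_continuous[OF X] D] by blast
  then have "disc X * (v \<bullet> flow X t p - v \<bullet> ?c) = 0" by (metis mult.right_neutral)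
  then have "v \<bullet> flow X t p = v \<bullet> ?c" using hfield_disc[OF X] by simp
  then have cI: "v \<bullet> ?c \<in> I" using inI t by (metis atLeastAtMost_iff less_imp_le)
  have scale: "flow X t (?c + s *\<^sub>R (p - ?c)) = ?c + s *\<^sub>R (flow X t p - ?c)" for s t
  proof -
    have "X (?c + s *\<^sub>R (p - ?c)) = s *\<^sub>R X p"
      using hfield_affine[OF X, of s "p - ?c" 0 0] by simp
    then show ?thesis unfolding flow_def by (simp add: algebra_simps)
  qed
  have "((\<lambda>s. ?c + s *\<^sub>R (p - ?c)) \<longlongrightarrow> ?c + 1 *\<^sub>R (p - ?c)) (at_left (1::real))"
    by (intro tendsto_intros)
  then have lim: "((\<lambda>s. ?c + s *\<^sub>R (p - ?c)) \<longlongrightarrow> p) (at_left (1::real))" by simp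
  have "\<forall>\<^sub>F p' in nhds p. \<forall>t\<in>{0..T}. flow X t p' \<in> U"
    by (rule flow_tube[OF X U(1)]) (use U(2) in \<open>auto simp: orbit_def\<close>)
  then have "\<forall>\<^sub>F s in at_left (1::real). \<forall>t\<in>{0..T}. flow X t (?c + s *\<^sub>R (p - ?c)) \<in> U"
    using lim by (rule eventually_compose_filterlim)
  moreover have "\<forall>\<^sub>F s in at_left (1::real). 0 < s \<and> s < 1"
    unfolding eventually_at_left_field by (rule exI[of _ 0]) auto
  ultimately have "\<forall>\<^sub>F s in at_left (1::real). (0 < s \<and> s < 1) \<and> (\<forall>t\<in>{0..T}. flow X t (?c + s *\<^sub>R (p - ?c)) \<in> U)"
    by eventually_elim auto
  then obtain s where s: "0 < s" "s < 1" "\<forall>t\<in>{0..T}. flow X t (?c + s *\<^sub>R (p - ?c)) \<in> U"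
    using eventually_happens'[OF trivial_limit_at_left_real] by blast
  define p' where "p' = ?c + s *\<^sub>R (p - ?c)"
  have sc: "flow X t p' = ?c + s *\<^sub>R (flow X t p - ?c)" for t unfolding p'_def by (rule scale)
  have in': "v \<bullet> flow X t p' \<in> I" if "t \<in> {0..T}" for t
  proof -
    have "convex I" using I by (simp add: is_interval_convex_1)
    then have "(1 - s) *\<^sub>R (v \<bullet> ?c) + s *\<^sub>R (v \<bullet> flow X t p) \<in> I"
      using cI inI that s by (intro convexD_alt) auto
    then show ?thesis unfolding sc by (simp add: inner_add_right inner_diff_right algebra_simps)
  qed
  have loop': "loop adm (orbit X p' T)"
    unfolding loop_def
  proof (intro exI conjI)
    show "itinerary adm (\<lambda>t. flow X t p') 0 T"
    proof (rule flow_itinerary[OF X T])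
      fix S assume "S \<subseteq> orbit X p' T"
      then have "\<forall>q\<in>S. v \<bullet> q \<in> I" unfolding orbit_def using in' by blast
      then show "adm X S" by (rule adm)
    qed
    show "continuous_on {0..T} (\<lambda>t. flow X t p')" by (intro flow_continuous[OF X] continuous_intros)
    have inj: "False" if "a < b" "0 \<le> a" "b < T" "flow X a p' = flow X b p'" for a b
    proof -
      have "flow X a p = flow X b p" using that(4) s unfolding sc by simp
      then have "flow X (b - a) p = p" by (rule flow_return_shift[OF X])
      moreover have "b - a \<in> {0<..<T}" using that by auto
      ultimately show False using nr by blast
    qed
    show "inj_on (\<lambda>t. flow X t p') {0..<T}"
    proof (rule inj_onI)
      fix a b assume "a \<in> {0..<T}" "b \<in> {0..<T}" "flow X a p' = flow X b p'"
      then show "a = b" using inj[of a b] inj[of b a] by (cases a b rule: linorder_cases) auto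
    qed
    show "flow X T p' = flow X 0 p'" unfolding sc using cl by simp
  qed (simp add: orbit_def)
  have "orbit X p' T \<subseteq> U" using s(3) unfolding orbit_def p'_def by auto
  then have same: "orbit X p' T = orbit X p T" using U(3) loop' by blast
  \<comment> \<open>the image differs from the orbit, as the largest distance from the centre is smaller\<close>
  have cont: "continuous_on {0..T} (\<lambda>t. norm (flow X t p - ?c))"
    by (intro continuous_intros flow_continuous[OF X])
  obtain m where m: "m \<in> {0..T}" "\<And>t. t \<in> {0..T} \<Longrightarrow> norm (flow X t p - ?c) \<le> norm (flow X m p - ?c)"
    using continuous_attains_sup[OF compact_Icc _ cont] T by auto
  have "p \<noteq> ?c"
  proof
    assume "p = ?c"
    then have "flow X (T/2) p = p" using hfield_zero[OF X] by (simp add: flow_def)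
    then show False using nr T by simp
  qed
  then have pos: "0 < norm (flow X m p - ?c)" using m(2)[of 0] T by auto
  have "flow X m p \<in> orbit X p' T" using same m(1) unfolding orbit_def by blast
  then obtain t where t: "t \<in> {0..T}" "flow X m p = flow X t p'" unfolding orbit_def by blast
  have "norm (flow X m p - ?c) = s * norm (flow X t p - ?c)" using t(2) s unfolding sc by simp
  also have "\<dots> \<le> s * norm (flow X m p - ?c)" using m(2)[OF t(1)] s by simp
  also have "\<dots> < norm (flow X m p - ?c)" using pos s by simp
  finally show False by simp
qed

section \<open>Shrinking and enlarging loops\<close>

lemma exc_le:
  assumes e: "exc v l X p T" and t: "t \<in> {0..T}"
  shows "v \<bullet> flow X t p \<le> l"
proof -
  consider "t = 0" | "t = T" | "t \<in> {0<..<T}" using t by fastforce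
  then show ?thesis
  proof cases
    case 3
    then have "v \<bullet> flow X t p < l" using e unfolding exc_def by blast
    then show ?thesis by simp
  qed (use e in \<open>simp_all add: exc_def\<close>)
qed

lemma link_end:
  assumes X: "hfield X" and lk: "link v l X p T"
  shows "0 < T" "v \<bullet> p = l" "v \<bullet> flow X T p = l" "flow X T p \<noteq> p"
    "t \<in> {0..T} \<Longrightarrow> v \<bullet> flow X t p \<le> l"
proof -
  show T: "0 < T" using lk unfolding link_def exc_def glide_def by auto
  have g: "v \<bullet> flow X t p = l" if "glide v l X p T" "t \<in> {0..T}" for t
    using that unfolding glide_def by blast
  have e: "exc v l X p T \<or> glide v l X p T" using lk unfolding link_def by blast
  show "v \<bullet> p = l" using e g[of 0] T unfolding exc_def by auto
  show "v \<bullet> flow X T p = l" using e g[of T] T unfolding exc_def by auto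
  show "flow X T p \<noteq> p" using lk unfolding link_def by simp
  show "v \<bullet> flow X t p \<le> l" if "t \<in> {0..T}"
    using e g[OF _ that] exc_le[of v l X p T, OF _ that] by auto
qed

lemma link_region:
  assumes T': "if exc v l X p T then exc v l X p' T' else glide v l X p' T'"
    and r: "r \<in> orbit X p' T'"
  shows "v \<bullet> r \<le> l" "\<not> exc v l X p T \<Longrightarrow> v \<bullet> r = l"
proof -
  obtain t where t: "t \<in> {0..T'}" "r = flow X t p'" using r unfolding orbit_def by blast
  show "v \<bullet> r \<le> l"
  proof (cases "exc v l X p T")
    case True
    then have "exc v l X p' T'" using T' by simp
    from exc_le[OF this t(1)] show ?thesis using t(2) by simp
  next
    case False
    then show ?thesis using t T' unfolding glide_def by simp
  qed
  show "v \<bullet> r = l" if "\<not> exc v l X p T"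
    using that t T' unfolding glide_def by simp
qed

lemma line_points_sum:
  assumes Y: "hfield Y" and nd: "nondeg v Y"
    and on: "v \<bullet> a = l" "v \<bullet> b = l" "v \<bullet> a' = l" "v \<bullet> b' = l"
    and vel: "v \<bullet> Y a + v \<bullet> Y b = v \<bullet> Y a' + v \<bullet> Y b'"
  shows "a + b = a' + b'"
proof -
  have "a = a' + b' - b"
  proof (rule nondegD[OF nd])
    show "v \<bullet> a = v \<bullet> (a' + b' - b)" using on by (simp add: inner_add_right inner_diff_right)
    have "Y (a' + b' - b) + Y b = Y a' + Y b'" by (rule field_sum[OF Y]) simp
    then have "v \<bullet> Y (a' + b' - b) + v \<bullet> Y b = v \<bullet> Y a' + v \<bullet> Y b'" by (metis inner_add_right)
    then show "v \<bullet> Y a = v \<bullet> Y (a' + b' - b)" using vel by simp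
  qed
  then show ?thesis by simp
qed

text \<open>
  If \<open>L u\<close> is the point of the line with velocity \<open>u\<close>, then
  \<open>L (- u) + L u\<close> does not depend on \<open>u\<close>. Hence
  \<open>L (- u)\<close> and \<open>L u\<close> are joined by a link on one side and by an
  excursion on the other side for all \<open>u\<close> near the velocity \<open>z\<close> of the
  given loop. For \<open>u < z\<close> the excursion stays below the level \<open>m\<close>.

  The set on which the outer field must be admissible is restricted to the line if the link is a
  glide. This matters when a loop in a half plane glides along its boundary following the field of
  the other side.
\<close>

theorem two_zone_not_isolated:
  assumes X: "hfield X" and Y: "hfield Y" and v: "v \<noteq> 0" and ndY: "nondeg v Y"
    and lk: "link v l X p T" and q: "flow X T p = q"
    and turn: "exc (- v) (- l) Y q S" and close: "flow Y S q = p"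
    and below: "\<forall>t\<in>{0..S}. v \<bullet> flow Y t q \<le> m"
    and admX: "\<And>A. \<forall>r\<in>A. v \<bullet> r \<le> l \<and> (\<not> exc v l X p T \<longrightarrow> v \<bullet> r = l) \<Longrightarrow> adm X A"
    and admY: "\<And>A. \<forall>r\<in>A. l \<le> v \<bullet> r \<and> v \<bullet> r \<le> m \<Longrightarrow> adm Y A"
  shows "\<not> isolated_loop adm (orbit X p T \<union> orbit Y q S)"
proof
  assume "isolated_loop adm (orbit X p T \<union> orbit Y q S)"
  then obtain U where U: "open U" "orbit X p T \<subseteq> U" "orbit Y q S \<subseteq> U"
    "\<And>\<Gamma>'. loop adm \<Gamma>' \<Longrightarrow> \<Gamma>' \<subseteq> U \<Longrightarrow> \<Gamma>' = orbit X p T \<union> orbit Y q S"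
    unfolding isolated_loop_def by auto
  define L where "L = level_point v Y l"
  define z where "z = v \<bullet> Y q"
  have S: "0 < S" using turn unfolding exc_def by simp
  have vq: "v \<bullet> q = l" and vp: "v \<bullet> p = l" and pq: "q \<noteq> p" using link_end[OF X lk] q by simp_all
  have zp: "v \<bullet> Y p = - z" using exc_velocity(2)[OF Y turn] close by (simp add: z_def)
  have "z \<noteq> 0" using nondegD[OF ndY, of p q] vp vq zp pq by (auto simp: z_def)
  then have zpos: "0 < z" using exc_velocity(1)[OF Y turn] by (simp add: z_def)
  have qL: "q = L z" and pL: "p = L (- z)"
    using level_point_unique[OF Y v ndY, of q] level_point_unique[OF Y v ndY, of p] vp vq zp by (simp_all add: L_def z_def)
  note LL = level_point[OF Y v ndY, of l, folded L_def]
  have sum: "L (- u) + L u = p + q" for u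
    by (rule line_points_sum[OF Y ndY]) (use LL vp vq zp in \<open>simp_all add: z_def\<close>)
  obtain t where t: "0 < t" "t < S" and turn': "\<forall>\<^sub>F q' in nhds q. v \<bullet> q' = l \<and> 0 < v \<bullet> Y q' \<and> v \<bullet> Y q' < v \<bullet> Y q \<longrightarrow>
      (\<exists>S'. exc (- v) (- l) Y q' S' \<and> (\<forall>s\<in>{0..S'}. flow Y s q' \<in> U \<and> v \<bullet> flow Y s q' < v \<bullet> flow Y t q))"
    using turn_perturb_inward[OF Y turn _ U(1)] zpos U(3) unfolding z_def orbit_def by blast
  have lt: "l < v \<bullet> flow Y t q" using turn t unfolding exc_def by auto
  have limz: "((\<lambda>u. u) \<longlongrightarrow> z) (at_left z)" by (rule tendsto_ident_at)
  have limq: "(L \<longlongrightarrow> q) (at_left z)" using level_point_tendsto[OF limz, of v Y l] qL by (simp add: L_def)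
  have "((\<lambda>u. L (- u)) \<longlongrightarrow> p) (at_left z)"
    using level_point_tendsto[OF tendsto_minus[OF limz], of v Y l] pL by (simp add: L_def)
  then have limpq: "filterlim (\<lambda>u. (L (- u), L u)) (nhds p \<times>\<^sub>F nhds (flow X T p)) (at_left z)"
    unfolding q using limq by (rule filterlim_Pair)
  have "\<forall>t\<in>{0..T}. flow X t p \<in> U" using U(2) unfolding orbit_def by auto
  from eventually_compose_filterlim[OF link_perturb[OF X v lk U(1) this] limpq]
  have "\<forall>\<^sub>F u in at_left z. \<exists>T'. (if exc v l X p T then exc v l X (L (- u)) T' else glide v l X (L (- u)) T')
       \<and> flow X T' (L (- u)) = L u \<and> (\<forall>t\<in>{0..T'}. flow X t (L (- u)) \<in> U)
       \<and> (\<forall>t\<in>{0<..T'}. flow X t (L (- u)) \<noteq> L (- u))"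
    by eventually_elim (use LL sum q in auto)
  moreover have "\<forall>\<^sub>F u in at_left z. 0 < u \<and> u < z"
    unfolding eventually_at_left_field using zpos by blast
  moreover note eventually_compose_filterlim[OF turn' limq]
  ultimately obtain u where u: "0 < u" "u < z" and
    ex: "\<exists>T'. (if exc v l X p T then exc v l X (L (- u)) T' else glide v l X (L (- u)) T')
       \<and> flow X T' (L (- u)) = L u \<and> (\<forall>t\<in>{0..T'}. flow X t (L (- u)) \<in> U)
       \<and> (\<forall>t\<in>{0<..T'}. flow X t (L (- u)) \<noteq> L (- u))"
    and ey: "v \<bullet> L u = l \<and> 0 < v \<bullet> Y (L u) \<and> v \<bullet> Y (L u) < v \<bullet> Y q \<longrightarrow>
      (\<exists>S'. exc (- v) (- l) Y (L u) S' \<and> (\<forall>s\<in>{0..S'}. flow Y s (L u) \<in> U \<and> v \<bullet> flow Y s (L u) < v \<bullet> flow Y t q))"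
    using eventually_happens'[OF trivial_limit_at_left_real[of z] eventually_conj[OF _ eventually_conj]] by blast
  obtain T' where T': "if exc v l X p T then exc v l X (L (- u)) T' else glide v l X (L (- u)) T'"
    "flow X T' (L (- u)) = L u" "\<forall>t\<in>{0..T'}. flow X t (L (- u)) \<in> U" "\<forall>t\<in>{0<..T'}. flow X t (L (- u)) \<noteq> L (- u)"
    using ex by blast
  have "v \<bullet> L u = l \<and> 0 < v \<bullet> Y (L u) \<and> v \<bullet> Y (L u) < v \<bullet> Y q"
    using LL u by (simp add: z_def[symmetric])
  with ey obtain S' where S': "exc (- v) (- l) Y (L u) S'" "\<forall>s\<in>{0..S'}. flow Y s (L u) \<in> U \<and> v \<bullet> flow Y s (L u) < v \<bullet> flow Y t q"
    by blast
  define p' q' where "p' = L (- u)" and "q' = L u"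
  have T'pos: "0 < T'" using T'(1) unfolding exc_def glide_def by (auto split: if_splits)
  have S'pos: "0 < S'" and S'l: "v \<bullet> flow Y S' q' = l" and inn: "\<And>s. 0 < s \<Longrightarrow> s < S' \<Longrightarrow> l < v \<bullet> flow Y s q'"
    using S'(1) unfolding exc_def q'_def by auto
  have close': "flow Y S' q' = p'"
  proof (rule nondegD[OF ndY])
    show "v \<bullet> flow Y S' q' = v \<bullet> p'" using S'l LL by (simp add: p'_def)
    show "v \<bullet> Y (flow Y S' q') = v \<bullet> Y p'"
      using exc_velocity(2)[OF Y S'(1)] LL by (simp add: p'_def q'_def)
  qed
  have pq': "p' \<noteq> q'" using LL(2)[of u] LL(2)[of "- u"] u unfolding p'_def q'_def by force
  note reg = link_region[OF T'(1), folded p'_def]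
  have regY: "l \<le> v \<bullet> r \<and> v \<bullet> r < v \<bullet> flow Y t q \<and> (v \<bullet> r \<le> l \<longrightarrow> r = p' \<or> r = q')" if r: "r \<in> orbit Y q' S'" for r
  proof -
    obtain s where s: "s \<in> {0..S'}" "r = flow Y s q'" using r unfolding orbit_def by blast
    have "v \<bullet> r < v \<bullet> flow Y t q" using S'(2) s unfolding q'_def by simp
    moreover have "s = 0 \<or> s = S' \<or> (0 < s \<and> s < S')" using s by auto
    ultimately show ?thesis using inn[of s] s close' LL(1) by (auto simp: q'_def p'_def)
  qed
  have arcX: "tarc adm (orbit X p' T') p' q'"
  proof -
    have "tarc adm (orbit X p' T') p' (flow X T' p')"
    proof (rule flow_tarc[OF X T'pos])
      show "\<forall>t\<in>{0<..T'}. flow X t p' \<noteq> p'" using T'(4) by (simp add: p'_def)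
      fix A assume "A \<subseteq> orbit X p' T'"
      then have "\<forall>r\<in>A. v \<bullet> r \<le> l \<and> (\<not> exc v l X p T \<longrightarrow> v \<bullet> r = l)"
        using reg by (meson subsetD)
      then show "adm X A" by (rule admX)
    qed
    then show ?thesis using T'(2) by (simp add: p'_def q'_def)
  qed
  have arcY: "tarc adm (orbit Y q' S') q' p'"
  proof -
    have "tarc adm (orbit Y q' S') q' (flow Y S' q')"
    proof (rule flow_tarc[OF Y S'pos])
      show "\<forall>t\<in>{0<..S'}. flow Y t q' \<noteq> q'"
        by (rule exc_no_return[OF Y S'(1)[folded q'_def]]) (use close' pq' in simp)
      fix A assume "A \<subseteq> orbit Y q' S'"
      moreover have "v \<bullet> flow Y t q \<le> m" using below t by simp
      ultimately have "\<forall>r\<in>A. l \<le> v \<bullet> r \<and> v \<bullet> r \<le> m"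
        by (meson less_imp_le less_le_trans regY subsetD)
      then show "adm Y A" by (rule admY)
    qed
    then show ?thesis using close' by simp
  qed
  have "orbit X p' T' \<inter> orbit Y q' S' \<subseteq> {p', q'}"
  proof
    fix r assume "r \<in> orbit X p' T' \<inter> orbit Y q' S'"
    then show "r \<in> {p', q'}" using regY[of r] reg(1)[of r] by blast
  qed
  from tarc_close[OF arcX arcY this] have "loop adm (orbit X p' T' \<union> orbit Y q' S')" .
  moreover have "orbit X p' T' \<union> orbit Y q' S' \<subseteq> U"
    using T'(3) S'(2) unfolding orbit_def p'_def q'_def by auto
  ultimately have same: "orbit X p' T' \<union> orbit Y q' S' = orbit X p T \<union> orbit Y q S" by (rule U(4))
  \<comment> \<open>the new loop misses the turning point of the old one\<close>
  have "flow Y t q \<in> orbit Y q S" using t unfolding orbit_def by auto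
  then have "flow Y t q \<in> orbit X p' T' \<union> orbit Y q' S'" using same by blast
  then show False using regY[of "flow Y t q"] reg(1)[of "flow Y t q"] lt by auto
qed

text \<open>
  The points are numbered in the order in which they are passed: the orbit enters the strip at
  \<open>p1\<close>, leaves it at \<open>p2\<close>, enters it again at \<open>p3\<close> and
  leaves it at \<open>p0\<close>.
\<close>

definition three_zone_cycle where
  "three_zone_cycle v lL lR X Y Z p0 p1 p2 p3 Ta Tb Tc Td \<longleftrightarrow>
     cross v lL lR Y p1 Ta \<and> flow Y Ta p1 = p2 \<and> link (- v) (- lR) Z p2 Tb \<and> flow Z Tb p2 = p3
     \<and> cross (- v) (- lR) (- lL) Y p3 Tc \<and> flow Y Tc p3 = p0 \<and> link v lL X p0 Td \<and> flow X Td p0 = p1"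

text \<open>
  The sign of the velocity separates the crossings in the two directions, and the energy separates
  crossings in the same direction that start with different velocities.
\<close>

lemma cross_region:
  assumes Y: "hfield Y" and lm: "l < m" and c: "cross v l m Y p T" and r: "r \<in> orbit Y p T"
  obtains "r = p" | "r = flow Y T p" | "l < v \<bullet> r" "v \<bullet> r < m" "0 < v \<bullet> Y r" "energy v Y r = energy v Y p"
proof -
  obtain t where t: "t \<in> {0..T}" "r = flow Y t p" using r unfolding orbit_def by blast
  consider "t = 0" | "t = T" | "t \<in> {0<..<T}" using t by fastforce
  then show ?thesis
  proof cases
    case 3
    have "0 < v \<bullet> Y r" using cross_velocity(1)[OF Y lm c] 3 t by simp
    moreover have "l < v \<bullet> r" "v \<bullet> r < m" using c 3 t unfolding cross_def by auto
    moreover have "energy v Y r = energy v Y p" using energy_flow[OF Y] t by simp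
    ultimately show ?thesis using that(3) by blast
  qed (use t that in simp_all)
qed

lemma cross_no_return:
  assumes lm: "l < m" and c: "cross v l m Y p T" and t: "t \<in> {0<..T}"
  shows "flow Y t p \<noteq> p"
proof
  assume e: "flow Y t p = p"
  consider "t = T" | "t \<in> {0<..<T}" using t by fastforce
  then show False
  proof cases
    case 1 then show False using c e lm unfolding cross_def by auto
  next
    case 2
    then have "l < v \<bullet> flow Y t p" using c unfolding cross_def by blast
    then show False using c e unfolding cross_def by simp
  qed
qed

text \<open>
  The functions \<open>f0\<close> to \<open>f3\<close> prescribe the velocities at the four
  corners of a perturbed loop. The squares are those of a crossing by the equation for
  \<open>D\<close>, and the sum of the velocities at the two ends of an excursion must be
  preserved. Velocities that are larger in modulus at the beginning of both crossings make the
  perturbed arcs cross the strip.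
\<close>

theorem three_zone_not_isolated:
  assumes X: "hfield X" and Y: "hfield Y" and Z: "hfield Z" and v: "v \<noteq> 0" and lr: "lL < lR"
    and ndY: "nondeg v Y"
    and cyc: "three_zone_cycle v lL lR X Y Z p0 p1 p2 p3 Ta Tb Tc Td"
    and D: "D = disc Y * ((lR - v \<bullet> centre Y)\<^sup>2 - (lL - v \<bullet> centre Y)\<^sup>2)"
    and lim: "(f0 \<longlongrightarrow> v \<bullet> Y p0) (at_right (0::real))" "(f1 \<longlongrightarrow> v \<bullet> Y p1) (at_right 0)"
      "(f2 \<longlongrightarrow> v \<bullet> Y p2) (at_right 0)" "(f3 \<longlongrightarrow> v \<bullet> Y p3) (at_right 0)"
    and fam: "\<And>s. 0 < s \<Longrightarrow> v \<bullet> Y p1 < f1 s \<and> f3 s < v \<bullet> Y p3 \<and> 0 \<le> f2 s \<and> f0 s \<le> 0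
      \<and> (f2 s)\<^sup>2 = (f1 s)\<^sup>2 + D \<and> (f3 s)\<^sup>2 = (f0 s)\<^sup>2 + D
      \<and> (exc v lL X p0 Td \<longrightarrow> f0 s + f1 s = v \<bullet> Y p0 + v \<bullet> Y p1)
      \<and> (exc (- v) (- lR) Z p2 Tb \<longrightarrow> f2 s + f3 s = v \<bullet> Y p2 + v \<bullet> Y p3)"
    and admX: "\<And>A. \<forall>r\<in>A. v \<bullet> r \<le> lL \<Longrightarrow> adm X A"
    and admY: "\<And>A. \<forall>r\<in>A. lL \<le> v \<bullet> r \<and> v \<bullet> r \<le> lR \<Longrightarrow> adm Y A"
    and admZ: "\<And>A. \<forall>r\<in>A. lR \<le> v \<bullet> r \<Longrightarrow> adm Z A"
  shows "\<not> isolated_loop adm ((orbit Y p1 Ta \<union> orbit Z p2 Tb) \<union> (orbit Y p3 Tc \<union> orbit X p0 Td))"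
proof
  define \<Gamma> where "\<Gamma> = (orbit Y p1 Ta \<union> orbit Z p2 Tb) \<union> (orbit Y p3 Tc \<union> orbit X p0 Td)"
  assume "isolated_loop adm ((orbit Y p1 Ta \<union> orbit Z p2 Tb) \<union> (orbit Y p3 Tc \<union> orbit X p0 Td))"
  then have "isolated_loop adm \<Gamma>" by (simp only: \<Gamma>_def)
  then obtain U where U0: "open U" "\<Gamma> \<subseteq> U" "\<And>\<Gamma>'. loop adm \<Gamma>' \<Longrightarrow> \<Gamma>' \<subseteq> U \<Longrightarrow> \<Gamma>' = \<Gamma>"
    unfolding isolated_loop_def by blast
  then have U: "open U" "orbit Y p1 Ta \<subseteq> U" "orbit Z p2 Tb \<subseteq> U" "orbit Y p3 Tc \<subseteq> U" "orbit X p0 Td \<subseteq> U"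
    by (simp_all only: Un_subset_iff \<Gamma>_def)
  have c1: "cross v lL lR Y p1 Ta" "flow Y Ta p1 = p2" and k2: "link (- v) (- lR) Z p2 Tb" "flow Z Tb p2 = p3"
    and c3: "cross (- v) (- lR) (- lL) Y p3 Tc" "flow Y Tc p3 = p0" and k0: "link v lL X p0 Td" "flow X Td p0 = p1"
    using cyc unfolding three_zone_cycle_def by blast+
  have lr': "- lR < - lL" and v': "- v \<noteq> 0" using lr v by simp_all
  define L R where "L = level_point v Y lL" and "R = level_point v Y lR"
  note LL = level_point[OF Y v ndY, of lL, folded L_def] and RR = level_point[OF Y v ndY, of lR, folded R_def]
  have on: "v \<bullet> p0 = lL" "v \<bullet> p1 = lL" "v \<bullet> p2 = lR" "v \<bullet> p3 = lR"
    using c1 c3 unfolding cross_def by auto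
  have vel: "0 \<le> v \<bullet> Y p1" "0 \<le> v \<bullet> Y p2" "v \<bullet> Y p3 \<le> 0" "v \<bullet> Y p0 \<le> 0"
    using cross_velocity(2,3)[OF Y lr c1(1)] cross_velocity(2,3)[OF Y lr' c3(1)] c1 c3 by simp_all
  have pt: "L (v \<bullet> Y p0) = p0" "L (v \<bullet> Y p1) = p1" "R (v \<bullet> Y p2) = p2" "R (v \<bullet> Y p3) = p3"
    using level_point_unique[OF Y v ndY] on unfolding L_def R_def by metis+
  have l0: "((\<lambda>s. L (f0 s)) \<longlongrightarrow> p0) (at_right 0)" and l1: "((\<lambda>s. L (f1 s)) \<longlongrightarrow> p1) (at_right 0)"
    using level_point_tendsto[OF lim(1), of v Y lL] level_point_tendsto[OF lim(2), of v Y lL] pt unfolding L_def by simp_all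
  have l2: "((\<lambda>s. R (f2 s)) \<longlongrightarrow> p2) (at_right 0)" and l3: "((\<lambda>s. R (f3 s)) \<longlongrightarrow> p3) (at_right 0)"
    using level_point_tendsto[OF lim(3), of v Y lR] level_point_tendsto[OF lim(4), of v Y lR] pt unfolding R_def by simp_all
  have l01: "filterlim (\<lambda>s. (L (f0 s), L (f1 s))) (nhds p0 \<times>\<^sub>F nhds (flow X Td p0)) (at_right 0)"
    unfolding k0(2) using l0 l1 by (rule filterlim_Pair)
  have l23: "filterlim (\<lambda>s. (R (f2 s), R (f3 s))) (nhds p2 \<times>\<^sub>F nhds (flow Z Tb p2)) (at_right 0)"
    unfolding k2(2) using l2 l3 by (rule filterlim_Pair)
  have inU: "\<forall>t\<in>{0..Ta}. flow Y t p1 \<in> U" "\<forall>t\<in>{0..Tb}. flow Z t p2 \<in> U" "\<forall>t\<in>{0..Tc}. flow Y t p3 \<in> U"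
    "\<forall>t\<in>{0..Td}. flow X t p0 \<in> U"
    using U(2-5) unfolding orbit_def by (simp_all only: image_subset_iff)
  note ev1 = eventually_compose_filterlim[OF cross_perturb_outward[OF Y lr c1(1) U(1) inU(1)] l1]
  note ev2 = eventually_compose_filterlim[OF link_perturb[OF Z v' k2(1) U(1) inU(2)] l23]
  note ev3 = eventually_compose_filterlim[OF cross_perturb_outward[OF Y lr' c3(1) U(1) inU(3)] l3]
  note ev0 = eventually_compose_filterlim[OF link_perturb[OF X v k0(1) U(1) inU(4)] l01]
  have "\<forall>\<^sub>F s in at_right (0::real). 0 < s" by (simp add: eventually_at_right_less)
  from eventually_happens'[OF trivial_limit_at_right_real eventually_conj[OF this eventually_conj[OF ev1 eventually_conj[OF ev2 eventually_conj[OF ev3 ev0]]]]]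
  obtain s where s: "0 < s"
    and e1: "v \<bullet> L (f1 s) = lL \<and> v \<bullet> Y p1 < v \<bullet> Y (L (f1 s)) \<longrightarrow>
       (\<exists>T'. cross v lL lR Y (L (f1 s)) T' \<and> (\<forall>t\<in>{0..T'}. flow Y t (L (f1 s)) \<in> U))"
    and e2: "- v \<bullet> R (f2 s) = - lR \<and> - v \<bullet> R (f3 s) = - lR \<longrightarrow>
      (exc (- v) (- lR) Z p2 Tb \<longrightarrow> R (f2 s) + R (f3 s) = p2 + flow Z Tb p2) \<longrightarrow>
      (\<exists>T'. (if exc (- v) (- lR) Z p2 Tb then exc (- v) (- lR) Z (R (f2 s)) T' else glide (- v) (- lR) Z (R (f2 s)) T')
       \<and> flow Z T' (R (f2 s)) = R (f3 s) \<and> (\<forall>t\<in>{0..T'}. flow Z t (R (f2 s)) \<in> U)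
       \<and> (\<forall>t\<in>{0<..T'}. flow Z t (R (f2 s)) \<noteq> R (f2 s)))"
    and e3: "- v \<bullet> R (f3 s) = - lR \<and> - v \<bullet> Y p3 < - v \<bullet> Y (R (f3 s)) \<longrightarrow>
       (\<exists>T'. cross (- v) (- lR) (- lL) Y (R (f3 s)) T' \<and> (\<forall>t\<in>{0..T'}. flow Y t (R (f3 s)) \<in> U))"
    and e0: "v \<bullet> L (f0 s) = lL \<and> v \<bullet> L (f1 s) = lL \<longrightarrow>
      (exc v lL X p0 Td \<longrightarrow> L (f0 s) + L (f1 s) = p0 + flow X Td p0) \<longrightarrow>
      (\<exists>T'. (if exc v lL X p0 Td then exc v lL X (L (f0 s)) T' else glide v lL X (L (f0 s)) T')
       \<and> flow X T' (L (f0 s)) = L (f1 s) \<and> (\<forall>t\<in>{0..T'}. flow X t (L (f0 s)) \<in> U)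
       \<and> (\<forall>t\<in>{0<..T'}. flow X t (L (f0 s)) \<noteq> L (f0 s)))"
    unfolding fst_conv snd_conv by blast
  note F = fam[OF s]
  define q0 q1 q2 q3 where "q0 = L (f0 s)" and "q1 = L (f1 s)" and "q2 = R (f2 s)" and "q3 = R (f3 s)"
  note qdef = q0_def q1_def q2_def q3_def
  have onq: "v \<bullet> q0 = lL" "v \<bullet> q1 = lL" "v \<bullet> q2 = lR" "v \<bullet> q3 = lR"
    and velq: "v \<bullet> Y q0 = f0 s" "v \<bullet> Y q1 = f1 s" "v \<bullet> Y q2 = f2 s" "v \<bullet> Y q3 = f3 s"
    using LL RR by (simp_all add: qdef)
  have sum0: "q0 + q1 = p0 + p1" if "exc v lL X p0 Td"
    by (rule line_points_sum[OF Y ndY]) (use onq on velq F that in simp_all)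
  have sum2: "q2 + q3 = p2 + p3" if "exc (- v) (- lR) Z p2 Tb"
    by (rule line_points_sum[OF Y ndY]) (use onq on velq F that in simp_all)
  obtain Ta' where a: "cross v lL lR Y q1 Ta'" "\<forall>t\<in>{0..Ta'}. flow Y t q1 \<in> U"
    using e1 onq velq F unfolding qdef by auto
  obtain Tb' where b: "if exc (- v) (- lR) Z p2 Tb then exc (- v) (- lR) Z q2 Tb' else glide (- v) (- lR) Z q2 Tb'"
    "flow Z Tb' q2 = q3" "\<forall>t\<in>{0..Tb'}. flow Z t q2 \<in> U" "\<forall>t\<in>{0<..Tb'}. flow Z t q2 \<noteq> q2"
    using e2[folded qdef] onq sum2 k2(2) by auto
  obtain Tc' where c: "cross (- v) (- lR) (- lL) Y q3 Tc'" "\<forall>t\<in>{0..Tc'}. flow Y t q3 \<in> U"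
    using e3[folded qdef] onq velq F by auto
  obtain Td' where d: "if exc v lL X p0 Td then exc v lL X q0 Td' else glide v lL X q0 Td'"
    "flow X Td' q0 = q1" "\<forall>t\<in>{0..Td'}. flow X t q0 \<in> U" "\<forall>t\<in>{0<..Td'}. flow X t q0 \<noteq> q0"
    using e0[folded qdef] onq sum0 k0(2) by auto
  have pos: "0 < Ta'" "0 < Tb'" "0 < Tc'" "0 < Td'"
    using a(1) b(1) c(1) d(1) unfolding cross_def exc_def glide_def by (auto split: if_splits)
  have endA: "flow Y Ta' q1 = q2"
  proof (rule nondegD[OF ndY])
    show "v \<bullet> flow Y Ta' q1 = v \<bullet> q2" using a(1) onq unfolding cross_def by simp
    have "(v \<bullet> Y (flow Y Ta' q1))\<^sup>2 = (f2 s)\<^sup>2"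
      using cross_end_velocity[OF Y a(1)] velq F unfolding D by simp
    then show "v \<bullet> Y (flow Y Ta' q1) = v \<bullet> Y q2"
      using cross_velocity(3)[OF Y lr a(1)] F velq by (metis power2_eq_imp_eq)
  qed
  have endC: "flow Y Tc' q3 = q0"
  proof (rule nondegD[OF ndY])
    show "v \<bullet> flow Y Tc' q3 = v \<bullet> q0" using c(1) onq unfolding cross_def by simp
    have "(v \<bullet> Y (flow Y Tc' q3))\<^sup>2 = (f3 s)\<^sup>2 - D"
      using cross_end_velocity[OF Y c(1)] velq power2_commute[of "v \<bullet> centre Y" lL] power2_commute[of "v \<bullet> centre Y" lR]
      unfolding D by (simp add: right_diff_distrib)
    then have "(- (v \<bullet> Y (flow Y Tc' q3)))\<^sup>2 = (- f0 s)\<^sup>2" using F by simp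
    then have "- (v \<bullet> Y (flow Y Tc' q3)) = - f0 s"
      by (rule power2_eq_imp_eq) (use cross_velocity(3)[OF Y lr' c(1)] F in simp_all)
    then show "v \<bullet> Y (flow Y Tc' q3) = v \<bullet> Y q0" using velq by simp
  qed
  note regL = link_region(1)[OF d(1)]
  have regR: "lR \<le> v \<bullet> r" if "r \<in> orbit Z q2 Tb'" for r using link_region(1)[OF b(1) that] by simp
  have regA: "r = q1 \<or> r = q2 \<or> (lL < v \<bullet> r \<and> v \<bullet> r < lR \<and> 0 < v \<bullet> Y r \<and> energy v Y r = energy v Y q1)"
    if "r \<in> orbit Y q1 Ta'" for r
    using cross_region[OF Y lr a(1) that] endA by metis
  have regC: "r = q3 \<or> r = q0 \<or> (lL < v \<bullet> r \<and> v \<bullet> r < lR \<and> v \<bullet> Y r < 0)"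
    if "r \<in> orbit Y q3 Tc'" for r
    using cross_region[OF Y lr' c(1) that] endC by (cases rule: cross_region[OF Y lr' c(1) that]) auto
  have arcA: "tarc adm (orbit Y q1 Ta') q1 q2"
    unfolding endA[symmetric]
  proof (rule flow_tarc[OF Y pos(1)])
    show "\<forall>t\<in>{0<..Ta'}. flow Y t q1 \<noteq> q1" using cross_no_return[OF lr a(1)] by blast
    fix A assume "A \<subseteq> orbit Y q1 Ta'"
    then have "\<forall>r\<in>A. lL \<le> v \<bullet> r \<and> v \<bullet> r \<le> lR" using regA onq lr by (metis less_imp_le order_refl subsetD)
    then show "adm Y A" by (rule admY)
  qed
  have arcC: "tarc adm (orbit Y q3 Tc') q3 q0"
    unfolding endC[symmetric]
  proof (rule flow_tarc[OF Y pos(3)])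
    show "\<forall>t\<in>{0<..Tc'}. flow Y t q3 \<noteq> q3" using cross_no_return[OF lr' c(1)] by blast
    fix A assume "A \<subseteq> orbit Y q3 Tc'"
    then have "\<forall>r\<in>A. lL \<le> v \<bullet> r \<and> v \<bullet> r \<le> lR" using regC onq lr by (metis less_imp_le order_refl subsetD)
    then show "adm Y A" by (rule admY)
  qed
  have arcB: "tarc adm (orbit Z q2 Tb') q2 q3"
    unfolding b(2)[symmetric]
  proof (rule flow_tarc[OF Z pos(2) b(4)])
    fix A assume "A \<subseteq> orbit Z q2 Tb'"
    then have "\<forall>r\<in>A. lR \<le> v \<bullet> r" using regR by blast
    then show "adm Z A" by (rule admZ)
  qed
  have arcD: "tarc adm (orbit X q0 Td') q0 q1"
    unfolding d(2)[symmetric]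
  proof (rule flow_tarc[OF X pos(4) d(4)])
    fix A assume "A \<subseteq> orbit X q0 Td'"
    then have "\<forall>r\<in>A. v \<bullet> r \<le> lL" using regL by blast
    then show "adm X A" by (rule admX)
  qed
  have AB: "r = q2" if "r \<in> orbit Y q1 Ta'" "r \<in> orbit Z q2 Tb'" for r
    using regA[OF that(1)] regR[OF that(2)] onq lr by auto
  have CD: "r = q0" if "r \<in> orbit Y q3 Tc'" "r \<in> orbit X q0 Td'" for r
    using regC[OF that(1)] regL[OF that(2)] onq lr by auto
  have AD: "r = q1" if "r \<in> orbit Y q1 Ta'" "r \<in> orbit X q0 Td'" for r
    using regA[OF that(1)] regL[OF that(2)] onq lr by auto
  have BC: "r = q3" if "r \<in> orbit Z q2 Tb'" "r \<in> orbit Y q3 Tc'" for r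
    using regC[OF that(2)] regR[OF that(1)] onq lr by auto
  have BD: False if "r \<in> orbit Z q2 Tb'" "r \<in> orbit X q0 Td'" for r
    using regR[OF that(1)] regL[OF that(2)] lr by auto
  have AC: "r = q1 \<or> r = q3" if "r \<in> orbit Y q1 Ta'" "r \<in> orbit Y q3 Tc'" for r
    using regA[OF that(1)] regC[OF that(2)] onq lr by auto
  have "tarc adm (orbit Y q1 Ta' \<union> orbit Z q2 Tb') q1 q3"
    by (rule tarc_join[OF arcA arcB]) (use AB in blast)
  moreover have "tarc adm (orbit Y q3 Tc' \<union> orbit X q0 Td') q3 q1"
    by (rule tarc_join[OF arcC arcD]) (use CD in blast)
  ultimately have "loop adm ((orbit Y q1 Ta' \<union> orbit Z q2 Tb') \<union> (orbit Y q3 Tc' \<union> orbit X q0 Td'))"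
    by (rule tarc_close) (use AD BC BD AC in blast)
  moreover have "(orbit Y q1 Ta' \<union> orbit Z q2 Tb') \<union> (orbit Y q3 Tc' \<union> orbit X q0 Td') \<subseteq> U"
    using a(2) b(3) c(2) d(3) unfolding orbit_def by auto
  ultimately have same: "(orbit Y q1 Ta' \<union> orbit Z q2 Tb') \<union> (orbit Y q3 Tc' \<union> orbit X q0 Td')
      = \<Gamma>"
    by (rule U0(3))
  \<comment> \<open>on the middle line of the strip the new upper arc is faster than the old one\<close>
  define \<mu> where "\<mu> = (lL + lR) / 2"
  have mu: "lL < \<mu>" "\<mu> < lR" using lr by (simp_all add: \<mu>_def)
  have "v \<bullet> flow Y 0 q1 \<le> \<mu>" "\<mu> \<le> v \<bullet> flow Y Ta' q1" "0 \<le> Ta'" using onq endA mu pos by simp_all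
  then obtain t where t: "0 \<le> t" "t \<le> Ta'" "v \<bullet> flow Y t q1 = \<mu>" using flow_pos_ivt[OF Y] by blast
  define r where "r = flow Y t q1"
  have rA: "r \<in> orbit Y q1 Ta'" using t unfolding orbit_def r_def by auto
  have r: "v \<bullet> r = \<mu>" "0 < v \<bullet> Y r" "energy v Y r = energy v Y q1"
    using t(3) regA[OF rA] onq mu by (auto simp: r_def)
  have "(v \<bullet> Y p1)\<^sup>2 < (v \<bullet> Y q1)\<^sup>2" using F vel velq by (intro power_strict_mono) auto
  then have less: "energy v Y p1 < energy v Y q1" unfolding energy_def using on onq by simp
  have "r \<in> \<Gamma>" unfolding same[symmetric] using rA by simp
  then consider "r \<in> orbit Y p1 Ta" | "r \<in> orbit Z p2 Tb" | "r \<in> orbit Y p3 Tc" | "r \<in> orbit X p0 Td"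
    unfolding \<Gamma>_def by (elim UnE)
  then show False
  proof cases
    case 1
    then show ?thesis
      by (cases rule: cross_region[OF Y lr c1(1)]) (use r on mu c1(2) less in auto)
  next
    case 2
    then have "- v \<bullet> r \<le> - lR" using link_end(5)[OF Z k2(1)] unfolding orbit_def by blast
    then show ?thesis using r mu by simp
  next
    case 3
    then show ?thesis
      by (cases rule: cross_region[OF Y lr' c3(1)]) (use r on mu c3(2) in auto)
  next
    case 4
    then have "v \<bullet> r \<le> lL" using link_end(5)[OF X k0(1)] unfolding orbit_def by blast
    then show ?thesis using r mu by simp
  qed
qed

section \<open>Periodic curves that follow three fields\<close>

text \<open>
  The first of velocity and acceleration across the line that does not vanish decides on which
  side the orbit proceeds. If both vanish, the orbit stays on the line.
\<close>

lemma flow_trichotomy: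
  assumes X: "hfield X"
  obtains e where "e > 0" "(\<forall>s\<in>{0<..<e}. v \<bullet> flow X s p < v \<bullet> p) \<or>
     (\<forall>s\<in>{0<..<e}. v \<bullet> flow X s p = v \<bullet> p) \<or> (\<forall>s\<in>{0<..<e}. v \<bullet> p < v \<bullet> flow X s p)"
proof -
  note dp = flow_pos_deriv[OF X, of v p _ UNIV] and dv = flow_vel_deriv[OF X, of v p _ UNIV]
  define z a where "z = v \<bullet> X p" and "a = disc X * (v \<bullet> p - v \<bullet> centre X)"
  have p0: "((\<lambda>t. v \<bullet> flow X t p) has_real_derivative z) (at 0)" using dp[of 0] by (simp add: z_def)
  have v0: "((\<lambda>t. v \<bullet> X (flow X t p)) has_real_derivative a) (at 0)" using dv[of 0] by (simp add: a_def)
  note cp = flow_pos_continuous[OF X, of _ v p]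
  consider "z > 0" | "z < 0" | "z = 0" "a > 0" | "z = 0" "a < 0" | "z = 0" "a = 0" by linarith
  then show ?thesis
  proof cases
    case 1
    from DERIV_pos_inc_right[OF p0 1] obtain e where e: "e > 0" "\<And>h. 0 < h \<Longrightarrow> h < e \<Longrightarrow> v \<bullet> p < v \<bullet> flow X h p" by auto
    then show ?thesis by (intro that[OF e(1)]) simp
  next
    case 2
    from DERIV_neg_dec_right[OF p0 2] obtain e where e: "e > 0" "\<And>h. 0 < h \<Longrightarrow> h < e \<Longrightarrow> v \<bullet> flow X h p < v \<bullet> p" by auto
    then show ?thesis by (intro that[OF e(1)]) simp
  next
    case 3
    from DERIV_pos_inc_right[OF v0 3(2)] obtain e where e: "e > 0" "\<And>h. 0 < h \<Longrightarrow> h < e \<Longrightarrow> 0 < v \<bullet> X (flow X h p)"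
      using 3(1) unfolding z_def by auto
    have "v \<bullet> flow X 0 p < v \<bullet> flow X s p" if "0 < s" "s < e" for s
      by (rule DERIV_pos_imp_increasing_open[OF that(1) _ cp]) (use dp e(2) that in force)
    then show ?thesis by (intro that[OF e(1)]) simp
  next
    case 4
    from DERIV_neg_dec_right[OF v0 4(2)] obtain e where e: "e > 0" "\<And>h. 0 < h \<Longrightarrow> h < e \<Longrightarrow> v \<bullet> X (flow X h p) < 0"
      using 4(1) unfolding z_def by auto
    have "v \<bullet> flow X s p < v \<bullet> flow X 0 p" if "0 < s" "s < e" for s
      by (rule DERIV_neg_imp_decreasing_open[OF that(1) _ cp]) (use dp e(2) that in force)
    then show ?thesis by (intro that[OF e(1)]) simp
  next
    case 5
    then have "v \<bullet> p = v \<bullet> centre X" using hfield_disc[OF X] by (simp add: a_def)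
    then have "v \<bullet> flow X s p = v \<bullet> p" for s using flow_pos[of v X s p] 5(1) by (simp add: z_def)
    then show ?thesis by (intro that[of 1]) simp_all
  qed
qed

text \<open>
  A curve that locally follows the flow is a solution of the differential equation.
\<close>

lemma flow_on_interval:
  assumes X: "hfield X" and cont: "continuous_on {s..e} g"
    and loc: "\<And>t. s < t \<Longrightarrow> t < e \<Longrightarrow> \<exists>d>0. \<forall>h\<in>{0..d}. g (t + h) = flow X h (g t) \<and> g (t - h) = flow X (- h) (g t)"
    and t: "t \<in> {s..e}"
  shows "g t = flow X (t - s) (g s)"
proof (rule solution_is_flow[OF X cont _ t])
  fix t assume t: "s < t" "t < e"
  then obtain d where d: "d > 0" "\<And>h. h \<in> {0..d} \<Longrightarrow> g (t + h) = flow X h (g t) \<and> g (t - h) = flow X (- h) (g t)"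
    using loc by blast
  have eq: "flow X (u - t) (g t) = g u" if "u \<in> {t - d<..<t + d}" for u
  proof (cases "t \<le> u")
    case True
    then show ?thesis using d(2)[of "u - t"] that by simp
  next
    case False
    then show ?thesis using d(2)[of "t - u"] that by simp
  qed
  have "((\<lambda>u. u - t) has_vector_derivative 1) (at t)"
    by (auto intro!: derivative_eq_intros)
  from vector_diff_chain_at[OF this flow_deriv[OF X, of "g t"]]
  have "((\<lambda>u. flow X (u - t) (g t)) has_vector_derivative X (flow X 0 (g t))) (at t)" by (simp add: o_def)
  then have D: "((\<lambda>u. flow X (u - t) (g t)) has_vector_derivative X (g t)) (at t)" by simp
  show "(g has_vector_derivative X (g t)) (at t)"
    by (rule has_vector_derivative_transform_within_open[OF D, where S = "{t - d<..<t + d}"])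
       (use d(1) eq in auto)
qed

lemma gap_around:
  fixes C :: "real set" and P :: real
  assumes C: "closed C" and c: "c \<in> C" and per: "\<And>t k. t \<in> C \<Longrightarrow> t + of_int k * P \<in> C" and P: "0 < P"
    and r: "r \<notin> C"
  obtains s e where "s < r" "r < e" "s \<in> C" "e \<in> C" "\<And>t. s < t \<Longrightarrow> t < e \<Longrightarrow> t \<notin> C" "e \<le> s + P"
proof -
  define k where "k = \<lfloor>(r - c) / P\<rfloor>"
  have "of_int k * P \<le> r - c" "r - c < (of_int k + 1) * P"
    using floor_divide_lower[OF P, of "r - c"] floor_divide_upper[OF P, of "r - c"] by (simp_all add: k_def)
  then have lo: "c + of_int k * P \<le> r" and hi: "r \<le> c + of_int (k + 1) * P" by (simp_all add: algebra_simps)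
  have cl: "c + of_int k * P \<in> C" "c + of_int (k + 1) * P \<in> C" using per[OF c] by blast+
  have "compact (C \<inter> {c + of_int k * P..r})" using C by (simp add: closed_Int_compact)
  moreover have "C \<inter> {c + of_int k * P..r} \<noteq> {}" using lo cl by auto
  ultimately obtain s where s: "s \<in> C \<inter> {c + of_int k * P..r}" "\<And>u. u \<in> C \<inter> {c + of_int k * P..r} \<Longrightarrow> u \<le> s"
    by (meson compact_attains_sup)
  have "compact (C \<inter> {r..c + of_int (k + 1) * P})" using C by (simp add: closed_Int_compact)
  moreover have "C \<inter> {r..c + of_int (k + 1) * P} \<noteq> {}" using hi cl by auto
  ultimately obtain e where e: "e \<in> C \<inter> {r..c + of_int (k + 1) * P}" "\<And>u. u \<in> C \<inter> {r..c + of_int (k + 1) * P} \<Longrightarrow> e \<le> u"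
    by (meson compact_attains_inf)
  have no: "t \<notin> C" if "s < t" "t < e" for t
  proof
    assume "t \<in> C"
    show False
    proof (cases "t \<le> r")
      case True
      then have "t \<in> C \<inter> {c + of_int k * P..r}" using \<open>t \<in> C\<close> s(1) that by auto
      from s(2)[OF this] that show False by simp
    next
      case False
      then have "t \<in> C \<inter> {r..c + of_int (k + 1) * P}" using \<open>t \<in> C\<close> e(1) that by auto
      from e(2)[OF this] that show False by simp
    qed
  qed
  have sr: "s < r" "r < e" using s(1) e(1) r by (auto simp: order.strict_iff_order)
  have "s + of_int 1 * P \<in> C" using per s(1) by blast
  then have "e \<le> s + P" using no[of "s + P"] P by force
  with that sr s(1) e(1) no show ?thesis by blast
qed

text \<open>
  After (\<open>\<sigma> = 1\<close>) or before (\<open>\<sigma> = - 1\<close>) the time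
  \<open>t\<close>, the curve follows for a while one of the three fields inside its closed zone.
  At a junction of two arcs the germs of the two directions may belong to different fields.
\<close>

definition germ :: "plane \<Rightarrow> real \<Rightarrow> real \<Rightarrow> (plane \<Rightarrow> plane) \<Rightarrow> (plane \<Rightarrow> plane) \<Rightarrow> (plane \<Rightarrow> plane)
    \<Rightarrow> (real \<Rightarrow> plane) \<Rightarrow> real \<Rightarrow> real \<Rightarrow> bool" where
  "germ v lL lR XL XC XR g \<sigma> t \<longleftrightarrow> (\<exists>d>0.
     (\<forall>h\<in>{0..d}. g (t + \<sigma> * h) = flow XL (\<sigma> * h) (g t) \<and> v \<bullet> g (t + \<sigma> * h) \<le> lL) \<or>
     (\<forall>h\<in>{0..d}. g (t + \<sigma> * h) = flow XC (\<sigma> * h) (g t) \<and> lL \<le> v \<bullet> g (t + \<sigma> * h) \<and> v \<bullet> g (t + \<sigma> * h) \<le> lR) \<or>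
     (\<forall>h\<in>{0..d}. g (t + \<sigma> * h) = flow XR (\<sigma> * h) (g t) \<and> lR \<le> v \<bullet> g (t + \<sigma> * h)))"

definition invariant_line :: "plane \<Rightarrow> real \<Rightarrow> (plane \<Rightarrow> plane) \<Rightarrow> bool" where
  "invariant_line v l X \<longleftrightarrow> v \<bullet> centre X = l \<and> (\<forall>r. v \<bullet> r = l \<longrightarrow> v \<bullet> X r = 0)"

lemma invariant_line_flow:
  assumes "invariant_line v l X" "v \<bullet> p = l"
  shows "v \<bullet> flow X t p = l"
  using flow_pos[of v X t p] assms unfolding invariant_line_def by simp

lemma invariant_line_degenerate:
  assumes X: "hfield X" and v: "v \<noteq> 0" and i: "invariant_line v l X"
  shows "\<not> nondeg v X"
proof
  assume nd: "nondeg v X"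
  have "centre X = centre X + perp v"
  proof (rule nondegD[OF nd])
    have "v \<bullet> (centre X + perp v) = l" using i by (simp add: invariant_line_def inner_add_right)
    then have "v \<bullet> X (centre X + perp v) = 0" using i unfolding invariant_line_def by blast
    then show "v \<bullet> X (centre X) = v \<bullet> X (centre X + perp v)" using hfield_zero[OF X] by simp
  qed (simp add: inner_add_right)
  then have "perp v = 0" by (metis add_cancel_right_right)
  then show False using v by simp
qed

lemma glide_invariant:
  assumes X: "hfield X" and v: "v \<noteq> 0" and g: "glide v l X p T" and ne: "flow X T p \<noteq> p"
  shows "invariant_line v l X"
  by (rule glide_exp[OF X v g ne]) (simp add: invariant_line_def)

text \<open>
  A maximal time interval during which the curve stays in the half plane
  \<open>v \<bullet> p \<le> l\<close>. It may be a single point, at which the curve touches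
  the line from the other side.
\<close>

definition is_link :: "plane \<Rightarrow> real \<Rightarrow> (real \<Rightarrow> plane) \<Rightarrow> real \<Rightarrow> real \<Rightarrow> bool" where
  "is_link v l g s e \<longleftrightarrow> s \<le> e \<and> (\<forall>r\<in>{s..e}. v \<bullet> g r \<le> l)
     \<and> (\<exists>d>0. \<forall>r\<in>{e<..<e + d}. l < v \<bullet> g r) \<and> (\<exists>d>0. \<forall>r\<in>{s - d<..<s}. l < v \<bullet> g r)"

text \<open>
  A simple closed curve with period \<open>T\<close>, described by germs instead of a partition
  into arcs: this makes the hypotheses invariant under the exchange of the two half planes and
  under time reversal.
\<close>

locale cycle =
  fixes v :: plane and lL lR :: real and XL XC XR :: "plane \<Rightarrow> plane" and g :: "real \<Rightarrow> plane" and T :: real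
  assumes v: "v \<noteq> 0" and lr: "lL < lR" and hL: "hfield XL" and hC: "hfield XC" and hR: "hfield XR"
    and T: "0 < T" and cont: "continuous_on UNIV g"
    and per: "\<And>t. g (t + T) = g t"
    and inj: "\<And>s t. g s = g t \<Longrightarrow> \<exists>k::int. t = s + of_int k * T"
    and rgerm: "\<And>t. germ v lL lR XL XC XR g 1 t"
    and lgerm: "\<And>t. germ v lL lR XL XC XR g (- 1) t"
begin

lemma mirror: "cycle (- v) (- lR) (- lL) XR XC XL g T"
proof -
  have germ: "germ (- v) (- lR) (- lL) XR XC XL g \<sigma> t" if "germ v lL lR XL XC XR g \<sigma> t" for \<sigma> t
    using that unfolding germ_def inner_minus_left neg_le_iff_le by meson
  show ?thesis
    by unfold_locales (use v lr hL hC hR T cont per inj germ rgerm lgerm in simp_all)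
qed

lemma reversal: "cycle v lL lR (\<lambda>p. - XL p) (\<lambda>p. - XC p) (\<lambda>p. - XR p) (\<lambda>t. g (- t)) T"
proof -
  have germ: "germ v lL lR (\<lambda>p. - XL p) (\<lambda>p. - XC p) (\<lambda>p. - XR p) (\<lambda>t. g (- t)) \<sigma> t"
    if "germ v lL lR XL XC XR g (- \<sigma>) (- t)" for \<sigma> t
    using that unfolding germ_def flow_minus by (simp add: algebra_simps)
  show ?thesis
  proof
    show "continuous_on UNIV (\<lambda>t. g (- t))"
      by (rule continuous_on_compose2[OF cont]) (auto intro: continuous_intros)
    show "g (- (t + T)) = g (- t)" for t using per[of "- t - T"] by simp
    show "\<exists>k::int. t = s + of_int k * T" if eq: "g (- s) = g (- t)" for s t
    proof -
      obtain k :: int where "- t = - s + of_int k * T" using inj[OF eq] by blast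
      then have "t = s + of_int (- k) * T" by simp
      then show ?thesis by blast
    qed
  qed (use v lr hL hC hR T germ rgerm lgerm in \<open>simp_all add: hfield_minus\<close>)
qed

lemma shift: "g (t + of_int k * T) = g t"
proof -
  have nat: "g (u + of_nat n * T) = g u" for u n
  proof (induction n)
    case (Suc n)
    have "g (u + of_nat (Suc n) * T) = g (u + of_nat n * T + T)" by (simp add: algebra_simps)
    then show ?case using per Suc by simp
  qed simp
  show ?thesis
  proof (cases "0 \<le> k")
    case True
    then show ?thesis using nat[of t "nat k"] by simp
  next
    case False
    then show ?thesis using nat[of "t + of_int k * T" "nat (- k)"] by simp
  qed
qed

lemma g_neq: "s < t \<Longrightarrow> t < s + T \<Longrightarrow> g s \<noteq> g t"
proof
  assume st: "s < t" "t < s + T" and "g s = g t"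
  then obtain k :: int where k: "t = s + of_int k * T" using inj by blast
  then have "0 < of_int k * T" "of_int k * T < 1 * T" using st by simp_all
  then have "0 < k" "(of_int k :: real) < 1" using T by (simp_all only: zero_less_mult_iff mult_less_cancel_right) auto
  then show False by simp
qed

lemma xcont: "continuous_on S (\<lambda>t. v \<bullet> g t)"
  by (intro continuous_intros continuous_on_subset[OF cont]) simp

lemma x_tendsto: "((\<lambda>t. v \<bullet> g t) \<longlongrightarrow> v \<bullet> g t) (nhds t)"
proof -
  have "isCont (\<lambda>t. v \<bullet> g t) t" using xcont[of UNIV] continuous_on_eq_continuous_at[OF open_UNIV] by blast
  then show ?thesis unfolding isCont_def tendsto_at_iff_tendsto_nhds[of "\<lambda>t. v \<bullet> g t"] .
qed

lemma x_less_nhd: "v \<bullet> g t < c \<Longrightarrow> \<exists>d>0. \<forall>r\<in>{t - d<..<t + d}. v \<bullet> g r < c"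
  and x_greater_nhd: "c < v \<bullet> g t \<Longrightarrow> \<exists>d>0. \<forall>r\<in>{t - d<..<t + d}. c < v \<bullet> g r"
proof -
  have *: "\<exists>d>0. \<forall>r\<in>{t - d<..<t + d}. P r" if ev: "\<forall>\<^sub>F r in nhds t. P r" for P
  proof -
    obtain d where d: "d > 0" "\<And>r. dist r t < d \<Longrightarrow> P r" using ev unfolding eventually_nhds_metric by blast
    have "P r" if "r \<in> {t - d<..<t + d}" for r
      by (rule d(2)) (use that in \<open>simp add: dist_real_def abs_less_iff\<close>)
    then show ?thesis using d(1) by blast
  qed
  show "v \<bullet> g t < c \<Longrightarrow> \<exists>d>0. \<forall>r\<in>{t - d<..<t + d}. v \<bullet> g r < c"
    by (rule *) (rule order_tendstoD(2)[OF x_tendsto])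
  show "c < v \<bullet> g t \<Longrightarrow> \<exists>d>0. \<forall>r\<in>{t - d<..<t + d}. c < v \<bullet> g r"
    by (rule *) (rule order_tendstoD(1)[OF x_tendsto])
qed

lemma germ_field:
  assumes "germ v lL lR XL XC XR g \<sigma> t"
  shows "\<exists>d X. 0 < d \<and> hfield X \<and> (\<forall>h. 0 \<le> h \<longrightarrow> h \<le> d \<longrightarrow> g (t + \<sigma> * h) = flow X (\<sigma> * h) (g t)) \<and>
    ((X = XL \<and> v \<bullet> g t \<le> lL) \<or> (X = XC \<and> lL \<le> v \<bullet> g t \<and> v \<bullet> g t \<le> lR) \<or> (X = XR \<and> lR \<le> v \<bullet> g t))"
proof -
  obtain d where d: "0 < d" and cs:
     "(\<forall>h\<in>{0..d}. g (t + \<sigma> * h) = flow XL (\<sigma> * h) (g t) \<and> v \<bullet> g (t + \<sigma> * h) \<le> lL) \<or>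
     (\<forall>h\<in>{0..d}. g (t + \<sigma> * h) = flow XC (\<sigma> * h) (g t) \<and> lL \<le> v \<bullet> g (t + \<sigma> * h) \<and> v \<bullet> g (t + \<sigma> * h) \<le> lR) \<or>
     (\<forall>h\<in>{0..d}. g (t + \<sigma> * h) = flow XR (\<sigma> * h) (g t) \<and> lR \<le> v \<bullet> g (t + \<sigma> * h))"
    using assms unfolding germ_def by blast
  have z: "0 \<in> {0..d}" "t + \<sigma> * 0 = t" using d by simp_all
  from cs show ?thesis
  proof (elim disjE)
    assume a: "\<forall>h\<in>{0..d}. g (t + \<sigma> * h) = flow XL (\<sigma> * h) (g t) \<and> v \<bullet> g (t + \<sigma> * h) \<le> lL"
    show ?thesis
      by (intro exI[of _ d] exI[of _ XL]) (use a bspec[OF a z(1)] hL d in simp)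
  next
    assume a: "\<forall>h\<in>{0..d}. g (t + \<sigma> * h) = flow XC (\<sigma> * h) (g t) \<and> lL \<le> v \<bullet> g (t + \<sigma> * h) \<and> v \<bullet> g (t + \<sigma> * h) \<le> lR"
    show ?thesis
      by (intro exI[of _ d] exI[of _ XC]) (use a bspec[OF a z(1)] hC d in simp)
  next
    assume a: "\<forall>h\<in>{0..d}. g (t + \<sigma> * h) = flow XR (\<sigma> * h) (g t) \<and> lR \<le> v \<bullet> g (t + \<sigma> * h)"
    show ?thesis
      by (intro exI[of _ d] exI[of _ XR]) (use a bspec[OF a z(1)] hR d in simp)
  qed
qed

lemma range_g: "range g = g ` {a..a + T}"
proof
  show "range g \<subseteq> g ` {a..a + T}"
  proof
    fix p assume "p \<in> range g"
    then obtain t where t: "p = g t" by blast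
    define k where "k = \<lfloor>(t - a) / T\<rfloor>"
    have "of_int k * T \<le> t - a" "t - a < (of_int k + 1) * T"
      using floor_divide_lower[OF T, of "t - a"] floor_divide_upper[OF T, of "t - a"] by (simp_all add: k_def)
    then have "t + of_int (- k) * T \<in> {a..a + T}" by (simp add: algebra_simps)
    moreover have "p = g (t + of_int (- k) * T)" unfolding t by (rule shift[symmetric])
    ultimately show "p \<in> g ` {a..a + T}" by blast
  qed
qed auto

lemma right_trichotomy:
  assumes x: "v \<bullet> g t = lL"
  obtains d where "d > 0" "(\<forall>r\<in>{t<..<t + d}. v \<bullet> g r < lL) \<or> (\<forall>r\<in>{t<..<t + d}. v \<bullet> g r = lL)
     \<or> (\<forall>r\<in>{t<..<t + d}. lL < v \<bullet> g r)"
proof -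
  obtain d X where d: "d > 0" and X: "hfield X"
    and eq: "\<And>h. 0 \<le> h \<Longrightarrow> h \<le> d \<Longrightarrow> g (t + 1 * h) = flow X (1 * h) (g t)"
    using germ_field[OF rgerm[of t]] by blast
  obtain e where e: "e > 0" "(\<forall>s\<in>{0<..<e}. v \<bullet> flow X s (g t) < lL) \<or>
     (\<forall>s\<in>{0<..<e}. v \<bullet> flow X s (g t) = lL) \<or> (\<forall>s\<in>{0<..<e}. lL < v \<bullet> flow X s (g t))"
    using flow_trichotomy[OF X, of v "g t"] unfolding x by blast
  have gr: "g r = flow X (r - t) (g t) \<and> r - t \<in> {0<..<e}" if "r \<in> {t<..<t + min d e}" for r
    using eq[of "r - t"] that by (simp add: min_def split: if_splits)
  show ?thesis
  proof (rule that[of "min d e"])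
    show "0 < min d e" using d e(1) by simp
    show "(\<forall>r\<in>{t<..<t + min d e}. v \<bullet> g r < lL) \<or> (\<forall>r\<in>{t<..<t + min d e}. v \<bullet> g r = lL)
      \<or> (\<forall>r\<in>{t<..<t + min d e}. lL < v \<bullet> g r)"
      using e(2)
    proof (elim disjE)
      assume "\<forall>s\<in>{0<..<e}. v \<bullet> flow X s (g t) < lL" then show ?thesis using gr by metis
    next
      assume "\<forall>s\<in>{0<..<e}. v \<bullet> flow X s (g t) = lL" then show ?thesis using gr by metis
    next
      assume "\<forall>s\<in>{0<..<e}. lL < v \<bullet> flow X s (g t)" then show ?thesis using gr by metis
    qed
  qed
qed

text \<open>
  A simple curve does not rest, so that a motion on the line is a proper glide.
\<close>

lemma equal_germ_invariant:
  assumes d: "0 < d" and x: "\<forall>r\<in>{t..<t + d}. v \<bullet> g r = lL"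
  shows "invariant_line v lL XL \<or> invariant_line v lL XC"
proof -
  have xt: "v \<bullet> g t = lL" using x d by simp
  obtain e X where e: "0 < e" and X: "hfield X"
    and eq: "\<And>h. 0 \<le> h \<Longrightarrow> h \<le> e \<Longrightarrow> g (t + 1 * h) = flow X (1 * h) (g t)"
    and cs: "(X = XL \<and> v \<bullet> g t \<le> lL) \<or> (X = XC \<and> lL \<le> v \<bullet> g t \<and> v \<bullet> g t \<le> lR) \<or> (X = XR \<and> lR \<le> v \<bullet> g t)"
    using germ_field[OF rgerm[of t]] by blast
  define h where "h = min (min (d / 2) e) (T / 2)"
  have h: "0 < h" "h < d" "h \<le> e" "h < T" using d e T by (auto simp: h_def)
  have "v \<bullet> flow X s (g t) = lL" if "s \<in> {0..h}" for s
    using eq[of s] bspec[OF x, of "t + s"] h that by simp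
  then have gl: "glide v lL X (g t) h" unfolding glide_def using h by simp
  have "flow X h (g t) \<noteq> g t" using eq[of h] g_neq[of t "t + h"] h by auto
  then have "invariant_line v lL X" using glide_invariant[OF X v gl] by blast
  then show ?thesis using cs xt lr by auto
qed

lemma local_flow_left:
  assumes "v \<bullet> g t < lL"
  shows "\<exists>d>0. \<forall>h\<in>{0..d}. g (t + h) = flow XL h (g t) \<and> g (t - h) = flow XL (- h) (g t)"
proof -
  have *: "\<exists>d>0. \<forall>h\<in>{0..d}. g (t + \<sigma> * h) = flow XL (\<sigma> * h) (g t)" if gm: "germ v lL lR XL XC XR g \<sigma> t" for \<sigma>
  proof -
    obtain d X where d: "0 < d" "\<And>h. 0 \<le> h \<Longrightarrow> h \<le> d \<Longrightarrow> g (t + \<sigma> * h) = flow X (\<sigma> * h) (g t)"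
      and cs: "(X = XL \<and> v \<bullet> g t \<le> lL) \<or> (X = XC \<and> lL \<le> v \<bullet> g t \<and> v \<bullet> g t \<le> lR) \<or> (X = XR \<and> lR \<le> v \<bullet> g t)"
      using germ_field[OF gm] by blast
    have "X = XL" using cs assms lr by auto
    then show ?thesis using d by auto
  qed
  obtain d1 where d1: "d1 > 0" "\<forall>h\<in>{0..d1}. g (t + h) = flow XL h (g t)" using *[OF rgerm] by auto
  obtain d2 where d2: "d2 > 0" "\<forall>h\<in>{0..d2}. g (t - h) = flow XL (- h) (g t)" using *[OF lgerm] by auto
  show ?thesis by (rule exI[of _ "min d1 d2"]) (use d1 d2 in simp)
qed

lemma local_flow_middle:
  assumes "lL < v \<bullet> g t" "v \<bullet> g t < lR"
  shows "\<exists>d>0. \<forall>h\<in>{0..d}. g (t + h) = flow XC h (g t) \<and> g (t - h) = flow XC (- h) (g t)"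
proof -
  have *: "\<exists>d>0. \<forall>h\<in>{0..d}. g (t + \<sigma> * h) = flow XC (\<sigma> * h) (g t)" if gm: "germ v lL lR XL XC XR g \<sigma> t" for \<sigma>
  proof -
    obtain d X where d: "0 < d" "\<And>h. 0 \<le> h \<Longrightarrow> h \<le> d \<Longrightarrow> g (t + \<sigma> * h) = flow X (\<sigma> * h) (g t)"
      and cs: "(X = XL \<and> v \<bullet> g t \<le> lL) \<or> (X = XC \<and> lL \<le> v \<bullet> g t \<and> v \<bullet> g t \<le> lR) \<or> (X = XR \<and> lR \<le> v \<bullet> g t)"
      using germ_field[OF gm] by blast
    have "X = XC" using cs assms lr by auto
    then show ?thesis using d by auto
  qed
  obtain d1 where d1: "d1 > 0" "\<forall>h\<in>{0..d1}. g (t + h) = flow XC h (g t)" using *[OF rgerm] by auto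
  obtain d2 where d2: "d2 > 0" "\<forall>h\<in>{0..d2}. g (t - h) = flow XC (- h) (g t)" using *[OF lgerm] by auto
  show ?thesis by (rule exI[of _ "min d1 d2"]) (use d1 d2 in simp)
qed

lemma flow_in_left:
  assumes "\<And>t. s < t \<Longrightarrow> t < e \<Longrightarrow> v \<bullet> g t < lL" "t \<in> {s..e}"
  shows "g t = flow XL (t - s) (g s)"
  by (rule flow_on_interval[OF hL _ _ assms(2)])
     (use assms(1) local_flow_left continuous_on_subset[OF cont] in auto)

lemma flow_in_middle:
  assumes "\<And>t. s < t \<Longrightarrow> t < e \<Longrightarrow> lL < v \<bullet> g t \<and> v \<bullet> g t < lR" "t \<in> {s..e}"
  shows "g t = flow XC (t - s) (g s)"
  by (rule flow_on_interval[OF hC _ _ assms(2)])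
     (use assms(1) local_flow_middle continuous_on_subset[OF cont] in auto)

end

section \<open>Gaps and links\<close>

definition walls :: "plane \<Rightarrow> real \<Rightarrow> real \<Rightarrow> (real \<Rightarrow> plane) \<Rightarrow> real set" where
  "walls v lL lR g = {t. v \<bullet> g t = lL \<or> v \<bullet> g t = lR}"

text \<open>
  A maximal time interval during which the curve runs in the open strip.
\<close>

definition strip_gap :: "plane \<Rightarrow> real \<Rightarrow> real \<Rightarrow> (real \<Rightarrow> plane) \<Rightarrow> real \<Rightarrow> real \<Rightarrow> bool" where
  "strip_gap v lL lR g a b \<longleftrightarrow> a < b \<and> a \<in> walls v lL lR g \<and> b \<in> walls v lL lR g
     \<and> (\<forall>t\<in>{a<..<b}. lL < v \<bullet> g t \<and> v \<bullet> g t < lR)"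

lemma walls_mirror [simp]: "walls (- v) (- lR) (- lL) g = walls v lL lR g"
  unfolding walls_def by auto

lemma strip_gap_mirror [simp]: "strip_gap (- v) (- lR) (- lL) g a b = strip_gap v lL lR g a b"
  unfolding strip_gap_def by auto

lemma is_linkI:
  assumes "s \<le> e" "\<And>r. r \<in> {s..e} \<Longrightarrow> v \<bullet> g r \<le> l"
    "0 < d" "\<And>r. r \<in> {e<..<e + d} \<Longrightarrow> l < v \<bullet> g r" "0 < c" "\<And>r. r \<in> {s - c<..<s} \<Longrightarrow> l < v \<bullet> g r"
  shows "is_link v l g s e"
  unfolding is_link_def using assms by blast

lemma is_link_unique:
  assumes 1: "is_link v l g s e" and 2: "is_link v l g s' e'" and t: "t \<in> {s..e}" "t \<in> {s'..e'}"
  shows "s = s'" "e = e'"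
proof -
  have e: False if k: "is_link v l g s e" "is_link v l g s' e'" and "t \<in> {s..e}" "t \<in> {s'..e'}" "e < e'" for s e s' e'
  proof -
    obtain d where d: "0 < d" "\<And>r. r \<in> {e<..<e + d} \<Longrightarrow> l < v \<bullet> g r" using k(1) unfolding is_link_def by blast
    define r where "r = min (e + d / 2) e'"
    have "r \<in> {e<..<e + d}" "r \<in> {s'..e'}" using d(1) that(3-5) by (auto simp: r_def min_def)
    then show False using d(2)[of r] k(2) unfolding is_link_def by force
  qed
  have s: False if k: "is_link v l g s e" "is_link v l g s' e'" and "t \<in> {s..e}" "t \<in> {s'..e'}" "s' < s" for s e s' e'
  proof -
    obtain d where d: "0 < d" "\<And>r. r \<in> {s - d<..<s} \<Longrightarrow> l < v \<bullet> g r" using k(1) unfolding is_link_def by blast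
    define r where "r = max (s - d / 2) s'"
    have "r \<in> {s - d<..<s}" "r \<in> {s'..e'}" using d(1) that(3-5) by (auto simp: r_def max_def)
    then show False using d(2)[of r] k(2) unfolding is_link_def by force
  qed
  show "s = s'" using s[OF 1 2 t] s[OF 2 1 t(2,1)] by (meson linorder_neqE)
  show "e = e'" using e[OF 1 2 t] e[OF 2 1 t(2,1)] by (meson linorder_neqE)
qed

context cycle
begin

abbreviation "Cgap \<equiv> strip_gap v lL lR g"
abbreviation "Llink \<equiv> is_link v lL g"
abbreviation "Rlink \<equiv> is_link (- v) (- lR) g"

lemma walls_shift: "t \<in> walls v lL lR g \<Longrightarrow> t + of_int k * T \<in> walls v lL lR g"
  unfolding walls_def using shift by simp

lemma closed_walls: "closed (walls v lL lR g)"
proof -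
  have "closed {t. v \<bullet> g t = lL}" "closed {t. v \<bullet> g t = lR}"
    using xcont[of UNIV] by (auto intro!: closed_Collect_eq continuous_intros)
  then show ?thesis unfolding walls_def by (simp add: Collect_disj_eq closed_Un)
qed

lemma x_ivt: "a \<le> b \<Longrightarrow> v \<bullet> g a \<le> c \<Longrightarrow> c \<le> v \<bullet> g b \<Longrightarrow> \<exists>u\<in>{a..b}. v \<bullet> g u = c"
  and x_ivt2: "a \<le> b \<Longrightarrow> v \<bullet> g b \<le> c \<Longrightarrow> c \<le> v \<bullet> g a \<Longrightarrow> \<exists>u\<in>{a..b}. v \<bullet> g u = c"
  using IVT'[of "\<lambda>t. v \<bullet> g t" a c b, OF _ _ _ xcont] IVT2'[of "\<lambda>t. v \<bullet> g t" b c a, OF _ _ _ xcont]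
  by force+

lemma x_between:
  assumes no: "\<And>u. u \<in> {min a b..max a b} \<Longrightarrow> v \<bullet> g u \<noteq> c"
  shows "v \<bullet> g a < c \<longleftrightarrow> v \<bullet> g b < c"
proof -
  have False if "v \<bullet> g a < c" "\<not> v \<bullet> g b < c" "a \<le> b" using x_ivt[of a b c] no that by force
  moreover have False if "v \<bullet> g a < c" "\<not> v \<bullet> g b < c" "b \<le> a" using x_ivt2[of b a c] no that by force
  moreover have False if "\<not> v \<bullet> g a < c" "v \<bullet> g b < c" "a \<le> b" using x_ivt2[of a b c] no that by force
  moreover have False if "\<not> v \<bullet> g a < c" "v \<bullet> g b < c" "b \<le> a" using x_ivt[of b a c] no that by force
  ultimately show ?thesis using linear[of a b] by blast
qed

lemma x_le_closure:
  assumes "s < e" "\<And>t. s < t \<Longrightarrow> t < e \<Longrightarrow> v \<bullet> g t \<le> c"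
  shows "v \<bullet> g s \<le> c" "v \<bullet> g e \<le> c"
proof -
  have "continuous_on {s..e} (\<lambda>t. - (v \<bullet> g t))" by (intro continuous_on_minus xcont)
  from continuous_ge_on_Ioo[OF this _ assms(1), of "- c"] assms
  have "u \<in> {s..e} \<Longrightarrow> - c \<le> - (v \<bullet> g u)" for u by simp
  from this[of s] this[of e] assms(1) show "v \<bullet> g s \<le> c" "v \<bullet> g e \<le> c" by simp_all
qed

lemma x_ge_closure:
  assumes "s < e" "\<And>t. s < t \<Longrightarrow> t < e \<Longrightarrow> c \<le> v \<bullet> g t"
  shows "c \<le> v \<bullet> g s" "c \<le> v \<bullet> g e"
proof -
  have "u \<in> {s..e} \<Longrightarrow> c \<le> v \<bullet> g u" for u
    using continuous_ge_on_Ioo[OF xcont[of "{s..e}"] _ assms(1), of c] assms by simp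
  from this[of s] this[of e] assms(1) show "c \<le> v \<bullet> g s" "c \<le> v \<bullet> g e" by simp_all
qed

lemma gap:
  assumes "w \<in> walls v lL lR g" "r \<notin> walls v lL lR g"
  obtains s e where "s < r" "r < e" "s \<in> walls v lL lR g" "e \<in> walls v lL lR g" "e \<le> s + T"
    "\<And>t. s < t \<Longrightarrow> t < e \<Longrightarrow> t \<notin> walls v lL lR g"
    "\<And>t. s < t \<Longrightarrow> t < e \<Longrightarrow> (v \<bullet> g t < lL \<longleftrightarrow> v \<bullet> g r < lL) \<and> (v \<bullet> g t < lR \<longleftrightarrow> v \<bullet> g r < lR)"
proof -
  obtain s e where se: "s < r" "r < e" "s \<in> walls v lL lR g" "e \<in> walls v lL lR g"
    "\<And>t. s < t \<Longrightarrow> t < e \<Longrightarrow> t \<notin> walls v lL lR g" "e \<le> s + T"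
    using gap_around[OF closed_walls assms(1) walls_shift T assms(2)] by metis
  have "(v \<bullet> g t < lL \<longleftrightarrow> v \<bullet> g r < lL) \<and> (v \<bullet> g t < lR \<longleftrightarrow> v \<bullet> g r < lR)" if t: "s < t" "t < e" for t
  proof -
    have "u \<notin> walls v lL lR g" if "u \<in> {min t r..max t r}" for u
      by (rule se(5)) (use that t se(1,2) in \<open>auto simp: min_def max_def split: if_splits\<close>)
    then have "v \<bullet> g u \<noteq> lL" "v \<bullet> g u \<noteq> lR" if "u \<in> {min t r..max t r}" for u
      using that unfolding walls_def by blast+
    then show ?thesis using x_between[of t r lL] x_between[of t r lR] by blast
  qed
  with se that show ?thesis by blast
qed

lemma left_gap:
  assumes r: "v \<bullet> g r < lL" and w: "v \<bullet> g w = lL"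
  obtains s e where "s < r" "r < e" "e \<le> s + T" "v \<bullet> g s = lL" "v \<bullet> g e = lL"
    "\<And>t. s < t \<Longrightarrow> t < e \<Longrightarrow> v \<bullet> g t < lL" "exc v lL XL (g s) (e - s)" "flow XL (e - s) (g s) = g e"
proof -
  have "w \<in> walls v lL lR g" "r \<notin> walls v lL lR g" using r w lr by (auto simp: walls_def)
  then obtain s e where se: "s < r" "r < e" "s \<in> walls v lL lR g" "e \<in> walls v lL lR g" "e \<le> s + T"
    and "\<And>t. s < t \<Longrightarrow> t < e \<Longrightarrow> t \<notin> walls v lL lR g"
    and z: "\<And>t. s < t \<Longrightarrow> t < e \<Longrightarrow> (v \<bullet> g t < lL \<longleftrightarrow> v \<bullet> g r < lL) \<and> (v \<bullet> g t < lR \<longleftrightarrow> v \<bullet> g r < lR)"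
    by (rule gap) (rule that)
  have lt: "v \<bullet> g t < lL" if "s < t" "t < e" for t using z[OF that] r by blast
  have "v \<bullet> g s \<le> lL" "v \<bullet> g e \<le> lL" using x_le_closure[of s e lL] se(1,2) lt by force+
  then have ends: "v \<bullet> g s = lL" "v \<bullet> g e = lL" using se(3,4) lr by (auto simp: walls_def)
  have fl: "g t = flow XL (t - s) (g s)" if "t \<in> {s..e}" for t by (rule flow_in_left[OF lt that])
  have "v \<bullet> flow XL t (g s) < lL" if "t \<in> {0<..<e - s}" for t
    using fl[of "s + t"] lt[of "s + t"] that by simp
  moreover have "flow XL (e - s) (g s) = g e" using fl[of e] se by simp
  ultimately have "exc v lL XL (g s) (e - s)" unfolding exc_def using ends se by simp
  with that se ends lt \<open>flow XL (e - s) (g s) = g e\<close> show ?thesis by blast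
qed

lemma strip_gap_around:
  assumes r: "lL < v \<bullet> g r" "v \<bullet> g r < lR" and w: "w \<in> walls v lL lR g"
  obtains a b where "a < r" "r < b" "Cgap a b"
proof -
  have "r \<notin> walls v lL lR g" using r by (auto simp: walls_def)
  with w obtain s e where se: "s < r" "r < e" "s \<in> walls v lL lR g" "e \<in> walls v lL lR g" "e \<le> s + T"
    and nw: "\<And>t. s < t \<Longrightarrow> t < e \<Longrightarrow> t \<notin> walls v lL lR g"
    and z: "\<And>t. s < t \<Longrightarrow> t < e \<Longrightarrow> (v \<bullet> g t < lL \<longleftrightarrow> v \<bullet> g r < lL) \<and> (v \<bullet> g t < lR \<longleftrightarrow> v \<bullet> g r < lR)"
    by (rule gap) (rule that)
  have "lL < v \<bullet> g t \<and> v \<bullet> g t < lR" if "s < t" "t < e" for t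
    using z[OF that] nw[OF that] r unfolding walls_def by auto
  then have "Cgap s e" unfolding strip_gap_def using se by auto
  with that se show ?thesis by blast
qed

lemma strip_gap_flow:
  assumes "Cgap a b" "t \<in> {a..b}"
  shows "g t = flow XC (t - a) (g a)"
  by (rule flow_in_middle[OF _ assms(2)]) (use assms(1) in \<open>auto simp: strip_gap_def\<close>)

lemma strip_gap_right:
  assumes x: "v \<bullet> g e = lL" and d: "0 < d" "\<forall>r\<in>{e<..<e + d}. lL < v \<bullet> g r"
  obtains b where "Cgap e b"
proof -
  have "v \<bullet> g e < lR" using x lr by simp
  then obtain d' where d': "0 < d'" "\<forall>r\<in>{e - d'<..<e + d'}. v \<bullet> g r < lR" using x_less_nhd by blast
  define r where "r = e + min d d' / 2"
  have r: "e < r" "r < e + d" "r < e + d'" using d d' by (auto simp: r_def)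
  have strip: "lL < v \<bullet> g u \<and> v \<bullet> g u < lR" if "e < u" "u \<le> r" for u using d d' r that by auto
  have ew: "e \<in> walls v lL lR g" using x by (simp add: walls_def)
  obtain a b where ab: "a < r" "r < b" "Cgap a b" using strip_gap_around[OF _ _ ew, of r] strip[of r] r by blast
  have "a = e"
  proof (rule antisym)
    show "a \<le> e" using strip[of a] ab unfolding strip_gap_def walls_def by force
    show "e \<le> a" using x r ab unfolding strip_gap_def by force
  qed
  with ab that show ?thesis by blast
qed

lemma strip_gap_left:
  assumes x: "v \<bullet> g s = lL" and d: "0 < d" "\<forall>r\<in>{s - d<..<s}. lL < v \<bullet> g r"
  obtains a where "Cgap a s"
proof -
  have "v \<bullet> g s < lR" using x lr by simp
  then obtain d' where d': "0 < d'" "\<forall>r\<in>{s - d'<..<s + d'}. v \<bullet> g r < lR" using x_less_nhd by blast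
  define r where "r = s - min d d' / 2"
  have r: "r < s" "s - d < r" "s - d' < r" using d d' by (auto simp: r_def)
  have strip: "lL < v \<bullet> g u \<and> v \<bullet> g u < lR" if "r \<le> u" "u < s" for u using d d' r that by auto
  have ew: "s \<in> walls v lL lR g" using x by (simp add: walls_def)
  obtain a b where ab: "a < r" "r < b" "Cgap a b" using strip_gap_around[OF _ _ ew, of r] strip[of r] r by blast
  have "b = s"
  proof (rule antisym)
    show "s \<le> b" using strip[of b] ab unfolding strip_gap_def walls_def by force
    show "b \<le> s" using x r ab unfolding strip_gap_def by force
  qed
  with ab that show ?thesis by blast
qed

text \<open>
  The link ends at the infimum of the later times at which the curve is in the strip or beyond.
  Immediately after this time the curve is on one side of the line, and this can only be the side
  of the strip.
\<close>

lemma link_extend_right: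
  assumes t: "v \<bullet> g t \<le> lL" and w: "lL < v \<bullet> g w"
  obtains e d where "t \<le> e" "\<forall>r\<in>{t..e}. v \<bullet> g r \<le> lL" "0 < d" "\<forall>r\<in>{e<..<e + d}. lL < v \<bullet> g r"
proof -
  define S where "S = {r. t \<le> r \<and> lL < v \<bullet> g r}"
  define k where "k = \<lceil>(t - w) / T\<rceil>"
  have "(t - w) / T \<le> of_int k" unfolding k_def by (rule le_of_int_ceiling)
  then have "t - w \<le> of_int k * T" using T by (simp add: pos_divide_le_eq)
  then have S: "w + of_int k * T \<in> S" unfolding S_def using w shift by simp
  have bdd: "bdd_below S" unfolding S_def by (rule bdd_belowI[of _ t]) auto
  define e where "e = Inf S"
  have te: "t \<le> e" unfolding e_def using S by (intro cInf_greatest) (auto simp: S_def)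
  have lo: "e \<le> r" if "r \<in> S" for r unfolding e_def by (rule cInf_lower[OF that bdd])
  have appr: "\<exists>r\<in>S. r < e + d" if "0 < d" for d
    using cInf_less_iff[of S "e + d"] S bdd that unfolding e_def by auto
  have le: "v \<bullet> g r \<le> lL" if "t \<le> r" "r < e" for r using lo[of r] that unfolding S_def by force
  have xe: "v \<bullet> g e \<le> lL"
  proof (cases "t = e")
    case True then show ?thesis using t by simp
  next
    case False
    then show ?thesis using x_le_closure(2)[of t e lL] te le by simp
  qed
  have "\<not> v \<bullet> g e < lL"
  proof
    assume "v \<bullet> g e < lL"
    then obtain d where d: "0 < d" "\<forall>r\<in>{e - d<..<e + d}. v \<bullet> g r < lL" using x_less_nhd by blast
    obtain r where r: "r \<in> S" "r < e + d" using appr[OF d(1)] by blast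
    then have "r \<in> {e - d<..<e + d}" using lo[OF r(1)] d(1) by simp
    then show False using d(2) r(1) unfolding S_def by force
  qed
  with xe have x: "v \<bullet> g e = lL" by simp
  obtain d where d: "d > 0" "(\<forall>r\<in>{e<..<e + d}. v \<bullet> g r < lL) \<or> (\<forall>r\<in>{e<..<e + d}. v \<bullet> g r = lL)
     \<or> (\<forall>r\<in>{e<..<e + d}. lL < v \<bullet> g r)" by (rule right_trichotomy[OF x])
  obtain r where r: "r \<in> S" "r < e + d" using appr[OF d(1)] by blast
  have "e \<noteq> r" using r(1) x by (auto simp: S_def)
  then have "r \<in> {e<..<e + d}" "lL < v \<bullet> g r" using lo[OF r(1)] r by (auto simp: S_def)
  then have "\<forall>r\<in>{e<..<e + d}. lL < v \<bullet> g r" using d(2) by (metis order_less_asym order_less_irrefl)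
  moreover have "\<forall>r\<in>{t..e}. v \<bullet> g r \<le> lL" using le x by (metis atLeastAtMost_iff order_le_less order_refl)
  ultimately show ?thesis using that te d(1) by blast
qed

text \<open>
  Time reversal turns the construction of the end of a link into one of its beginning.
\<close>

lemma link_around:
  assumes t: "v \<bullet> g t \<le> lL" and w: "lL < v \<bullet> g w"
  obtains s e where "Llink s e" "t \<in> {s..e}"
proof -
  obtain e d where e: "t \<le> e" "\<forall>r\<in>{t..e}. v \<bullet> g r \<le> lL" "0 < d" "\<forall>r\<in>{e<..<e + d}. lL < v \<bullet> g r"
    by (rule link_extend_right[OF t w])
  interpret R: cycle v lL lR "\<lambda>p. - XL p" "\<lambda>p. - XC p" "\<lambda>p. - XR p" "\<lambda>t. g (- t)" T by (rule reversal)
  have "v \<bullet> g (- (- t)) \<le> lL" "lL < v \<bullet> g (- (- w))" using t w by simp_all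
  then obtain s c where s: "- t \<le> s" "\<forall>r\<in>{-t..s}. v \<bullet> g (- r) \<le> lL" "0 < c" "\<forall>r\<in>{s<..<s + c}. lL < v \<bullet> g (- r)"
    by (rule R.link_extend_right)
  have l: "v \<bullet> g r \<le> lL" if "r \<in> {- s..t}" for r using bspec[OF s(2), of "- r"] that by auto
  have l2: "lL < v \<bullet> g r" if "r \<in> {- s - c<..<- s}" for r using bspec[OF s(4), of "- r"] that by auto
  have "v \<bullet> g r \<le> lL" if "r \<in> {- s..e}" for r using l[of r] e(2) that by (cases "r \<le> t") auto
  moreover have "- s \<le> e" using s(1) e(1) by simp
  ultimately have "Llink (- s) e" using e(3,4) s(3) l2 by (intro is_linkI[of "- s" e v g lL d c]) blast+
  moreover have "t \<in> {- s..e}" using s(1) e(1) by simp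
  ultimately show ?thesis by (rule that)
qed

lemma link_ends:
  assumes "Llink s e"
  shows "s \<le> e" "v \<bullet> g s = lL" "v \<bullet> g e = lL" "e < s + T" "\<And>r. r \<in> {s..e} \<Longrightarrow> v \<bullet> g r \<le> lL"
    "\<exists>b. Cgap e b" "\<exists>a. Cgap a s"
proof -
  obtain d where d: "0 < d" "\<forall>r\<in>{e<..<e + d}. lL < v \<bullet> g r" using assms unfolding is_link_def by blast
  obtain c where c: "0 < c" "\<forall>r\<in>{s - c<..<s}. lL < v \<bullet> g r" using assms unfolding is_link_def by blast
  show se: "s \<le> e" and le: "\<And>r. r \<in> {s..e} \<Longrightarrow> v \<bullet> g r \<le> lL" using assms unfolding is_link_def by auto
  show xe: "v \<bullet> g e = lL"
  proof (rule antisym[OF le])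
    show "lL \<le> v \<bullet> g e" by (rule x_ge_closure(1)[of e "e + d"]) (use d in \<open>auto intro: less_imp_le\<close>)
  qed (use se in simp)
  show xs: "v \<bullet> g s = lL"
  proof (rule antisym[OF le])
    show "lL \<le> v \<bullet> g s" by (rule x_ge_closure(2)[of "s - c" s]) (use c in \<open>auto intro: less_imp_le\<close>)
  qed (use se in simp)
  show "e < s + T"
  proof (rule ccontr)
    assume n: "\<not> e < s + T"
    define r where "r = e + min (d / 2) T"
    have "r \<in> {e<..<e + d}" "r - T \<in> {s..e}" using d(1) T n by (auto simp: r_def)
    then have "lL < v \<bullet> g r" "v \<bullet> g (r - T) \<le> lL" using d(2) le by blast+
    then show False using per[of "r - T"] by simp
  qed
  show "\<exists>b. Cgap e b" using strip_gap_right[OF xe d] by blast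
  show "\<exists>a. Cgap a s" using strip_gap_left[OF xs c] by blast
qed

lemma link_shift: "Llink s e \<Longrightarrow> Llink (s + of_int k * T) (e + of_int k * T)"
proof -
  assume a: "Llink s e"
  obtain d where d: "0 < d" "\<forall>r\<in>{e<..<e + d}. lL < v \<bullet> g r" using a unfolding is_link_def by blast
  obtain c where c: "0 < c" "\<forall>r\<in>{s - c<..<s}. lL < v \<bullet> g r" using a unfolding is_link_def by blast
  have sh: "g r = g (r - of_int k * T)" for r using shift[of "r - of_int k * T" k] by simp
  have "lL < v \<bullet> g r" if "r \<in> {e + of_int k * T<..<e + of_int k * T + d}" for r
    unfolding sh[of r] using bspec[OF d(2), of "r - of_int k * T"] that by auto
  moreover have "lL < v \<bullet> g r" if "r \<in> {s + of_int k * T - c<..<s + of_int k * T}" for r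
    unfolding sh[of r] using bspec[OF c(2), of "r - of_int k * T"] that by auto
  moreover have "v \<bullet> g r \<le> lL" if "r \<in> {s + of_int k * T..e + of_int k * T}" for r
    unfolding sh[of r] using link_ends(5)[OF a, of "r - of_int k * T"] that by auto
  ultimately show ?thesis
    using link_ends(1)[OF a] d(1) c(1)
    by (intro is_linkI[of "s + of_int k * T" "e + of_int k * T" v g lL d c]) simp_all
qed

lemma link_before_gap:
  assumes c: "Cgap a b" and x: "v \<bullet> g a = lL"
  shows "\<exists>s. Llink s a"
proof -
  have ab: "a < b" using c unfolding strip_gap_def by simp
  then have w: "lL < v \<bullet> g ((a + b) / 2)" using c unfolding strip_gap_def by simp
  obtain s e where l: "Llink s e" "a \<in> {s..e}" using link_around[OF _ w, of a] x by auto
  have "\<not> a < e"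
  proof
    assume "a < e"
    define r where "r = min ((a + b) / 2) e"
    have "r \<in> {a<..<b}" "r \<in> {s..e}" using \<open>a < e\<close> l(2) ab by (auto simp: r_def min_def)
    then have "lL < v \<bullet> g r" "v \<bullet> g r \<le> lL" using c link_ends(5)[OF l(1)] unfolding strip_gap_def by blast+
    then show False by simp
  qed
  then have "a = e" using l(2) by simp
  then show ?thesis using l(1) by blast
qed

lemma link_after_gap:
  assumes c: "Cgap a b" and x: "v \<bullet> g b = lL"
  shows "\<exists>e. Llink b e"
proof -
  have ab: "a < b" using c unfolding strip_gap_def by simp
  then have w: "lL < v \<bullet> g ((a + b) / 2)" using c unfolding strip_gap_def by simp
  obtain s e where l: "Llink s e" "b \<in> {s..e}" using link_around[OF _ w, of b] x by auto
  have "\<not> s < b"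
  proof
    assume "s < b"
    define r where "r = max ((a + b) / 2) s"
    have "r \<in> {a<..<b}" "r \<in> {s..e}" using \<open>s < b\<close> l(2) ab by (auto simp: r_def max_def)
    then have "lL < v \<bullet> g r" "v \<bullet> g r \<le> lL" using c link_ends(5)[OF l(1)] unfolding strip_gap_def by blast+
    then show False by simp
  qed
  then have "b = s" using l(2) by simp
  then show ?thesis using l(1) by blast
qed

text \<open>
  Links that share a time coincide. The translate of the first link by one period ends at the time
  \<open>e + T\<close>, which belongs to the second link, because \<open>e'\<close> differs from
  \<open>e\<close> by a positive multiple of the period.
\<close>

lemma closing_link:
  assumes 1: "Llink s e" and 2: "Llink s' e'" and eq: "g e = g e'" and less: "e < s'" and first: "\<not> e + T < s'"
  shows "e' = e + T"
proof -
  obtain k :: int where k: "e' = e + of_int k * T" using inj[OF eq] by blast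
  have "0 < of_int k * T" using k less link_ends(1)[OF 2] by simp
  then have "1 \<le> k" using T by (simp add: zero_less_mult_iff)
  then have "1 * T \<le> of_int k * T" using T by (intro mult_right_mono) simp_all
  then have "e + of_int 1 * T \<in> {s'..e'}" using k first by simp
  moreover have "Llink (s + of_int 1 * T) (e + of_int 1 * T)" by (rule link_shift[OF 1])
  moreover have "e + of_int 1 * T \<in> {s + of_int 1 * T..e + of_int 1 * T}" using link_ends(1)[OF 1] by simp
  ultimately have "e' = e + of_int 1 * T" using is_link_unique(2)[OF 2] by blast
  then show ?thesis by simp
qed

text \<open>
  Take the last visit to the left line before the right line is reached, and the first subsequent
  visit to the right line.
\<close>

lemma passage_across:
  assumes st: "s \<le> t" "v \<bullet> g s = lL" "v \<bullet> g t = lR"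
  obtains a b where "Cgap a b" "v \<bullet> g a = lL" "v \<bullet> g b = lR"
proof -
  have cl: "closed {r. v \<bullet> g r = c}" for c using xcont[of UNIV] by (auto intro!: closed_Collect_eq continuous_intros)
  have "compact ({s..t} \<inter> {r. v \<bullet> g r = lL})" by (intro compact_Int_closed compact_Icc cl)
  moreover have "s \<in> {s..t} \<inter> {r. v \<bullet> g r = lL}" using st by simp
  ultimately obtain a where a: "a \<in> {s..t} \<inter> {r. v \<bullet> g r = lL}" "\<And>r. r \<in> {s..t} \<inter> {r. v \<bullet> g r = lL} \<Longrightarrow> r \<le> a"
    using compact_attains_sup by (metis empty_iff)
  have "compact ({a..t} \<inter> {r. v \<bullet> g r = lR})" by (intro compact_Int_closed compact_Icc cl)
  moreover have "t \<in> {a..t} \<inter> {r. v \<bullet> g r = lR}" using a(1) st by simp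
  ultimately obtain b where b: "b \<in> {a..t} \<inter> {r. v \<bullet> g r = lR}" "\<And>r. r \<in> {a..t} \<inter> {r. v \<bullet> g r = lR} \<Longrightarrow> b \<le> r"
    using compact_attains_inf by (metis empty_iff)
  have xa: "v \<bullet> g a = lL" and xb: "v \<bullet> g b = lR" using a(1) b(1) by simp_all
  have "a \<noteq> b" using xa xb lr by auto
  then have ab: "a < b" using b(1) by simp
  have abt: "s \<le> a" "b \<le> t" using a(1) b(1) by simp_all
  have nL: "v \<bullet> g r \<noteq> lL" if "a < r" "r \<le> b" for r using a(2)[of r] abt that by auto
  have nR: "v \<bullet> g r \<noteq> lR" if "a \<le> r" "r < b" for r using b(2)[of r] abt that by auto
  have "lL < v \<bullet> g r \<and> v \<bullet> g r < lR" if r: "a < r" "r < b" for r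
  proof -
    have "v \<bullet> g r < lR \<longleftrightarrow> v \<bullet> g a < lR" by (rule x_between) (use nR r in simp)
    moreover have "v \<bullet> g r < lL \<longleftrightarrow> v \<bullet> g b < lL" by (rule x_between) (use nL r in simp)
    ultimately show ?thesis using xa xb lr nL[of r] r by auto
  qed
  then have "Cgap a b" unfolding strip_gap_def walls_def using ab xa xb by auto
  then show ?thesis using xa xb by (rule that)
qed

lemma gap_exc_left:
  assumes c: "Cgap a b" and x: "v \<bullet> g a = lL" "v \<bullet> g b = lL"
  shows "exc (- v) (- lL) XC (g a) (b - a)" "flow XC (b - a) (g a) = g b"
    "0 \<le> v \<bullet> XC (g a)" "v \<bullet> XC (g b) = - (v \<bullet> XC (g a))"
proof -
  have ab: "a < b" using c unfolding strip_gap_def by simp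
  show fl: "flow XC (b - a) (g a) = g b" using strip_gap_flow[OF c, of b] ab by simp
  have "lL < v \<bullet> flow XC t (g a)" if "t \<in> {0<..<b - a}" for t
  proof -
    have "a + t \<in> {a<..<b}" using that by auto
    then have "lL < v \<bullet> g (a + t) \<and> v \<bullet> g (a + t) < lR" using c unfolding strip_gap_def by blast
    then show ?thesis using strip_gap_flow[OF c, of "a + t"] that by simp
  qed
  then show e: "exc (- v) (- lL) XC (g a) (b - a)" unfolding exc_def using x fl ab by simp
  show "0 \<le> v \<bullet> XC (g a)" "v \<bullet> XC (g b) = - (v \<bullet> XC (g a))"
    using exc_velocity[OF hC e] fl by simp_all
qed

lemma gap_cross:
  assumes c: "Cgap a b" and x: "v \<bullet> g a = lL" "v \<bullet> g b = lR"
  shows "cross v lL lR XC (g a) (b - a)" "flow XC (b - a) (g a) = g b"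
    "0 \<le> v \<bullet> XC (g a)" "0 \<le> v \<bullet> XC (g b)"
proof -
  have ab: "a < b" using c unfolding strip_gap_def by simp
  show fl: "flow XC (b - a) (g a) = g b" using strip_gap_flow[OF c, of b] ab by simp
  have "lL < v \<bullet> flow XC t (g a) \<and> v \<bullet> flow XC t (g a) < lR" if "t \<in> {0<..<b - a}" for t
  proof -
    have "a + t \<in> {a<..<b}" using that by auto
    then have "lL < v \<bullet> g (a + t) \<and> v \<bullet> g (a + t) < lR" using c unfolding strip_gap_def by blast
    then show ?thesis using strip_gap_flow[OF c, of "a + t"] that by simp
  qed
  then show e: "cross v lL lR XC (g a) (b - a)" unfolding cross_def using x fl ab by simp
  show "0 \<le> v \<bullet> XC (g a)" "0 \<le> v \<bullet> XC (g b)"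
    using cross_velocity(2,3)[OF hC lr e] fl by simp_all
qed

lemma gap_energy:
  assumes "Cgap a b" shows "energy v XC (g b) = energy v XC (g a)"
proof -
  have "g b = flow XC (b - a) (g a)" using strip_gap_flow[OF assms, of b] assms unfolding strip_gap_def by simp
  then show ?thesis using energy_flow[OF hC] by simp
qed

end

section \<open>Links around a nondegenerate strip\<close>

lemma exc_not_invariant:
  assumes "exc v l X p T"
  shows "\<not> invariant_line v l X"
proof
  assume i: "invariant_line v l X"
  have "v \<bullet> p = l" "T / 2 \<in> {0<..<T}" using assms unfolding exc_def by auto
  then have "v \<bullet> flow X (T / 2) p < l" "v \<bullet> flow X (T / 2) p = l"
    using assms invariant_line_flow[OF i] unfolding exc_def by blast+
  then show False by simp
qed

text \<open>
  The outermost place at which the curve comes back from the half plane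
  \<open>v \<bullet> p \<le> l\<close>: the velocity of \<open>X\<close>, the field of the
  strip, orders the points of the line.
\<close>

definition top_end :: "plane \<Rightarrow> real \<Rightarrow> (plane \<Rightarrow> plane) \<Rightarrow> (real \<Rightarrow> plane) \<Rightarrow> real \<Rightarrow> bool" where
  "top_end v l X g e \<longleftrightarrow> (\<exists>s. is_link v l g s e) \<and>
     (\<forall>s' e'. is_link v l g s' e' \<longrightarrow> v \<bullet> X (g e') \<le> v \<bullet> X (g e))"

context cycle
begin

text \<open>
  The gaps before and after the link are in the strip, where the curve follows the middle field.
\<close>

lemma link_velocity:
  assumes "Llink s e"
  shows "v \<bullet> XC (g s) \<le> 0" "0 \<le> v \<bullet> XC (g e)"
proof -
  interpret M: cycle "- v" "- lR" "- lL" XR XC XL g T by (rule mirror)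
  note E = link_ends[OF assms]
  obtain a b where a: "Cgap a s" and b: "Cgap e b" using E(6,7) by blast
  have "v \<bullet> g b = lL \<or> v \<bullet> g b = lR" "v \<bullet> g a = lL \<or> v \<bullet> g a = lR"
    using a b unfolding strip_gap_def walls_def by auto
  then show "0 \<le> v \<bullet> XC (g e)" using gap_exc_left(3)[OF b E(3)] gap_cross(3)[OF b E(3)] by blast
  have a': "strip_gap (- v) (- lR) (- lL) g a s" using a by simp
  from \<open>v \<bullet> g a = lL \<or> v \<bullet> g a = lR\<close> show "v \<bullet> XC (g s) \<le> 0"
  proof
    assume "v \<bullet> g a = lL"
    then show ?thesis using gap_exc_left(3,4)[OF a _ E(2)] by simp
  next
    assume "v \<bullet> g a = lR"
    then show ?thesis using M.gap_cross(4)[OF a'] E(2) by simp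
  qed
qed

lemma gap_from_right_germ:
  assumes x: "v \<bullet> g t = lL" and d: "0 < d" "\<forall>r\<in>{t<..<t + d}. v \<bullet> g r < lL"
  obtains e where "t < e" "\<And>r. t < r \<Longrightarrow> r < e \<Longrightarrow> v \<bullet> g r < lL" "v \<bullet> g e = lL"
    "exc v lL XL (g t) (e - t)" "flow XL (e - t) (g t) = g e"
proof -
  define r where "r = t + d / 2"
  have r: "t < r" "r < t + d" using d(1) by (auto simp: r_def)
  have "v \<bullet> g r < lL" using d(2) r by simp
  then obtain s e where se: "s < r" "r < e" "v \<bullet> g s = lL" "v \<bullet> g e = lL"
    "\<And>t. s < t \<Longrightarrow> t < e \<Longrightarrow> v \<bullet> g t < lL" "exc v lL XL (g s) (e - s)" "flow XL (e - s) (g s) = g e"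
    using left_gap[OF _ x] by metis
  have "s = t"
  proof (rule antisym)
    show "t \<le> s" using se(5)[of t] se(2) x r by force
    show "s \<le> t" using d(2) se(1,3) r by force
  qed
  with se r that[of e] show ?thesis by simp
qed

text \<open>
  A line that is not invariant under the middle field can be followed only with the outer field.
\<close>

lemma wall_right_flow:
  assumes d: "0 < d" "\<forall>u\<in>{r..<r + d}. v \<bullet> g u = lL" and ni: "\<not> invariant_line v lL XC"
  shows "\<exists>d'>0. \<forall>h\<in>{0..d'}. g (r + h) = flow XL h (g r)"
proof -
  have xr: "v \<bullet> g r = lL" using d by simp
  obtain e X where e: "0 < e" and X: "hfield X"
    and eq: "\<And>h. 0 \<le> h \<Longrightarrow> h \<le> e \<Longrightarrow> g (r + 1 * h) = flow X (1 * h) (g r)"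
    and cs: "(X = XL \<and> v \<bullet> g r \<le> lL) \<or> (X = XC \<and> lL \<le> v \<bullet> g r \<and> v \<bullet> g r \<le> lR) \<or> (X = XR \<and> lR \<le> v \<bullet> g r)"
    using germ_field[OF rgerm[of r]] by blast
  define h where "h = min (min (d / 2) e) (T / 2)"
  have h: "0 < h" "h < d" "h \<le> e" "h < T" using d e T by (auto simp: h_def)
  have "v \<bullet> flow X s (g r) = lL" if "s \<in> {0..h}" for s
    using eq[of s] bspec[OF d(2), of "r + s"] h that by simp
  then have gl: "glide v lL X (g r) h" unfolding glide_def using h by simp
  have "flow X h (g r) \<noteq> g r" using eq[of h] g_neq[of r "r + h"] h by auto
  then have "invariant_line v lL X" using glide_invariant[OF X v gl] by blast
  then have "X = XL" using cs xr lr ni by auto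
  then show ?thesis using eq e by auto
qed

text \<open>
  A link of positive length is a single excursion or a single glide. Two consecutive excursions
  would meet at a point of tangency, and then the second one would be a closed orbit; and a line
  along which an orbit glides is invariant and admits no excursions.
\<close>

lemma link_structure:
  assumes nd: "nondeg v XC" and lk: "Llink s e" and se: "s < e"
  shows "flow XL (e - s) (g s) = g e" "link v lL XL (g s) (e - s)"
    "\<And>r. r \<in> {s..e} \<Longrightarrow> g r = flow XL (r - s) (g s)"
    "exc v lL XL (g s) (e - s) \<or> (\<forall>r\<in>{s..e}. v \<bullet> g r = lL) \<and> glide v lL XL (g s) (e - s)"
    "exc v lL XL (g s) (e - s) \<Longrightarrow> r \<in> {s..e} \<Longrightarrow> v \<bullet> g r = lL \<Longrightarrow> r = s \<or> r = e"
proof -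
  note E = link_ends[OF lk]
  have niC: "\<not> invariant_line v lL XC" using nd invariant_line_degenerate[OF hC v] by blast
  have ne: "g s \<noteq> g e" using g_neq[OF se] E(4) by blast
  have not_greater: "\<not> (\<forall>r\<in>{t<..<t + d}. lL < v \<bullet> g r)" if "0 < d" "s \<le> t" "t < e" for t d
  proof
    assume a: "\<forall>r\<in>{t<..<t + d}. lL < v \<bullet> g r"
    define r where "r = min (t + d / 2) e"
    have "r \<in> {t<..<t + d}" "r \<in> {s..e}" using that by (auto simp: r_def min_def)
    then show False using a E(5)[of r] by force
  qed
  have equal_inv: "invariant_line v lL XL" if "0 < d" "v \<bullet> g t = lL" "\<forall>r\<in>{t<..<t + d}. v \<bullet> g r = lL" for t d
  proof -
    have "\<forall>r\<in>{t..<t + d}. v \<bullet> g r = lL" using that by (metis atLeastLessThan_iff greaterThanLessThan_iff order_le_less)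
    from equal_germ_invariant[OF that(1) this] niC show ?thesis by blast
  qed
  obtain d where d: "d > 0" "(\<forall>r\<in>{s<..<s + d}. v \<bullet> g r < lL) \<or> (\<forall>r\<in>{s<..<s + d}. v \<bullet> g r = lL)
     \<or> (\<forall>r\<in>{s<..<s + d}. lL < v \<bullet> g r)" by (rule right_trichotomy[OF E(2)])
  then consider "\<forall>r\<in>{s<..<s + d}. v \<bullet> g r < lL" | "\<forall>r\<in>{s<..<s + d}. v \<bullet> g r = lL"
    using not_greater[OF d(1) order_refl se] by blast
  then have main: "(exc v lL XL (g s) (e - s) \<and> (\<forall>r\<in>{s<..<e}. v \<bullet> g r < lL)
      \<or> (\<forall>r\<in>{s..e}. v \<bullet> g r = lL) \<and> glide v lL XL (g s) (e - s)) \<and> (\<forall>r\<in>{s..e}. g r = flow XL (r - s) (g s))"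
  proof cases
    case 1
    obtain e' where e': "s < e'" "\<And>r. s < r \<Longrightarrow> r < e' \<Longrightarrow> v \<bullet> g r < lL" "v \<bullet> g e' = lL"
      "exc v lL XL (g s) (e' - s)" "flow XL (e' - s) (g s) = g e'"
      using gap_from_right_germ[OF E(2) d(1) 1] by metis
    have le: "e' \<le> e" using e'(2)[of e] E(3) se by force
    have "e' = e"
    proof (rule ccontr)
      assume "e' \<noteq> e"
      then have lt: "e' < e" using le by simp
      obtain c where c: "c > 0" "(\<forall>r\<in>{e'<..<e' + c}. v \<bullet> g r < lL) \<or> (\<forall>r\<in>{e'<..<e' + c}. v \<bullet> g r = lL)
        \<or> (\<forall>r\<in>{e'<..<e' + c}. lL < v \<bullet> g r)" by (rule right_trichotomy[OF e'(3)])
      have "\<not> (\<forall>r\<in>{e'<..<e' + c}. v \<bullet> g r = lL)"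
        using equal_inv[OF c(1) e'(3)] exc_not_invariant[OF e'(4)] by blast
      moreover have "\<not> (\<forall>r\<in>{e'<..<e' + c}. lL < v \<bullet> g r)" using not_greater[OF c(1)] e'(1) lt by simp
      ultimately have "\<forall>r\<in>{e'<..<e' + c}. v \<bullet> g r < lL" using c(2) by blast
      then obtain e'' where e'': "e' < e''" "\<And>r. e' < r \<Longrightarrow> r < e'' \<Longrightarrow> v \<bullet> g r < lL" "v \<bullet> g e'' = lL"
        "exc v lL XL (g e') (e'' - e')" "flow XL (e'' - e') (g e') = g e''"
        using gap_from_right_germ[OF e'(3) c(1)] by metis
      have "e'' \<le> e" using e''(2)[of e] E(3) lt by force
      \<comment> \<open>the orbit would arrive at and leave the line on the same side: a full turn around a centre\<close>
      have "v \<bullet> XL (g e') = 0"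
        using exc_velocity[OF hL e'(4)] exc_velocity(1)[OF hL e''(4)] e'(5) by simp
      then have "g e'' = g e'" using exc_closed[OF hL e''(4)] e''(5) by simp
      then show False using g_neq[OF e''(1)] \<open>e'' \<le> e\<close> E(4) e'(1) by force
    qed
    moreover have "g r = flow XL (r - s) (g s)" if "r \<in> {s..e}" for r
      by (rule flow_in_left[OF _ that]) (use e'(2) \<open>e' = e\<close> in simp)
    moreover have "exc v lL XL (g s) (e - s)" using e'(4) \<open>e' = e\<close> by simp
    moreover have "\<forall>r\<in>{s<..<e}. v \<bullet> g r < lL" using e'(2) \<open>e' = e\<close> by simp
    ultimately show ?thesis by blast
  next
    case 2
    have inv: "invariant_line v lL XL" by (rule equal_inv[OF d(1) E(2) 2])
    have on: "v \<bullet> g r = lL" if "r \<in> {s..e}" for r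
    proof (rule ccontr)
      assume "v \<bullet> g r \<noteq> lL"
      then have "v \<bullet> g r < lL" using E(5)[OF that] by simp
      then obtain a b where "exc v lL XL (g a) (b - a)" using left_gap[OF _ E(2)] by metis
      then show False using exc_not_invariant inv by blast
    qed
    have fl: "g r = flow XL (r - s) (g s)" if "r \<in> {s..e}" for r
    proof (rule flow_on_interval[OF hL _ _ that])
      show "continuous_on {s..e} g" using cont by (rule continuous_on_subset) simp
      fix t assume t: "s < t" "t < e"
      interpret R: cycle v lL lR "\<lambda>p. - XL p" "\<lambda>p. - XC p" "\<lambda>p. - XR p" "\<lambda>t. g (- t)" T by (rule reversal)
      have "\<forall>u\<in>{t..<t + (e - t)}. v \<bullet> g u = lL" using on t by simp
      then obtain d1 where d1: "0 < d1" "\<forall>h\<in>{0..d1}. g (t + h) = flow XL h (g t)"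
        using wall_right_flow[OF _ _ niC, of "e - t" t] t by auto
      have "\<forall>u\<in>{-t..<-t + (t - s)}. v \<bullet> g (- u) = lL" using on t by simp
      moreover have "\<not> invariant_line v lL (\<lambda>p. - XC p)" using niC unfolding invariant_line_def centre_minus by simp
      ultimately obtain d2 where d2: "0 < d2" "\<forall>h\<in>{0..d2}. g (- (- t + h)) = flow (\<lambda>p. - XL p) h (g (- (- t)))"
        using R.wall_right_flow[of "t - s" "- t"] t by auto
      show "\<exists>d>0. \<forall>h\<in>{0..d}. g (t + h) = flow XL h (g t) \<and> g (t - h) = flow XL (- h) (g t)"
        by (rule exI[of _ "min d1 d2"]) (use d1 d2 in \<open>simp add: flow_minus\<close>)
    qed
    have "v \<bullet> flow XL t (g s) = lL" for t by (rule invariant_line_flow[OF inv E(2)])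
    then have "glide v lL XL (g s) (e - s)" unfolding glide_def using se by simp
    then show ?thesis using on fl by blast
  qed
  show fl: "\<And>r. r \<in> {s..e} \<Longrightarrow> g r = flow XL (r - s) (g s)" using main by blast
  show fe: "flow XL (e - s) (g s) = g e" using fl[of e] se by simp
  show "link v lL XL (g s) (e - s)" unfolding link_def fe using main ne by auto
  show "exc v lL XL (g s) (e - s) \<or> (\<forall>r\<in>{s..e}. v \<bullet> g r = lL) \<and> glide v lL XL (g s) (e - s)" using main by blast
  show "r = s \<or> r = e" if x: "exc v lL XL (g s) (e - s)" "r \<in> {s..e}" "v \<bullet> g r = lL"
  proof (rule ccontr)
    assume "\<not> (r = s \<or> r = e)"
    then have r: "r \<in> {s<..<e}" using x(2) by auto
    have "\<not> glide v lL XL (g s) (e - s)"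
      using exc_not_invariant[OF x(1)] glide_invariant[OF hL v] fe ne by metis
    then have "\<forall>r\<in>{s<..<e}. v \<bullet> g r < lL" using main by blast
    then have "v \<bullet> g r < lL" using r by blast
    then show False using x(3) by simp
  qed
qed

lemma velocity_continuous: "continuous_on S (\<lambda>t. v \<bullet> XC (g t))"
  by (intro continuous_intros continuous_on_compose2[OF hfield_continuous[OF hC, of UNIV]] continuous_on_subset[OF cont]) auto

text \<open>
  Along a glide the curve is injective, and so the velocity of the middle field is monotone along
  it, and increasing because of the signs at the two ends.
\<close>

lemma link_velocity_order:
  assumes nd: "nondeg v XC" and lk: "Llink s e" and r: "r \<in> {s..e}" "v \<bullet> g r = lL"
  shows "v \<bullet> XC (g r) \<le> v \<bullet> XC (g e)"
proof (cases "r = s \<or> r = e")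
  case True
  then show ?thesis using link_velocity[OF lk] by auto
next
  case False
  then have sre: "s < r" "r < e" using r by auto
  then have se: "s < e" by simp
  note E = link_ends[OF lk]
  have "\<not> exc v lL XL (g s) (e - s)" using link_structure(5)[OF nd lk se _ r] False by blast
  then have on: "\<And>u. u \<in> {s..e} \<Longrightarrow> v \<bullet> g u = lL" using link_structure(4)[OF nd lk se] by blast
  have "inj_on (\<lambda>t. v \<bullet> XC (g t)) {s..e}"
  proof (rule inj_onI, rule ccontr)
    fix a b assume ab: "a \<in> {s..e}" "b \<in> {s..e}" "v \<bullet> XC (g a) = v \<bullet> XC (g b)" "a \<noteq> b"
    then have "g a = g b" using nondegD[OF nd, of "g a" "g b"] on by simp
    then show False using g_neq[of a b] g_neq[of b a] ab E(4) by force
  qed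
  from continuous_inj_imp_mono[OF sre velocity_continuous this] link_velocity[OF lk]
  show ?thesis by linarith
qed

text \<open>
  The velocity of the middle field does not have the same sign at both ends, and a link other than
  an excursion stays on the line.
\<close>

lemma link_zero_velocity:
  assumes nd: "nondeg v XC" and lk: "Llink s e" and ne: "\<not> (s < e \<and> exc v lL XL (g s) (e - s))"
  obtains r where "r \<in> {s..e}" "v \<bullet> g r = lL" "v \<bullet> XC (g r) = 0"
proof (cases "s = e")
  case True
  show ?thesis
  proof (rule that[of s])
    show "v \<bullet> XC (g s) = 0" using link_velocity[OF lk] unfolding True by linarith
  qed (use True link_ends(2)[OF lk] in simp_all)
next
  case False
  then have se: "s < e" using link_ends(1)[OF lk] by simp
  then have on: "\<And>u. u \<in> {s..e} \<Longrightarrow> v \<bullet> g u = lL" using link_structure(4)[OF nd lk se] ne by blast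
  obtain r where r: "s \<le> r" "r \<le> e" "v \<bullet> XC (g r) = 0"
    using IVT'[of "\<lambda>t. v \<bullet> XC (g t)" s 0 e, OF link_velocity[OF lk] link_ends(1)[OF lk] velocity_continuous] by blast
  show ?thesis by (rule that[of r]) (use r on in simp_all)
qed

text \<open>
  Of two excursions one encloses the other, because the sum of the end velocities is the same. All
  other links contain the point of the line with velocity zero, so that there is at most one of
  them. Excursions and glides do not occur together, and a trivial link sits at velocity zero.
\<close>

lemma links_nested:
  assumes nd: "nondeg v XC" and 1: "Llink s e" and 2: "Llink s' e'"
    and le: "v \<bullet> XC (g s') \<le> v \<bullet> XC (g s)" "v \<bullet> XC (g e') \<le> v \<bullet> XC (g e)"
  shows "g s' = g s" "g e' = g e"
proof -
  note E1 = link_ends[OF 1] and E2 = link_ends[OF 2]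
  note V1 = link_velocity[OF 1] and V2 = link_velocity[OF 2]
  have shared: "g s' = g s \<and> g e' = g e" if r: "r \<in> {s..e}" "r' \<in> {s'..e'}" "g r = g r'" for r r'
  proof -
    obtain k :: int where k: "r' = r + of_int k * T" using inj[OF r(3)] by blast
    have "r' \<in> {s + of_int k * T..e + of_int k * T}" using r(1) k by simp
    from is_link_unique[OF link_shift[OF 1] 2 this r(2)] show ?thesis using shift by metis
  qed
  let ?x1 = "s < e \<and> exc v lL XL (g s) (e - s)" and ?x2 = "s' < e' \<and> exc v lL XL (g s') (e' - s')"
  have "g s' = g s \<and> g e' = g e"
  proof (cases ?x1; cases ?x2)
    assume x1: ?x1 and x2: ?x2
    have "g s + g e = g s' + g e'"
      using exc_sum[OF hL v conjunct2[OF x1] conjunct2[OF x2]] link_structure(1)[OF nd 1] link_structure(1)[OF nd 2] x1 x2 by simp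
    from field_sum[OF hC this] have "v \<bullet> XC (g s) + v \<bullet> XC (g e) = v \<bullet> XC (g s') + v \<bullet> XC (g e')"
      by (metis inner_add_right)
    then have "v \<bullet> XC (g s') = v \<bullet> XC (g s)" "v \<bullet> XC (g e') = v \<bullet> XC (g e)" using le by linarith+
    then show ?thesis using nondegD[OF nd] E1 E2 by simp
  next
    assume x1: ?x1 and x2: "\<not> ?x2"
    have "s' = e'"
    proof (rule ccontr)
      assume "s' \<noteq> e'"
      then have se: "s' < e'" using E2(1) by simp
      then have "glide v lL XL (g s') (e' - s')" using link_structure(4)[OF nd 2 se] x2 by blast
      moreover have "flow XL (e' - s') (g s') \<noteq> g s'" using link_structure(2)[OF nd 2 se] unfolding link_def by blast
      ultimately have "invariant_line v lL XL" by (rule glide_invariant[OF hL v])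
      then show False using exc_not_invariant x1 by blast
    qed
    then have "v \<bullet> XC (g s') = v \<bullet> XC (g s)" using V1 V2 le by simp
    then have "g s = g s'" using nondegD[OF nd] E1 E2 by simp
    then show ?thesis using shared[of s s'] E1(1) E2(1) by simp
  next
    assume x1: "\<not> ?x1" and x2: ?x2
    have "s = e"
    proof (rule ccontr)
      assume "s \<noteq> e"
      then have se: "s < e" using E1(1) by simp
      then have "glide v lL XL (g s) (e - s)" using link_structure(4)[OF nd 1 se] x1 by blast
      moreover have "flow XL (e - s) (g s) \<noteq> g s" using link_structure(2)[OF nd 1 se] unfolding link_def by blast
      ultimately have "invariant_line v lL XL" by (rule glide_invariant[OF hL v])
      then show False using exc_not_invariant x2 by blast
    qed
    then have "v \<bullet> XC (g e') = v \<bullet> XC (g e)" using V1 V2 le by simp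
    then have "g e = g e'" using nondegD[OF nd] E1 E2 by simp
    then show ?thesis using shared[of e e'] E1(1) E2(1) by simp
  next
    assume x1: "\<not> ?x1" and x2: "\<not> ?x2"
    obtain r r' where r: "r \<in> {s..e}" "v \<bullet> g r = lL" "v \<bullet> XC (g r) = 0"
      and r': "r' \<in> {s'..e'}" "v \<bullet> g r' = lL" "v \<bullet> XC (g r') = 0"
      using link_zero_velocity[OF nd 1 x1] link_zero_velocity[OF nd 2 x2] by metis
    have "g r = g r'" using nondegD[OF nd] r r' by simp
    then show ?thesis using shared r(1) r'(1) by blast
  qed
  then show "g s' = g s" "g e' = g e" by blast+
qed

lemma top_end_exists:
  assumes nd: "nondeg v XC" and w: "v \<bullet> g w = lL" and w': "lL < v \<bullet> g w'"
  obtains e where "top_end v lL XC g e"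
proof -
  have red: "\<exists>t\<in>{0..T}. g t = g u" for u using range_g[of 0] by (metis add_0 image_iff rangeI)
  define K where "K = {t \<in> {0..T}. v \<bullet> g t = lL}"
  have "closed {t. v \<bullet> g t = lL}" using xcont[of UNIV] by (auto intro!: closed_Collect_eq continuous_intros)
  moreover have "K = {0..T} \<inter> {t. v \<bullet> g t = lL}" by (auto simp: K_def)
  ultimately have "compact K" by (simp add: compact_Int_closed)
  moreover have "K \<noteq> {}" using red[of w] w by (auto simp: K_def)
  ultimately obtain t where t: "t \<in> K" "\<And>u. u \<in> K \<Longrightarrow> v \<bullet> XC (g u) \<le> v \<bullet> XC (g t)"
    using continuous_attains_sup[OF _ _ velocity_continuous] by metis
  have xt: "v \<bullet> g t = lL" using t(1) by (simp add: K_def)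
  obtain s e where l: "Llink s e" "t \<in> {s..e}" using link_around[OF _ w', of t] xt by auto
  have "v \<bullet> XC (g e') \<le> v \<bullet> XC (g e)" if l': "Llink s' e'" for s' e'
  proof -
    obtain u where u: "u \<in> {0..T}" "g u = g e'" using red by blast
    then have "u \<in> K" using link_ends(3)[OF l'] by (simp add: K_def)
    from t(2)[OF this] u(2) link_velocity_order[OF nd l xt] show ?thesis by simp
  qed
  with l(1) that show ?thesis unfolding top_end_def by blast
qed

end

section \<open>The equations for the velocities\<close>

text \<open>
  The velocity \<open>z1\<close> is increased, and the remaining velocities are determined in the
  order of passage. The sum \<open>z0 + z1\<close> need not be preserved, as is appropriate for
  a loop that glides along the left line.
\<close>

lemma left_free_family:
  fixes z0 z1 z2 z3 D :: real
  assumes sgn: "z0 \<le> 0" "0 \<le> z1" "0 \<le> z2" "z3 \<le> 0" and eqs: "z2\<^sup>2 = z1\<^sup>2 + D" "z3\<^sup>2 = z0\<^sup>2 + D"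
  obtains f0 f1 f2 f3 :: "real \<Rightarrow> real" where
    "(f0 \<longlongrightarrow> z0) (at_right 0)" "(f1 \<longlongrightarrow> z1) (at_right 0)" "(f2 \<longlongrightarrow> z2) (at_right 0)" "(f3 \<longlongrightarrow> z3) (at_right 0)"
    "\<And>s. 0 < s \<Longrightarrow> z1 < f1 s \<and> z2 < f2 s \<and> f3 s < z3 \<and> f0 s \<le> z0
       \<and> (f2 s)\<^sup>2 = (f1 s)\<^sup>2 + D \<and> (f3 s)\<^sup>2 = (f0 s)\<^sup>2 + D \<and> f2 s + f3 s = z2 + z3"
proof -
  define f1 where "f1 s = z1 + s" for s
  define f2 where "f2 s = sqrt ((f1 s)\<^sup>2 + D)" for s
  define f3 where "f3 s = z2 + z3 - f2 s" for s
  define f0 where "f0 s = - sqrt ((f3 s)\<^sup>2 - D)" for s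
  have l: "((\<lambda>s. s) \<longlongrightarrow> 0) (at_right (0::real))" by (rule tendsto_ident_at)
  have l1: "(f1 \<longlongrightarrow> z1) (at_right 0)"
    unfolding f1_def[abs_def] using tendsto_add[OF tendsto_const l, of z1] by simp
  have "sqrt (z1\<^sup>2 + D) = z2" using eqs(1) sgn(3) by (metis real_sqrt_abs abs_of_nonneg)
  then have l2: "(f2 \<longlongrightarrow> z2) (at_right 0)"
    unfolding f2_def[abs_def] using tendsto_real_sqrt[OF tendsto_add[OF tendsto_power[OF l1, of 2] tendsto_const, of D]] by simp
  have l3: "(f3 \<longlongrightarrow> z3) (at_right 0)"
    unfolding f3_def[abs_def] using tendsto_diff[OF tendsto_const l2, of "z2 + z3"] by simp
  have z30: "sqrt (z3\<^sup>2 - D) = - z0" using eqs(2) sgn(1) by simp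
  then have l0: "(f0 \<longlongrightarrow> z0) (at_right 0)"
    unfolding f0_def[abs_def] using tendsto_minus[OF tendsto_real_sqrt[OF tendsto_diff[OF tendsto_power[OF l3, of 2] tendsto_const, of D]]] by simp
  have "z1 < f1 s \<and> z2 < f2 s \<and> f3 s < z3 \<and> f0 s \<le> z0
       \<and> (f2 s)\<^sup>2 = (f1 s)\<^sup>2 + D \<and> (f3 s)\<^sup>2 = (f0 s)\<^sup>2 + D \<and> f2 s + f3 s = z2 + z3" if s: "0 < s" for s
  proof -
    have 1: "z1 < f1 s" using s by (simp add: f1_def)
    have "z1\<^sup>2 < (f1 s)\<^sup>2" using 1 sgn by (intro power_strict_mono) auto
    then have "z2\<^sup>2 < (f1 s)\<^sup>2 + D" using eqs(1) by simp
    then have 2: "z2 < f2 s" unfolding f2_def by (rule real_less_rsqrt)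
    have "0 \<le> (f1 s)\<^sup>2 + D" using \<open>z2\<^sup>2 < (f1 s)\<^sup>2 + D\<close> zero_le_power2[of z2] by linarith
    then have sq2: "(f2 s)\<^sup>2 = (f1 s)\<^sup>2 + D" by (simp add: f2_def)
    have 3: "f3 s < z3" using 2 by (simp add: f3_def)
    then have "(- z3)\<^sup>2 < (- f3 s)\<^sup>2" using sgn by (intro power_strict_mono) auto
    then have lt: "z0\<^sup>2 < (f3 s)\<^sup>2 - D" using eqs(2) by simp
    have "0 \<le> (f3 s)\<^sup>2 - D" using lt zero_le_power2[of z0] by linarith
    then have sq0: "(f3 s)\<^sup>2 = (f0 s)\<^sup>2 + D" by (simp add: f0_def)
    have "- z0 \<le> sqrt ((f3 s)\<^sup>2 - D)" using lt by (intro real_le_rsqrt) simp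
    then have "f0 s \<le> z0" by (simp add: f0_def)
    with 1 2 3 sq2 sq0 show ?thesis by (simp add: f3_def)
  qed
  with l0 l1 l2 l3 show ?thesis by (rule that)
qed

text \<open>
  The previous family after exchange of the two sides and change of signs.
\<close>

lemma right_free_family:
  fixes z0 z1 z2 z3 D :: real
  assumes sgn: "z0 \<le> 0" "0 \<le> z1" "0 \<le> z2" "z3 \<le> 0" and eqs: "z2\<^sup>2 = z1\<^sup>2 + D" "z3\<^sup>2 = z0\<^sup>2 + D"
  obtains f0 f1 f2 f3 :: "real \<Rightarrow> real" where
    "(f0 \<longlongrightarrow> z0) (at_right 0)" "(f1 \<longlongrightarrow> z1) (at_right 0)" "(f2 \<longlongrightarrow> z2) (at_right 0)" "(f3 \<longlongrightarrow> z3) (at_right 0)"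
    "\<And>s. 0 < s \<Longrightarrow> z1 < f1 s \<and> z2 \<le> f2 s \<and> f3 s < z3 \<and> f0 s \<le> z0
       \<and> (f2 s)\<^sup>2 = (f1 s)\<^sup>2 + D \<and> (f3 s)\<^sup>2 = (f0 s)\<^sup>2 + D \<and> f0 s + f1 s = z0 + z1"
proof -
  obtain h2 h3 h0 h1 :: "real \<Rightarrow> real" where h:
    "(h2 \<longlongrightarrow> - z2) (at_right 0)" "(h3 \<longlongrightarrow> - z3) (at_right 0)" "(h0 \<longlongrightarrow> - z0) (at_right 0)" "(h1 \<longlongrightarrow> - z1) (at_right 0)"
    "\<And>s. 0 < s \<Longrightarrow> - z3 < h3 s \<and> - z0 < h0 s \<and> h1 s < - z1 \<and> h2 s \<le> - z2
       \<and> (h0 s)\<^sup>2 = (h3 s)\<^sup>2 + - D \<and> (h1 s)\<^sup>2 = (h2 s)\<^sup>2 + - D \<and> h0 s + h1 s = - z0 + - z1"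
    by (rule left_free_family[of "- z2" "- z3" "- z0" "- z1" "- D"]) (use sgn eqs in auto)
  show ?thesis
  proof (rule that[of "\<lambda>s. - h0 s" "\<lambda>s. - h1 s" "\<lambda>s. - h2 s" "\<lambda>s. - h3 s"])
    show "z1 < - h1 s \<and> z2 \<le> - h2 s \<and> - h3 s < z3 \<and> - h0 s \<le> z0
       \<and> (- h2 s)\<^sup>2 = (- h1 s)\<^sup>2 + D \<and> (- h3 s)\<^sup>2 = (- h0 s)\<^sup>2 + D \<and> - h0 s + - h1 s = z0 + z1" if "0 < s" for s
      using h(5)[OF that] by auto
  qed (use tendsto_minus[OF h(1)] tendsto_minus[OF h(2)] tendsto_minus[OF h(3)] tendsto_minus[OF h(4)] in simp_all)
qed

text \<open>
  Eliminating \<open>z0\<close>, \<open>z3\<close> and \<open>D\<close> leaves a linear relation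
  between \<open>z1\<close> and \<open>z2\<close>, in addition to the equation of the hyperbola
  \<open>z2\<^sup>2 = z1\<^sup>2 + D\<close>. In the coordinates
  \<open>u = 2 z1 - cL\<close> and \<open>w = 2 z2 - cR\<close>, where \<open>cL\<close>
  and \<open>cR\<close> are the two sums, the relation is \<open>cR w = cL u\<close>, a line
  through the centre of the hyperbola \<open>w\<^sup>2 - u\<^sup>2 = const\<close>. For
  \<open>cL \<noteq> 0\<close> it meets the branch \<open>w \<ge> 0\<close> twice only if it
  is an asymptote and the hyperbola degenerates, and the signs exclude the asymptote with
  \<open>cL = - cR\<close>.
\<close>

lemma two_solutions_symmetric:
  fixes z0 z1 z2 z3 y0 y1 y2 y3 D :: real
  assumes z: "z0 \<le> 0" "0 \<le> z1" "0 \<le> z2" "z3 \<le> 0" "z2\<^sup>2 = z1\<^sup>2 + D" "z3\<^sup>2 = z0\<^sup>2 + D"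
    and y: "y0 \<le> 0" "0 \<le> y1" "0 \<le> y2" "y3 \<le> 0" "y2\<^sup>2 = y1\<^sup>2 + D" "y3\<^sup>2 = y0\<^sup>2 + D"
    and sums: "z0 + z1 = y0 + y1" "z2 + z3 = y2 + y3" and ne: "z1 \<noteq> y1"
  shows "(z0 + z1 = 0 \<and> z2 + z3 = 0) \<or> (z0 + z1 = z2 + z3 \<and> D = 0)"
proof -
  define cL cR where "cL = z0 + z1" and "cR = z2 + z3"
  have z0: "z0 = cL - z1" and z3: "z3 = cR - z2" and y0: "y0 = cL - y1" and y3: "y3 = cR - y2"
    using sums by (simp_all add: cL_def cR_def)
  have Az: "cR * (2 * z2 - cR) = cL * (2 * z1 - cL)"
    using z(5,6) unfolding z0 z3 by (simp add: power2_eq_square algebra_simps)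
  have Ay: "cR * (2 * y2 - cR) = cL * (2 * y1 - cL)"
    using y(5,6) unfolding y0 y3 by (simp add: power2_eq_square algebra_simps)
  have B: "cR * (z2 - y2) = cL * (z1 - y1)" using Az Ay by (simp add: algebra_simps)
  have C: "(z2 - y2) * (z2 + y2) = (z1 - y1) * (z1 + y1)"
    using z(5) y(5) by (simp add: power2_eq_square algebra_simps)
  have p1: "0 < z1 + y1" using z(2) y(2) ne by linarith
  have ne2: "z2 \<noteq> y2" using C p1 ne by auto
  have p2: "0 < z2 + y2" using z(3) y(3) ne2 by linarith
  show ?thesis
  proof (cases "cL = 0")
    case True
    then have "cR = 0" using B ne2 by simp
    then show ?thesis using True by (simp add: cL_def cR_def)
  next
    case False
    define u w u' w' where "u = 2 * z1 - cL" and "w = 2 * z2 - cR" and "u' = 2 * y1 - cL" and "w' = 2 * y2 - cR"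
    have wu: "cR * w = cL * u" "cR * w' = cL * u'" using Az Ay by (simp_all add: u_def w_def u'_def w'_def)
    have wpos: "0 \<le> w" "0 \<le> w'" "w \<noteq> w'" using z3 z(3,4) y3 y(3,4) ne2 by (auto simp: w_def w'_def)
    have K: "w\<^sup>2 - u\<^sup>2 = 4 * D + cL\<^sup>2 - cR\<^sup>2" "w'\<^sup>2 - u'\<^sup>2 = 4 * D + cL\<^sup>2 - cR\<^sup>2"
    proof -
      have "w\<^sup>2 - u\<^sup>2 = 4 * (z2\<^sup>2 - z1\<^sup>2) + cR\<^sup>2 - cL\<^sup>2 - 4 * cR * z2 + 4 * cL * z1"
        by (simp add: u_def w_def power2_eq_square algebra_simps)
      moreover have "4 * cR * z2 - 4 * cL * z1 = 2 * cR\<^sup>2 - 2 * cL\<^sup>2"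
        using Az by (simp add: power2_eq_square algebra_simps)
      ultimately show "w\<^sup>2 - u\<^sup>2 = 4 * D + cL\<^sup>2 - cR\<^sup>2" using z(5) by simp
      have "w'\<^sup>2 - u'\<^sup>2 = 4 * (y2\<^sup>2 - y1\<^sup>2) + cR\<^sup>2 - cL\<^sup>2 - 4 * cR * y2 + 4 * cL * y1"
        by (simp add: u'_def w'_def power2_eq_square algebra_simps)
      moreover have "4 * cR * y2 - 4 * cL * y1 = 2 * cR\<^sup>2 - 2 * cL\<^sup>2"
        using Ay by (simp add: power2_eq_square algebra_simps)
      ultimately show "w'\<^sup>2 - u'\<^sup>2 = 4 * D + cL\<^sup>2 - cR\<^sup>2" using y(5) by simp
    qed
    have sq: "cR\<^sup>2 * w\<^sup>2 = cL\<^sup>2 * u\<^sup>2" "cR\<^sup>2 * w'\<^sup>2 = cL\<^sup>2 * u'\<^sup>2"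
      using wu by (metis power_mult_distrib)+
    have "(cL\<^sup>2 - cR\<^sup>2) * w\<^sup>2 = cL\<^sup>2 * (w\<^sup>2 - u\<^sup>2)" "(cL\<^sup>2 - cR\<^sup>2) * w'\<^sup>2 = cL\<^sup>2 * (w'\<^sup>2 - u'\<^sup>2)"
      using sq by (simp_all add: algebra_simps)
    then have "(cL\<^sup>2 - cR\<^sup>2) * (w\<^sup>2 - w'\<^sup>2) = 0" using K by (simp add: algebra_simps)
    moreover have "w\<^sup>2 \<noteq> w'\<^sup>2" using wpos by (metis power2_eq_imp_eq)
    ultimately have "cL\<^sup>2 = cR\<^sup>2" by simp
    then have "cL = cR \<or> cL = - cR" by (simp add: power2_eq_iff)
    moreover have "cL \<noteq> - cR"
    proof
      assume "cL = - cR"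
      then have "cR * ((z2 - y2) + (z1 - y1)) = 0" using B by (simp add: algebra_simps)
      then have "(z2 - y2) + (z1 - y1) = 0" using False \<open>cL = - cR\<close> by (simp only: mult_eq_0_iff neg_equal_0_iff_equal) simp
      then have "z2 - y2 = - (z1 - y1)" by simp
      then have "- (z1 - y1) * (z2 + y2) = (z1 - y1) * (z1 + y1)" using C by (simp only:)
      then have "(z1 - y1) * ((z2 + y2) + (z1 + y1)) = 0"
        by (metis add.right_inverse distrib_left mult_minus_left)
      then show False using p1 p2 ne by simp
    qed
    ultimately have c: "cL = cR" by blast
    then have "w = u" using wu(1) False by simp
    then have "D = 0" using K(1) c by simp
    then show ?thesis using c by (simp add: cL_def cR_def)
  qed
qed

text \<open>
  In the symmetric cases the condition on the left sum follows from the condition on the right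
  sum.
\<close>

lemma symmetric_family:
  fixes z0 z1 z2 z3 D :: real
  assumes sgn: "z0 \<le> 0" "0 \<le> z1" "0 \<le> z2" "z3 \<le> 0" and eqs: "z2\<^sup>2 = z1\<^sup>2 + D" "z3\<^sup>2 = z0\<^sup>2 + D"
    and sym: "(z0 + z1 = 0 \<and> z2 + z3 = 0) \<or> (z0 + z1 = z2 + z3 \<and> D = 0)"
  obtains f0 f1 f2 f3 :: "real \<Rightarrow> real" where
    "(f0 \<longlongrightarrow> z0) (at_right 0)" "(f1 \<longlongrightarrow> z1) (at_right 0)" "(f2 \<longlongrightarrow> z2) (at_right 0)" "(f3 \<longlongrightarrow> z3) (at_right 0)"
    "\<And>s. 0 < s \<Longrightarrow> z1 < f1 s \<and> z2 \<le> f2 s \<and> f3 s < z3 \<and> f0 s \<le> z0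
       \<and> (f2 s)\<^sup>2 = (f1 s)\<^sup>2 + D \<and> (f3 s)\<^sup>2 = (f0 s)\<^sup>2 + D \<and> f0 s + f1 s = z0 + z1 \<and> f2 s + f3 s = z2 + z3"
proof -
  obtain f0 f1 f2 f3 :: "real \<Rightarrow> real" where f:
    "(f0 \<longlongrightarrow> z0) (at_right 0)" "(f1 \<longlongrightarrow> z1) (at_right 0)" "(f2 \<longlongrightarrow> z2) (at_right 0)" "(f3 \<longlongrightarrow> z3) (at_right 0)"
    "\<And>s. 0 < s \<Longrightarrow> z1 < f1 s \<and> z2 < f2 s \<and> f3 s < z3 \<and> f0 s \<le> z0
       \<and> (f2 s)\<^sup>2 = (f1 s)\<^sup>2 + D \<and> (f3 s)\<^sup>2 = (f0 s)\<^sup>2 + D \<and> f2 s + f3 s = z2 + z3"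
    by (rule left_free_family[OF sgn eqs]) (rule that)
  have "f0 s + f1 s = z0 + z1" if s: "0 < s" for s
  proof -
    note F = f(5)[OF s]
    from sym show ?thesis
    proof
      assume c: "z0 + z1 = 0 \<and> z2 + z3 = 0"
      then have "f3 s = - f2 s" using F by simp
      then have "(f1 s)\<^sup>2 = (- f0 s)\<^sup>2" using F by simp
      then have "f1 s = - f0 s" by (rule power2_eq_imp_eq) (use F sgn in auto)
      then show ?thesis using c by simp
    next
      assume c: "z0 + z1 = z2 + z3 \<and> D = 0"
      then have "(f2 s)\<^sup>2 = (f1 s)\<^sup>2" "(- f3 s)\<^sup>2 = (- f0 s)\<^sup>2" using F by simp_all
      have "f2 s = f1 s" by (rule power2_eq_imp_eq[OF \<open>(f2 s)\<^sup>2 = (f1 s)\<^sup>2\<close>]) (use F sgn in auto)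
      moreover have "- f3 s = - f0 s" by (rule power2_eq_imp_eq[OF \<open>(- f3 s)\<^sup>2 = (- f0 s)\<^sup>2\<close>]) (use F sgn in auto)
      ultimately show ?thesis using F c by simp
    qed
  qed
  with f(5) have "\<And>s. 0 < s \<Longrightarrow> z1 < f1 s \<and> z2 \<le> f2 s \<and> f3 s < z3 \<and> f0 s \<le> z0
       \<and> (f2 s)\<^sup>2 = (f1 s)\<^sup>2 + D \<and> (f3 s)\<^sup>2 = (f0 s)\<^sup>2 + D \<and> f0 s + f1 s = z0 + z1 \<and> f2 s + f3 s = z2 + z3"
    by (meson less_imp_le)
  with f(1-4) show ?thesis by (rule that)
qed

lemma three_zone_velocities:
  assumes Y: "hfield Y" and lr: "lL < lR" and cyc: "three_zone_cycle v lL lR X Y Z p0 p1 p2 p3 Ta Tb Tc Td"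
    and D: "D = disc Y * ((lR - v \<bullet> centre Y)\<^sup>2 - (lL - v \<bullet> centre Y)\<^sup>2)"
  shows "v \<bullet> Y p0 \<le> 0" "0 \<le> v \<bullet> Y p1" "0 \<le> v \<bullet> Y p2" "v \<bullet> Y p3 \<le> 0"
    "(v \<bullet> Y p2)\<^sup>2 = (v \<bullet> Y p1)\<^sup>2 + D" "(v \<bullet> Y p3)\<^sup>2 = (v \<bullet> Y p0)\<^sup>2 + D"
proof -
  have c1: "cross v lL lR Y p1 Ta" "flow Y Ta p1 = p2" and c3: "cross (- v) (- lR) (- lL) Y p3 Tc" "flow Y Tc p3 = p0"
    using cyc unfolding three_zone_cycle_def by blast+
  have lr': "- lR < - lL" using lr by simp
  show "0 \<le> v \<bullet> Y p1" "0 \<le> v \<bullet> Y p2" using cross_velocity(2,3)[OF Y lr c1(1)] c1(2) by simp_all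
  show "v \<bullet> Y p0 \<le> 0" "v \<bullet> Y p3 \<le> 0" using cross_velocity(2,3)[OF Y lr' c3(1)] c3(2) by simp_all
  show "(v \<bullet> Y p2)\<^sup>2 = (v \<bullet> Y p1)\<^sup>2 + D" using cross_end_velocity[OF Y c1(1)] c1(2) D by simp
  show "(v \<bullet> Y p3)\<^sup>2 = (v \<bullet> Y p0)\<^sup>2 + D"
    using cross_end_velocity[OF Y c3(1)] c3(2) power2_commute[of "v \<bullet> centre Y" lL] power2_commute[of "v \<bullet> centre Y" lR]
    unfolding D by (simp add: right_diff_distrib)
qed

section \<open>Periodic curves turn once\<close>

context cycle
begin

text \<open>
  The gap that starts at the top end of the left line reaches the right line, since it has at
  least the energy of some crossing, whereas an excursion into the strip has less. Every point at
  which the curve arrives at the right line from the strip has at most the energy, and so at most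
  the velocity, of the end of this crossing. As links are nested, the link that starts there ends
  at the top end of the right line.
\<close>

lemma half_turn:
  assumes nd: "nondeg v XC" and top: "top_end v lL XC g e1" and w: "v \<bullet> g w = lR"
  obtains s2 e2 where "Cgap e1 s2" "v \<bullet> g e1 = lL" "v \<bullet> g s2 = lR" "Rlink s2 e2" "top_end (- v) (- lR) XC g e2"
proof -
  interpret M: cycle "- v" "- lR" "- lL" XR XC XL g T by (rule mirror)
  obtain s1 where l1: "Llink s1 e1" using top unfolding top_end_def by blast
  have max: "v \<bullet> XC (g e) \<le> v \<bullet> XC (g e1)" if "Llink s e" for s e using top that unfolding top_end_def by blast
  note E1 = link_ends[OF l1]
  obtain u where u: "u \<in> {e1..e1 + T}" "v \<bullet> g u = lR" using range_g[of e1] w by (metis imageE rangeI)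
  have "e1 \<le> u" using u(1) by simp
  then obtain a b where c: "Cgap a b" and xa: "v \<bullet> g a = lL" and xb: "v \<bullet> g b = lR"
    by (rule passage_across[OF _ E1(3) u(2)])
  have xe1: "v \<bullet> g e1 = lL" by (rule E1(3))
  obtain s2 where c1: "Cgap e1 s2" using E1(6) by blast
  have x1: "cross v lL lR XC (g a) (b - a)" by (rule gap_cross(1)[OF c xa xb])
  have za: "0 \<le> v \<bullet> XC (g a)" by (rule gap_cross(3)[OF c xa xb])
  have "v \<bullet> XC (g a) \<le> v \<bullet> XC (g e1)" using link_before_gap[OF c xa] max by blast
  then have "(v \<bullet> XC (g a))\<^sup>2 \<le> (v \<bullet> XC (g e1))\<^sup>2" using za by (intro power_mono) auto
  then have en: "energy v XC (g a) \<le> energy v XC (g e1)" unfolding energy_def using xa xe1 by simp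
  have xs2: "v \<bullet> g s2 = lR"
  proof (rule ccontr)
    assume "v \<bullet> g s2 \<noteq> lR"
    then have x: "v \<bullet> g s2 = lL" using c1 unfolding strip_gap_def walls_def by auto
    note e = gap_exc_left(1)[OF c1 xe1 x]
    have "- lR < - v \<bullet> flow XC t (g e1)" if "0 < t" "t < s2 - e1" for t
    proof -
      have "e1 + t \<in> {e1<..<s2}" using that by simp
      then have "v \<bullet> g (e1 + t) < lR" using c1 unfolding strip_gap_def by blast
      then show ?thesis using strip_gap_flow[OF c1, of "e1 + t"] that by simp
    qed
    from exc_energy_less_cross[OF hC e this, of "g a" "b - a"] x1 en show False by simp
  qed
  have c1': "strip_gap (- v) (- lR) (- lL) g e1 s2" using c1 by simp
  obtain e2 where l2: "Rlink s2 e2" using M.link_after_gap[OF c1'] xs2 by auto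
  have z2: "0 \<le> v \<bullet> XC (g s2)" by (rule gap_cross(4)[OF c1 xe1 xs2])
  \<comment> \<open>the passage starting at the top end is the outermost one\<close>
  have maxR: "v \<bullet> XC (g s) \<le> v \<bullet> XC (g s2)" if l: "Rlink s e" for s e
  proof -
    note E = M.link_ends[OF l]
    obtain a where a: "Cgap a s" using E(7) by auto
    have xs: "v \<bullet> g s = lR" using E(2) by simp
    have zs: "0 \<le> v \<bullet> XC (g s)" using M.link_velocity(1)[OF l] by simp
    have "energy v XC (g a) \<le> energy v XC (g e1)"
    proof (cases "v \<bullet> g a = lL")
      case True
      have z: "0 \<le> v \<bullet> XC (g a)" by (rule gap_cross(3)[OF a True xs])
      have "v \<bullet> XC (g a) \<le> v \<bullet> XC (g e1)" using link_before_gap[OF a True] max by blast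
      then have "(v \<bullet> XC (g a))\<^sup>2 \<le> (v \<bullet> XC (g e1))\<^sup>2" using z by (intro power_mono) auto
      then show ?thesis unfolding energy_def using True xe1 by simp
    next
      case False
      then have xa: "- v \<bullet> g a = - lR" using a unfolding strip_gap_def walls_def by auto
      have a': "strip_gap (- v) (- lR) (- lL) g a s" using a by simp
      have e: "exc v lR XC (g a) (s - a)" using M.gap_exc_left(1)[OF a' xa E(2)] by simp
      have "lL < v \<bullet> flow XC t (g a)" if "0 < t" "t < s - a" for t
      proof -
        have "a + t \<in> {a<..<s}" using that by simp
        then have "lL < v \<bullet> g (a + t)" using a unfolding strip_gap_def by blast
        then show ?thesis using strip_gap_flow[OF a, of "a + t"] that by simp
      qed
      from exc_energy_less_cross[OF hC e this, of "g e1" "s2 - e1"] gap_cross(1)[OF c1 xe1 xs2] show ?thesis by simp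
    qed
    then have "energy v XC (g s) \<le> energy v XC (g s2)" using gap_energy[OF a] gap_energy[OF c1] by simp
    then have "(v \<bullet> XC (g s))\<^sup>2 \<le> (v \<bullet> XC (g s2))\<^sup>2" unfolding energy_def using xs xs2 by simp
    then show ?thesis using z2 by (rule power2_le_imp_le)
  qed
  have ndM: "nondeg (- v) XC" using nd by simp
  have "- v \<bullet> XC (g e) \<le> - v \<bullet> XC (g e2)" if l: "Rlink s e" for s e
  proof (rule ccontr)
    assume "\<not> ?thesis"
    then have lt: "- v \<bullet> XC (g e2) < - v \<bullet> XC (g e)" by simp
    have "- v \<bullet> XC (g s2) \<le> - v \<bullet> XC (g s)" using maxR[OF l] by simp
    from M.links_nested(2)[OF ndM l l2 this] lt show False by simp
  qed
  then have "top_end (- v) (- lR) XC g e2" unfolding top_end_def using l2 by blast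
  with c1 xe1 xs2 l2 show ?thesis by (rule that)
qed

text \<open>
  Two half turns lead from the top end of the left line to an end with the same velocity, hence to
  the same point.
\<close>

lemma three_zone_structure:
  assumes nd: "nondeg v XC" and wL: "v \<bullet> g wL = lL" and wR: "v \<bullet> g wR = lR"
  obtains e1 s2 e2 s3 where "Cgap e1 s2" "v \<bullet> g e1 = lL" "v \<bullet> g s2 = lR" "Rlink s2 e2" "Cgap e2 s3"
    "v \<bullet> g e2 = lR" "v \<bullet> g s3 = lL" "Llink s3 (e1 + T)"
proof -
  interpret M: cycle "- v" "- lR" "- lL" XR XC XL g T by (rule mirror)
  obtain e1 where t1: "top_end v lL XC g e1" using top_end_exists[OF nd wL, of wR] wR lr by auto
  obtain s2 e2 where c1: "Cgap e1 s2" "v \<bullet> g e1 = lL" "v \<bullet> g s2 = lR" and l2: "Rlink s2 e2" and t2: "top_end (- v) (- lR) XC g e2"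
    by (rule half_turn[OF nd t1 wR])
  have "nondeg (- v) XC" "- v \<bullet> g wL = - lL" using nd wL by simp_all
  then obtain s3 e3 where c2: "strip_gap (- v) (- lR) (- lL) g e2 s3" "- v \<bullet> g e2 = - lR" "- v \<bullet> g s3 = - lL"
    and l3: "is_link (- (- v)) (- (- lL)) g s3 e3" and t3: "top_end (- (- v)) (- (- lL)) XC g e3"
    by (rule M.half_turn[OF _ t2])
  have l3': "Llink s3 e3" and t3': "top_end v lL XC g e3" and c2': "Cgap e2 s3" using l3 t3 c2(1) by simp_all
  obtain s1 where l1: "Llink s1 e1" using t1 unfolding top_end_def by blast
  have "v \<bullet> XC (g e3) = v \<bullet> XC (g e1)" using t1 t3' l1 l3' unfolding top_end_def by (meson antisym)
  then have "g e1 = g e3" using nondegD[OF nd] link_ends(3)[OF l3'] c1(2) by simp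
  have o: "e1 < s2" "s2 \<le> e2" "e2 < s3"
    using c1(1) c2' M.link_ends(1)[OF l2] unfolding strip_gap_def by auto
  have x: "v \<bullet> g (e1 + T) = lL" using per c1(2) by simp
  have "\<not> e1 + T < s2" using c1(1) x T unfolding strip_gap_def by force
  moreover have "\<not> (s2 \<le> e1 + T \<and> e1 + T \<le> e2)" using M.link_ends(5)[OF l2, of "e1 + T"] x lr by auto
  moreover have "\<not> (e2 < e1 + T \<and> e1 + T < s3)" using c2' x unfolding strip_gap_def by force
  ultimately have "\<not> e1 + T < s3" by linarith
  then have "e3 = e1 + T" by (rule closing_link[OF l1 l3' \<open>g e1 = g e3\<close>, rotated]) (use o in simp)
  with c1 l2 c2' c2(2,3) l3' that show ?thesis by simp
qed

text \<open>
  All gaps start and end on the left line, with opposite velocities. So the gap from the top end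
  leads to a link that starts no higher than the link of the top end itself, and as links are
  nested it ends at the same point.
\<close>

lemma two_zone_structure:
  assumes nd: "nondeg v XC" and wL: "v \<bullet> g wL = lL" and w': "lL < v \<bullet> g w'" and nR: "\<And>t. v \<bullet> g t \<noteq> lR"
  obtains e1 s2 where "Cgap e1 s2" "v \<bullet> g e1 = lL" "v \<bullet> g s2 = lL" "Llink s2 (e1 + T)"
proof -
  obtain e1 where t1: "top_end v lL XC g e1" using top_end_exists[OF nd wL w'] by blast
  obtain s1 where l1: "Llink s1 e1" using t1 unfolding top_end_def by blast
  have max: "v \<bullet> XC (g e) \<le> v \<bullet> XC (g e1)" if "Llink s e" for s e using t1 that unfolding top_end_def by blast
  note E1 = link_ends[OF l1]
  have ends: "v \<bullet> g a = lL" "v \<bullet> g b = lL" if "Cgap a b" for a b using that nR unfolding strip_gap_def walls_def by auto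
  obtain s2 where c1: "Cgap e1 s2" using E1(6) by blast
  obtain a where a: "Cgap a s1" using E1(7) by blast
  obtain e2 where l2: "Llink s2 e2" using link_after_gap[OF c1 ends(2)[OF c1]] by blast
  obtain sa where "Llink sa a" using link_before_gap[OF a ends(1)[OF a]] by blast
  then have "v \<bullet> XC (g a) \<le> v \<bullet> XC (g e1)" by (rule max)
  then have "v \<bullet> XC (g s2) \<le> v \<bullet> XC (g s1)"
    using gap_exc_left(4)[OF c1 ends[OF c1]] gap_exc_left(4)[OF a ends[OF a]] by simp
  from links_nested(2)[OF nd l1 l2 this max[OF l2]] have eq: "g e1 = g e2" by simp
  have less: "e1 < s2" using c1 unfolding strip_gap_def by simp
  have "v \<bullet> g (e1 + T) = lL" using per ends(1)[OF c1] by simp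
  then have "\<not> e1 + T < s2" using c1 T unfolding strip_gap_def by force
  then have "e2 = e1 + T" by (rule closing_link[OF l1 l2 eq less])
  with c1 ends[OF c1] l2 that show ?thesis by simp
qed

end

section \<open>The possible shapes of an isolated curve\<close>

context cycle
begin

lemma orbit_of_arc:
  assumes "a \<le> b" "\<And>t. t \<in> {a..b} \<Longrightarrow> g t = flow X (t - a) (g a)"
  shows "g ` {a..b} = orbit X (g a) (b - a)"
proof
  show "g ` {a..b} \<subseteq> orbit X (g a) (b - a)"
  proof
    fix p assume "p \<in> g ` {a..b}"
    then obtain t where t: "t \<in> {a..b}" "p = g t" by blast
    then have "p = flow X (t - a) (g a)" using assms(2)[OF t(1)] by simp
    moreover have "t - a \<in> {0..b - a}" using t(1) by simp
    ultimately have "p = flow X (t - a) (g a) \<and> t - a \<in> {0..b - a}" by blast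
    then show "p \<in> orbit X (g a) (b - a)" unfolding orbit_def by blast
  qed
  show "orbit X (g a) (b - a) \<subseteq> g ` {a..b}"
  proof
    fix p assume "p \<in> orbit X (g a) (b - a)"
    then obtain t where t: "t \<in> {0..b - a}" "p = flow X t (g a)" unfolding orbit_def by blast
    then have "a + t \<in> {a..b}" by simp
    moreover from assms(2)[OF this] have "g (a + t) = p" using t(2) by simp
    ultimately have "a + t \<in> {a..b} \<and> g (a + t) = p" by blast
    then show "p \<in> g ` {a..b}" by blast
  qed
qed

lemma closed_flow_not_isolated:
  assumes X: "hfield X" and fl: "\<And>t. t \<in> {a..a + T} \<Longrightarrow> g t = flow X (t - a) (g a)"
    and I: "is_interval (I :: real set)" "\<And>t. v \<bullet> g t \<in> I"
    and adm: "\<And>S. (\<forall>q\<in>S. v \<bullet> q \<in> I) \<Longrightarrow> adm X S"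
  shows "\<not> isolated_loop adm (range g)"
proof -
  have eq: "flow X t (g a) = g (a + t)" if "t \<in> {0..T}" for t using fl[of "a + t"] that by simp
  have "\<not> isolated_loop adm (orbit X (g a) T)"
  proof (rule closed_orbit_not_isolated[OF X T _ _ I(1)])
    show "flow X T (g a) = g a" using eq[of T] per T by simp
    show "\<forall>t\<in>{0<..<T}. flow X t (g a) \<noteq> g a"
    proof
      fix t assume t: "t \<in> {0<..<T}"
      then show "flow X t (g a) \<noteq> g a" using eq[of t] g_neq[of a "a + t"] by auto
    qed
    show "\<forall>t\<in>{0..T}. v \<bullet> flow X t (g a) \<in> I" using eq I(2) by simp
  qed (rule adm)
  moreover have "range g = orbit X (g a) T"
    using range_g[of a] orbit_of_arc[of a "a + T" X, OF _ fl] T by simp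
  ultimately show ?thesis by simp
qed

lemma strip_gap_strict: "Cgap a b \<Longrightarrow> a < t \<Longrightarrow> t < b \<Longrightarrow> lL < v \<bullet> g t \<and> v \<bullet> g t < lR"
  unfolding strip_gap_def by simp

lemma strip_gap_le: "Cgap a b \<Longrightarrow> t \<in> {a..b} \<Longrightarrow> lL \<le> v \<bullet> g t \<and> v \<bullet> g t \<le> lR"
proof -
  assume c: "Cgap a b" and t: "t \<in> {a..b}"
  then consider "t = a" | "t = b" | "t \<in> {a<..<b}" by fastforce
  then show ?thesis using c lr unfolding strip_gap_def walls_def by cases (auto intro: less_imp_le)
qed

text \<open>
  The second premise on \<open>XL\<close> says that this field is needed on the line only, if the
  curve does not enter the open left half plane.
\<close>

lemma link_turn_not_isolated:
  assumes nd: "nondeg v XC" and ab: "a < b" "b < a + T" and lk: "Llink b (a + T)"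
    and x: "v \<bullet> g a = lL" "\<And>t. a < t \<Longrightarrow> t < b \<Longrightarrow> lL < v \<bullet> g t \<and> v \<bullet> g t \<le> lR"
    and fl: "\<And>t. t \<in> {a..b} \<Longrightarrow> g t = flow XC (t - a) (g a)"
    and admL: "\<And>A. \<forall>r\<in>A. v \<bullet> r \<le> lL \<Longrightarrow> ((\<And>t. lL \<le> v \<bullet> g t) \<Longrightarrow> \<forall>r\<in>A. v \<bullet> r = lL) \<Longrightarrow> adm XL A"
    and admC: "\<And>A. \<forall>r\<in>A. lL \<le> v \<bullet> r \<and> v \<bullet> r \<le> lR \<Longrightarrow> adm XC A"
  shows "\<not> isolated_loop adm (range g)"
proof -
  note E = link_ends[OF lk] and S = link_structure[OF nd lk ab(2)]
  have fb: "flow XC (b - a) (g a) = g b" using fl[of b] ab by simp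
  have gT: "g (a + T) = g a" by (rule per)
  have fe: "flow XC t (g a) = g (a + t)" if "t \<in> {0..b - a}" for t using fl[of "a + t"] that by simp
  have turn: "exc (- v) (- lL) XC (g a) (b - a)"
    unfolding exc_def using x(1) E(2) fb ab(1) fe x(2) by simp
  have "\<not> isolated_loop adm (orbit XL (g b) (a + T - b) \<union> orbit XC (g a) (b - a))"
  proof (rule two_zone_not_isolated[OF hL hC v nd S(2) _ turn fb])
    show "flow XL (a + T - b) (g b) = g a" using S(1) gT by simp
    show "\<forall>t\<in>{0..b - a}. v \<bullet> flow XC t (g a) \<le> lR"
    proof
      fix t assume t: "t \<in> {0..b - a}"
      then consider "t = 0" | "t = b - a" | "a < a + t" "a + t < b" by fastforce
      then show "v \<bullet> flow XC t (g a) \<le> lR"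
        using fe[OF t] x(2)[of "a + t"] x(1) E(2) lr by cases simp_all
    qed
    fix A assume A: "\<forall>r\<in>A. v \<bullet> r \<le> lL \<and> (\<not> exc v lL XL (g b) (a + T - b) \<longrightarrow> v \<bullet> r = lL)"
    show "adm XL A"
    proof (rule admL)
      show "\<forall>r\<in>A. v \<bullet> r \<le> lL" using A by blast
      assume ge: "\<And>t. lL \<le> v \<bullet> g t"
      have "\<not> exc v lL XL (g b) (a + T - b)"
      proof
        assume e: "exc v lL XL (g b) (a + T - b)"
        define h where "h = (a + T - b) / 2"
        have h: "h \<in> {0<..<a + T - b}" using ab by (auto simp: h_def)
        then have "v \<bullet> flow XL h (g b) < lL" using e unfolding exc_def by blast
        moreover have "g (b + h) = flow XL h (g b)" using S(3)[of "b + h"] h by simp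
        ultimately show False using ge[of "b + h"] by simp
      qed
      then show "\<forall>r\<in>A. v \<bullet> r = lL" using A by blast
    qed
  qed (rule admC)
  moreover have "range g = orbit XL (g b) (a + T - b) \<union> orbit XC (g a) (b - a)"
  proof -
    have "{a..a + T} = {b..a + T} \<union> {a..b}" using ab by auto
    then have "range g = g ` {b..a + T} \<union> g ` {a..b}" using range_g[of a] by (metis image_Un)
    moreover have "g ` {b..a + T} = orbit XL (g b) (a + T - b)" by (rule orbit_of_arc[OF _ S(3)]) (use ab in auto)
    moreover have "g ` {a..b} = orbit XC (g a) (b - a)" by (rule orbit_of_arc[OF _ fl]) (use ab in auto)
    ultimately show ?thesis by simp
  qed
  ultimately show ?thesis by simp
qed

lemma one_sided_not_isolated:
  assumes nd: "nondeg v XC" and w: "lL < v \<bullet> g w" and nR: "\<And>t. v \<bullet> g t \<noteq> lR" and wR: "v \<bullet> g w < lR"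
    and admL: "\<And>A. \<forall>r\<in>A. v \<bullet> r \<le> lL \<Longrightarrow> ((\<And>t. lL \<le> v \<bullet> g t) \<Longrightarrow> \<forall>r\<in>A. v \<bullet> r = lL) \<Longrightarrow> adm XL A"
    and admC: "\<And>A. \<forall>r\<in>A. lL \<le> v \<bullet> r \<and> v \<bullet> r \<le> lR \<Longrightarrow> adm XC A"
  shows "\<not> isolated_loop adm (range g)"
proof (cases "\<exists>t. v \<bullet> g t = lL")
  case False
  have zone: "lL < v \<bullet> g t \<and> v \<bullet> g t < lR" for t
  proof -
    have "v \<bullet> g t < lL \<longleftrightarrow> v \<bullet> g w < lL" by (rule x_between) (use False in blast)
    moreover have "v \<bullet> g t < lR \<longleftrightarrow> v \<bullet> g w < lR" by (rule x_between) (use nR in blast)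
    ultimately show ?thesis using w wR False by (metis linorder_neqE not_less_iff_gr_or_eq)
  qed
  show ?thesis
  proof (rule closed_flow_not_isolated[OF hC, where I = "{lL..lR}" and a = 0])
    show "g t = flow XC (t - 0) (g 0)" if "t \<in> {0..0 + T}" for t by (rule flow_in_middle[OF zone that])
    show "v \<bullet> g t \<in> {lL..lR}" for t using zone[of t] by simp
  qed (use admC is_interval_cc in auto)
next
  case True
  then obtain wL where wL: "v \<bullet> g wL = lL" by blast
  obtain e s where c: "Cgap e s" and xe: "v \<bullet> g e = lL" and xs: "v \<bullet> g s = lL" and lk: "Llink s (e + T)"
    by (rule two_zone_structure[OF nd wL w nR])
  have es: "e < s" "s \<le> e + T" using c link_ends(1)[OF lk] unfolding strip_gap_def by auto
  show ?thesis
  proof (cases "s = e + T")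
    case True
    have le: "lL \<le> v \<bullet> g t \<and> v \<bullet> g t \<le> lR" for t
    proof -
      obtain u where "u \<in> {e..e + T}" "g t = g u" using range_g[of e] by (metis imageE rangeI)
      then show ?thesis using strip_gap_le[OF c, of u] True by simp
    qed
    show ?thesis
    proof (rule closed_flow_not_isolated[OF hC, where I = "{lL..lR}" and a = e])
      show "g t = flow XC (t - e) (g e)" if "t \<in> {e..e + T}" for t
        using strip_gap_flow[OF c, of t] that True by simp
      show "v \<bullet> g t \<in> {lL..lR}" for t using le[of t] by simp
    qed (use admC is_interval_cc in auto)
  next
    case False
    show ?thesis
    proof (rule link_turn_not_isolated[OF nd es(1) _ lk xe])
      show "s < e + T" using es False by simp
      show "lL < v \<bullet> g t \<and> v \<bullet> g t \<le> lR" if "e < t" "t < s" for t using c that unfolding strip_gap_def by (auto intro: less_imp_le)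
      show "g t = flow XC (t - e) (g e)" if "t \<in> {e..s}" for t by (rule strip_gap_flow[OF c that])
    qed (use admL admC in blast)+
  qed
qed

text \<open>
  If one of the two links is a single point, the two gaps next to it form a single excursion into
  the strip that touches the far line, and the curve is composed of one excursion and one link, or
  is a closed orbit. If one of the links is a glide, one of the two conditions on the sums is
  absent, and the free families apply.
\<close>

lemma isolated_three_zone_cycle:
  assumes nd: "nondeg v XC" and wL: "v \<bullet> g wL = lL" and wR: "v \<bullet> g wR = lR"
    and admL: "\<And>A. \<forall>r\<in>A. v \<bullet> r \<le> lL \<Longrightarrow> adm XL A"
    and admC: "\<And>A. \<forall>r\<in>A. lL \<le> v \<bullet> r \<and> v \<bullet> r \<le> lR \<Longrightarrow> adm XC A"
    and admR: "\<And>A. \<forall>r\<in>A. lR \<le> v \<bullet> r \<Longrightarrow> adm XR A"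
    and iso: "isolated_loop adm (range g)"
  obtains p0 p1 p2 p3 Ta Tb Tc Td where "three_zone_cycle v lL lR XL XC XR p0 p1 p2 p3 Ta Tb Tc Td"
    "exc v lL XL p0 Td" "exc (- v) (- lR) XR p2 Tb"
    "range g = (orbit XC p1 Ta \<union> orbit XR p2 Tb) \<union> (orbit XC p3 Tc \<union> orbit XL p0 Td)"
proof -
  interpret M: cycle "- v" "- lR" "- lL" XR XC XL g T by (rule mirror)
  have ndM: "nondeg (- v) XC" using nd by simp
  obtain e1 s2 e2 s3 where c1: "Cgap e1 s2" and x1: "v \<bullet> g e1 = lL" "v \<bullet> g s2 = lR" and l2: "Rlink s2 e2"
    and c2: "Cgap e2 s3" and x2: "v \<bullet> g e2 = lR" "v \<bullet> g s3 = lL" and l3: "Llink s3 (e1 + T)"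
    by (rule three_zone_structure[OF nd wL wR])
  have o: "e1 < s2" "s2 \<le> e2" "e2 < s3" "s3 \<le> e1 + T"
    using c1 c2 M.link_ends(1)[OF l2] link_ends(1)[OF l3] unfolding strip_gap_def by auto
  have f1: "g t = flow XC (t - e1) (g e1)" if "t \<in> {e1..s2}" for t by (rule strip_gap_flow[OF c1 that])
  have f2: "g t = flow XC (t - e2) (g e2)" if "t \<in> {e2..s3}" for t by (rule strip_gap_flow[OF c2 that])
  have "s2 < e2"
  proof (rule ccontr)
    assume "\<not> s2 < e2"
    then have se: "s2 = e2" using o by simp
    \<comment> \<open>the curve only touches the right line\<close>
    have f12: "g t = flow XC (t - e1) (g e1)" if "t \<in> {e1..s3}" for t
    proof (cases "t \<le> s2")
      case False
      then have "g t = flow XC (t - e2) (flow XC (e2 - e1) (g e1))" using f2[of t] f1[of e2] that se o by simp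
      then show ?thesis by (simp add: flow_add[OF hC, symmetric])
    qed (use f1[of t] that in simp)
    have strip: "lL < v \<bullet> g t \<and> v \<bullet> g t \<le> lR" if t: "e1 < t" "t < s3" for t
    proof -
      consider "t < s2" | "t = s2" | "e2 < t" using se by linarith
      then show ?thesis
      proof cases
        case 1 then show ?thesis using strip_gap_strict[OF c1 t(1)] by simp
      next
        case 2 then show ?thesis using x1 lr by simp
      next
        case 3 then show ?thesis using strip_gap_strict[OF c2 _ t(2)] by simp
      qed
    qed
    show False
    proof (cases "s3 = e1 + T")
      case True
      have le: "lL \<le> v \<bullet> g t \<and> v \<bullet> g t \<le> lR" for t
      proof -
        obtain u where "u \<in> {e1..e1 + T}" "g t = g u" using range_g[of e1] by (metis imageE rangeI)
        then show ?thesis using strip[of u] True x1(1) x2(2) lr by (cases "u = e1 \<or> u = s3") auto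
      qed
      have "\<not> isolated_loop adm (range g)"
      proof (rule closed_flow_not_isolated[OF hC, where I = "{lL..lR}" and a = e1])
        show "g t = flow XC (t - e1) (g e1)" if "t \<in> {e1..e1 + T}" for t using f12[of t] that True by simp
        show "v \<bullet> g t \<in> {lL..lR}" for t using le[of t] by simp
      qed (use admC is_interval_cc in auto)
      then show False using iso by blast
    next
      case False
      have "\<not> isolated_loop adm (range g)"
      proof (rule link_turn_not_isolated[OF nd _ _ l3 x1(1) strip f12])
        show "e1 < s3" "s3 < e1 + T" using o False by simp_all
      qed (use admL admC in blast)+
      then show False using iso by blast
    qed
  qed
  have "s3 < e1 + T"
  proof (rule ccontr)
    assume "\<not> s3 < e1 + T"
    then have se: "s3 = e1 + T" using o by simp
    \<comment> \<open>the curve only touches the left line\<close>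
    have sh: "g t = g (t - T)" for t using per[of "t - T"] by simp
    have f3: "g t = flow XC (t - s3) (g s3)" if "t \<in> {s3..s2 + T}" for t
    proof -
      have "g t = flow XC (t - T - e1) (g e1)" using f1[of "t - T"] sh[of t] that se by simp
      then show ?thesis using sh[of s3] se by (simp add: algebra_simps)
    qed
    have f23: "g t = flow XC (t - e2) (g e2)" if "t \<in> {e2..s2 + T}" for t
    proof (cases "t \<le> s3")
      case False
      then have "g t = flow XC (t - s3) (flow XC (s3 - e2) (g e2))" using f3[of t] f2[of s3] that o by simp
      then show ?thesis by (simp add: flow_add[OF hC, symmetric])
    qed (use f2[of t] that in simp)
    have strip: "- lR < - v \<bullet> g t \<and> - v \<bullet> g t \<le> - lL" if t: "e2 < t" "t < s2 + T" for t
    proof -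
      consider "t < s3" | "t = s3" | "e1 < t - T" using se by linarith
      then show ?thesis
      proof cases
        case 1 then show ?thesis using strip_gap_strict[OF c2 t(1)] by simp
      next
        case 2 then show ?thesis using x2 lr by simp
      next
        case 3 then show ?thesis using strip_gap_strict[OF c1 3] t(2) sh[of t] by simp
      qed
    qed
    have l2': "Rlink (s2 + T) (e2 + T)" using M.link_shift[OF l2, of 1] by simp
    have "\<not> isolated_loop adm (range g)"
    proof (rule M.link_turn_not_isolated[OF ndM _ _ l2' _ strip f23])
      show "e2 < s2 + T" "s2 + T < e2 + T" using M.link_ends(4)[OF l2] \<open>s2 < e2\<close> by simp_all
      show "- v \<bullet> g e2 = - lR" using x2 by simp
      show "adm XR A" if "\<forall>r\<in>A. - v \<bullet> r \<le> - lR" for A by (rule admR) (use that in simp)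
      show "adm XC A" if "\<forall>r\<in>A. - lR \<le> - v \<bullet> r \<and> - v \<bullet> r \<le> - lL" for A by (rule admC) (use that in simp)
    qed
    then show False using iso by blast
  qed
  note S3 = link_structure[OF nd l3 \<open>s3 < e1 + T\<close>] and S2 = M.link_structure[OF ndM l2 \<open>s2 < e2\<close>]
  have c2': "strip_gap (- v) (- lR) (- lL) g e2 s3" using c2 by simp
  have x2': "- v \<bullet> g e2 = - lR" "- v \<bullet> g s3 = - lL" using x2 by simp_all
  note G1 = gap_cross[OF c1 x1] and G2 = M.gap_cross[OF c2' x2']
  have cyc: "three_zone_cycle v lL lR XL XC XR (g s3) (g e1) (g s2) (g e2) (s2 - e1) (e2 - s2) (s3 - e2) (e1 + T - s3)"
    unfolding three_zone_cycle_def using G1(1,2) G2(1,2) S2(1,2) S3(1,2) per by simp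
  have rng: "range g = (orbit XC (g e1) (s2 - e1) \<union> orbit XR (g s2) (e2 - s2)) \<union> (orbit XC (g e2) (s3 - e2) \<union> orbit XL (g s3) (e1 + T - s3))"
  proof -
    have "{e1..e1 + T} = ({e1..s2} \<union> {s2..e2}) \<union> ({e2..s3} \<union> {s3..e1 + T})" using o by auto
    then have "range g = (g ` {e1..s2} \<union> g ` {s2..e2}) \<union> (g ` {e2..s3} \<union> g ` {s3..e1 + T})"
      using range_g[of e1] by (metis image_Un)
    moreover have "g ` {e1..s2} = orbit XC (g e1) (s2 - e1)" by (rule orbit_of_arc[OF _ f1]) (use o in auto)
    moreover have "g ` {s2..e2} = orbit XR (g s2) (e2 - s2)" by (rule orbit_of_arc[OF _ S2(3)]) (use o in auto)
    moreover have "g ` {e2..s3} = orbit XC (g e2) (s3 - e2)" by (rule orbit_of_arc[OF _ f2]) (use o in auto)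
    moreover have "g ` {s3..e1 + T} = orbit XL (g s3) (e1 + T - s3)" by (rule orbit_of_arc[OF _ S3(3)]) (use o in auto)
    ultimately show ?thesis by simp
  qed
  define D where "D = disc XC * ((lR - v \<bullet> centre XC)\<^sup>2 - (lL - v \<bullet> centre XC)\<^sup>2)"
  note V = three_zone_velocities[OF hC lr cyc D_def]
  have noniso: False
    if f: "(f0 \<longlongrightarrow> v \<bullet> XC (g s3)) (at_right 0)" "(f1 \<longlongrightarrow> v \<bullet> XC (g e1)) (at_right 0)"
        "(f2 \<longlongrightarrow> v \<bullet> XC (g s2)) (at_right 0)" "(f3 \<longlongrightarrow> v \<bullet> XC (g e2)) (at_right 0)"
      and F: "\<And>s. 0 < s \<Longrightarrow> v \<bullet> XC (g e1) < f1 s \<and> f3 s < v \<bullet> XC (g e2) \<and> 0 \<le> f2 s \<and> f0 s \<le> 0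
      \<and> (f2 s)\<^sup>2 = (f1 s)\<^sup>2 + D \<and> (f3 s)\<^sup>2 = (f0 s)\<^sup>2 + D
      \<and> (exc v lL XL (g s3) (e1 + T - s3) \<longrightarrow> f0 s + f1 s = v \<bullet> XC (g s3) + v \<bullet> XC (g e1))
      \<and> (exc (- v) (- lR) XR (g s2) (e2 - s2) \<longrightarrow> f2 s + f3 s = v \<bullet> XC (g s2) + v \<bullet> XC (g e2))"
    for f0 f1 f2 f3 :: "real \<Rightarrow> real"
  proof -
    have "\<not> isolated_loop adm (range g)"
      unfolding rng
    proof (rule three_zone_not_isolated[OF hL hC hR v lr nd cyc D_def f])
      fix s :: real assume "0 < s"
      then show "v \<bullet> XC (g e1) < f1 s \<and> f3 s < v \<bullet> XC (g e2) \<and> 0 \<le> f2 s \<and> f0 s \<le> 0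
          \<and> (f2 s)\<^sup>2 = (f1 s)\<^sup>2 + D \<and> (f3 s)\<^sup>2 = (f0 s)\<^sup>2 + D
          \<and> (exc v lL XL (g s3) (e1 + T - s3) \<longrightarrow> f0 s + f1 s = v \<bullet> XC (g s3) + v \<bullet> XC (g e1))
          \<and> (exc (- v) (- lR) XR (g s2) (e2 - s2) \<longrightarrow> f2 s + f3 s = v \<bullet> XC (g s2) + v \<bullet> XC (g e2))" by (rule F)
    qed (rule admL admC admR; assumption)+
    then show False using iso by (rule notE)
  qed
  have "exc v lL XL (g s3) (e1 + T - s3)"
  proof (rule ccontr)
    assume n: "\<not> ?thesis"
    show False
    proof (rule left_free_family[OF V])
      fix f0 f1 f2 f3 :: "real \<Rightarrow> real"
      assume f: "(f0 \<longlongrightarrow> v \<bullet> XC (g s3)) (at_right 0)" "(f1 \<longlongrightarrow> v \<bullet> XC (g e1)) (at_right 0)"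
        "(f2 \<longlongrightarrow> v \<bullet> XC (g s2)) (at_right 0)" "(f3 \<longlongrightarrow> v \<bullet> XC (g e2)) (at_right 0)"
       and F: "\<And>s. 0 < s \<Longrightarrow> v \<bullet> XC (g e1) < f1 s \<and> v \<bullet> XC (g s2) < f2 s \<and> f3 s < v \<bullet> XC (g e2) \<and> f0 s \<le> v \<bullet> XC (g s3)
       \<and> (f2 s)\<^sup>2 = (f1 s)\<^sup>2 + D \<and> (f3 s)\<^sup>2 = (f0 s)\<^sup>2 + D \<and> f2 s + f3 s = v \<bullet> XC (g s2) + v \<bullet> XC (g e2)"
      show False
      proof (rule noniso[OF f])
        fix s :: real assume "0 < s"
        from F[OF this] show "v \<bullet> XC (g e1) < f1 s \<and> f3 s < v \<bullet> XC (g e2) \<and> 0 \<le> f2 s \<and> f0 s \<le> 0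
          \<and> (f2 s)\<^sup>2 = (f1 s)\<^sup>2 + D \<and> (f3 s)\<^sup>2 = (f0 s)\<^sup>2 + D
          \<and> (exc v lL XL (g s3) (e1 + T - s3) \<longrightarrow> f0 s + f1 s = v \<bullet> XC (g s3) + v \<bullet> XC (g e1))
          \<and> (exc (- v) (- lR) XR (g s2) (e2 - s2) \<longrightarrow> f2 s + f3 s = v \<bullet> XC (g s2) + v \<bullet> XC (g e2))"
          using V(1,3) by (elim conjE, intro conjI impI) (assumption | linarith | erule notE[OF n])+
      qed
    qed
  qed
  moreover have "exc (- v) (- lR) XR (g s2) (e2 - s2)"
  proof (rule ccontr)
    assume n: "\<not> ?thesis"
    show False
    proof (rule right_free_family[OF V])
      fix f0 f1 f2 f3 :: "real \<Rightarrow> real"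
      assume f: "(f0 \<longlongrightarrow> v \<bullet> XC (g s3)) (at_right 0)" "(f1 \<longlongrightarrow> v \<bullet> XC (g e1)) (at_right 0)"
        "(f2 \<longlongrightarrow> v \<bullet> XC (g s2)) (at_right 0)" "(f3 \<longlongrightarrow> v \<bullet> XC (g e2)) (at_right 0)"
       and F: "\<And>s. 0 < s \<Longrightarrow> v \<bullet> XC (g e1) < f1 s \<and> v \<bullet> XC (g s2) \<le> f2 s \<and> f3 s < v \<bullet> XC (g e2) \<and> f0 s \<le> v \<bullet> XC (g s3)
       \<and> (f2 s)\<^sup>2 = (f1 s)\<^sup>2 + D \<and> (f3 s)\<^sup>2 = (f0 s)\<^sup>2 + D \<and> f0 s + f1 s = v \<bullet> XC (g s3) + v \<bullet> XC (g e1)"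
      show False
      proof (rule noniso[OF f])
        fix s :: real assume "0 < s"
        from F[OF this] show "v \<bullet> XC (g e1) < f1 s \<and> f3 s < v \<bullet> XC (g e2) \<and> 0 \<le> f2 s \<and> f0 s \<le> 0
          \<and> (f2 s)\<^sup>2 = (f1 s)\<^sup>2 + D \<and> (f3 s)\<^sup>2 = (f0 s)\<^sup>2 + D
          \<and> (exc v lL XL (g s3) (e1 + T - s3) \<longrightarrow> f0 s + f1 s = v \<bullet> XC (g s3) + v \<bullet> XC (g e1))
          \<and> (exc (- v) (- lR) XR (g s2) (e2 - s2) \<longrightarrow> f2 s + f3 s = v \<bullet> XC (g s2) + v \<bullet> XC (g e2))"
          using V(1,3) by (elim conjE, intro conjI impI) (assumption | linarith | erule notE[OF n])+
      qed
    qed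
  qed
  ultimately show ?thesis by (rule that[OF cyc _ _ rng])
qed

text \<open>
  A simple closed curve does not fit into a line: it would be injective near its extreme point.
\<close>

lemma not_on_line: "\<exists>t. v \<bullet> g t \<noteq> l"
proof (rule ccontr)
  assume "\<not> ?thesis"
  then have on: "v \<bullet> g t = l" for t by blast
  define f where "f t = perp v \<bullet> g t" for t
  have fc: "continuous_on S f" for S
    unfolding f_def by (intro continuous_intros continuous_on_subset[OF cont]) simp
  obtain m where m: "m \<in> {0..T}" "\<And>t. t \<in> {0..T} \<Longrightarrow> f t \<le> f m"
    using continuous_attains_sup[OF compact_Icc _ fc[of "{0..T}"]] T by auto
  have max: "f t \<le> f m" for t
  proof -
    obtain u where "u \<in> {0..0 + T}" "g t = g u" using range_g[of 0] by (metis imageE rangeI)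
    then show ?thesis using m(2)[of u] by (simp add: f_def)
  qed
  have inj: "f s \<noteq> f t" if "s < t" "t < s + T" for s t
  proof
    assume "f s = f t"
    then have "g s = g t"
      using perp_decomposition[OF v, of "g s"] perp_decomposition[OF v, of "g t"] on unfolding f_def by metis
    then show False using g_neq that by blast
  qed
  have "inj_on f {m - T / 3..m + T / 3}"
  proof (rule inj_onI)
    fix s t assume "s \<in> {m - T / 3..m + T / 3}" "t \<in> {m - T / 3..m + T / 3}" "f s = f t"
    then show "s = t" using inj[of s t] inj[of t s] T by (cases s t rule: linorder_cases) auto
  qed
  from continuous_inj_imp_mono[OF _ _ fc this, of m] T max[of "m - T / 3"] max[of "m + T / 3"]
  show False by simp
qed

text \<open>
  If the curve stays in the left half plane and touches its boundary, this half plane is cut off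
  far away. The curve then runs in the strip between the cut and the boundary, whose field is
  \<open>XL\<close>, and meets the half plane of the field \<open>XC\<close> only on the line.
\<close>

lemma left_half_plane_not_isolated:
  assumes le: "\<And>t. v \<bullet> g t \<le> lL"
    and admL: "\<And>A. \<forall>r\<in>A. v \<bullet> r \<le> lL \<Longrightarrow> adm XL A"
    and admC: "\<And>A. \<forall>r\<in>A. lL \<le> v \<bullet> r \<and> v \<bullet> r \<le> lR \<Longrightarrow> adm XC A"
  shows "\<not> isolated_loop adm (range g)"
proof (cases "\<exists>t. v \<bullet> g t = lL")
  case False
  then have lt: "v \<bullet> g t < lL" for t using le[of t] by (metis order_le_less)
  show ?thesis
  proof (rule closed_flow_not_isolated[OF hL, where I = "{..lL}" and a = 0])
    show "g t = flow XL (t - 0) (g 0)" if "t \<in> {0..0 + T}" for t by (rule flow_in_left[OF lt that])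
    show "v \<bullet> g t \<in> {..lL}" for t using le[of t] by simp
  qed (use admL is_interval_ic in auto)
next
  case True
  then obtain w where w: "v \<bullet> g w = lL" by blast
  obtain r where r: "v \<bullet> g r < lL" using not_on_line[of lL] le by (metis order_le_less)
  obtain s e where "exc v lL XL (g s) (e - s)" using left_gap[OF r w] by metis
  then have nd: "nondeg v XL" by (rule exc_nondeg[OF hL v])
  have "compact ((\<lambda>t. v \<bullet> g t) ` {0..T})" by (intro compact_continuous_image xcont compact_Icc)
  then obtain B where B: "\<And>t. t \<in> {0..T} \<Longrightarrow> \<bar>v \<bullet> g t\<bar> \<le> B"
    using compact_imp_bounded bounded_iff by (metis imageI real_norm_def)
  define M where "M = max (B + 1) (- lL + 1)"
  have M: "- (v \<bullet> g t) < M" for t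
  proof -
    obtain u where u: "u \<in> {0..0 + T}" "g t = g u" using range_g[of 0] by (metis imageE rangeI)
    then show ?thesis using B[of u] unfolding M_def by simp
  qed
  \<comment> \<open>seen from the left half plane, the orbit is an orbit of a system whose middle zone is a strip to the left of the line\<close>
  have germ: "germ (- v) (- lL) M XC XL XR g \<sigma> t" if "germ v lL lR XL XC XR g \<sigma> t" for \<sigma> t
  proof -
    obtain d where d: "0 < d" and cs:
     "(\<forall>h\<in>{0..d}. g (t + \<sigma> * h) = flow XL (\<sigma> * h) (g t) \<and> v \<bullet> g (t + \<sigma> * h) \<le> lL) \<or>
     (\<forall>h\<in>{0..d}. g (t + \<sigma> * h) = flow XC (\<sigma> * h) (g t) \<and> lL \<le> v \<bullet> g (t + \<sigma> * h) \<and> v \<bullet> g (t + \<sigma> * h) \<le> lR) \<or>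
     (\<forall>h\<in>{0..d}. g (t + \<sigma> * h) = flow XR (\<sigma> * h) (g t) \<and> lR \<le> v \<bullet> g (t + \<sigma> * h))"
      using \<open>germ v lL lR XL XC XR g \<sigma> t\<close> unfolding germ_def by blast
    have "\<not> lR \<le> v \<bullet> g (t + \<sigma> * 0)" using le[of t] lr by simp
    moreover have "0 \<in> {0..d}" using d by simp
    ultimately have "(\<forall>h\<in>{0..d}. g (t + \<sigma> * h) = flow XL (\<sigma> * h) (g t) \<and> v \<bullet> g (t + \<sigma> * h) \<le> lL) \<or>
     (\<forall>h\<in>{0..d}. g (t + \<sigma> * h) = flow XC (\<sigma> * h) (g t) \<and> lL \<le> v \<bullet> g (t + \<sigma> * h))"
      using cs by blast
    moreover have "- (v \<bullet> g u) \<le> M" for u using M[of u] by simp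
    ultimately show ?thesis unfolding germ_def inner_minus_left neg_le_iff_le using d by blast
  qed
  interpret N: cycle "- v" "- lL" M XC XL XR g T
  proof
    show "- lL < M" by (simp add: M_def)
  qed (use v hL hC hR T cont per inj germ rgerm lgerm in simp_all)
  show ?thesis
  proof (rule N.one_sided_not_isolated)
    show "nondeg (- v) XL" using nd by simp
    show "- lL < - v \<bullet> g r" using r by simp
    show "- v \<bullet> g t \<noteq> M" for t using M[of t] by simp
    show "- v \<bullet> g r < M" using M[of r] by simp
    show "adm XC A" if "\<forall>r\<in>A. - v \<bullet> r \<le> - lL" "(\<And>t. - lL \<le> - v \<bullet> g t) \<Longrightarrow> \<forall>r\<in>A. - v \<bullet> r = - lL" for A
    proof (rule admC)
      have "\<forall>r\<in>A. - v \<bullet> r = - lL" by (rule that(2)) (use le in simp)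
      then show "\<forall>r\<in>A. lL \<le> v \<bullet> r \<and> v \<bullet> r \<le> lR" using lr by simp
    qed
    show "adm XL A" if "\<forall>r\<in>A. - lL \<le> - v \<bullet> r \<and> - v \<bullet> r \<le> M" for A
      by (rule admL) (use that in simp)
  qed
qed

text \<open>
  In the degenerate case the velocity depends on the position only. So every gap crosses the strip
  in the same direction, and the curve could not come back.
\<close>

lemma strip_entered_nondeg:
  assumes w: "lL < v \<bullet> g w" "v \<bullet> g w < lR" and c: "c \<in> walls v lL lR g"
  shows "nondeg v XC"
proof (rule ccontr)
  assume deg: "\<not> nondeg v XC"
  interpret M: cycle "- v" "- lR" "- lL" XR XC XL g T by (rule mirror)
  obtain k where k: "k \<noteq> 0" "\<And>p. v \<bullet> XC p = k * (v \<bullet> p - v \<bullet> centre XC)"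
    using degenerate_velocity[OF hC v deg] by blast
  define \<mu> where "\<mu> = (lL + lR) / 2"
  have mu: "lL < \<mu>" "\<mu> < lR" using lr by (simp_all add: \<mu>_def)
  \<comment> \<open>in a degenerate middle zone the orbit crosses the strip from one line to the other, always in the same direction\<close>
  have ends: "(v \<bullet> g a = lL \<and> v \<bullet> g b = lR \<and> 0 < k * (\<mu> - v \<bullet> centre XC)) \<or>
      (v \<bullet> g a = lR \<and> v \<bullet> g b = lL \<and> k * (\<mu> - v \<bullet> centre XC) < 0)" if c: "Cgap a b" for a b
  proof -
    have ab: "a < b" using c unfolding strip_gap_def by simp
    have c': "strip_gap (- v) (- lR) (- lL) g a b" using c by simp
    have x: "v \<bullet> g a = lL \<or> v \<bullet> g a = lR" "v \<bullet> g b = lL \<or> v \<bullet> g b = lR"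
      using c unfolding strip_gap_def walls_def by auto
    have nLL: "\<not> (v \<bullet> g a = lL \<and> v \<bullet> g b = lL)"
      using gap_exc_left(1)[OF c] exc_nondeg[OF hC, of "- v"] deg v by (metis neg_equal_0_iff_equal nondeg_minus(1))
    have nRR: "\<not> (v \<bullet> g a = lR \<and> v \<bullet> g b = lR)"
    proof
      assume "v \<bullet> g a = lR \<and> v \<bullet> g b = lR"
      then have "exc (- (- v)) (- (- lR)) XC (g a) (b - a)" by (intro M.gap_exc_left(1)[OF c']) simp_all
      then show False using exc_nondeg[OF hC v] deg by simp
    qed
    have mid: "\<exists>t. a < t \<and> t < b \<and> v \<bullet> g t = \<mu>" if "v \<bullet> g a \<noteq> v \<bullet> g b"
    proof -
      have "\<exists>t\<in>{a..b}. v \<bullet> g t = \<mu>"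
        using x_ivt[of a b \<mu>] x_ivt2[of a b \<mu>] ab x mu that by force
      then obtain t where t: "t \<in> {a..b}" "v \<bullet> g t = \<mu>" by blast
      then have "t \<noteq> a" "t \<noteq> b" using x mu by auto
      then show ?thesis using t by (intro exI[of _ t]) simp
    qed
    show ?thesis
    proof (cases "v \<bullet> g a = lL")
      case True
      then have xb: "v \<bullet> g b = lR" using x nLL by blast
      obtain t where t: "a < t" "t < b" "v \<bullet> g t = \<mu>" using mid True xb lr by auto
      have "0 < v \<bullet> XC (flow XC (t - a) (g a))"
        by (rule cross_velocity(1)[OF hC lr gap_cross(1)[OF c True xb]]) (use t in simp_all)
      then have "0 < v \<bullet> XC (g t)" using strip_gap_flow[OF c, of t] t by simp
      then show ?thesis using k(2) t(3) True xb by simp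
    next
      case False
      then have xa: "v \<bullet> g a = lR" and xb: "v \<bullet> g b = lL" using x nRR by blast+
      obtain t where t: "a < t" "t < b" "v \<bullet> g t = \<mu>" using mid xa xb lr by auto
      have xm: "- v \<bullet> g a = - lR" "- v \<bullet> g b = - lL" using xa xb by simp_all
      have "0 < - v \<bullet> XC (flow XC (t - a) (g a))"
        by (rule cross_velocity(1)[OF hC M.lr M.gap_cross(1)[OF c' xm]]) (use t in simp_all)
      then have "v \<bullet> XC (g t) < 0" using strip_gap_flow[OF c, of t] t by simp
      then show ?thesis using k(2) t(3) xa xb by simp
    qed
  qed
  obtain a b where ab: "a < w" "w < b" "Cgap a b" by (rule strip_gap_around[OF w c])
  have ab': "a < b" using ab by simp
  have nT: "b \<le> a + T"
  proof (rule ccontr)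
    assume "\<not> b \<le> a + T"
    then have "lL < v \<bullet> g (a + T) \<and> v \<bullet> g (a + T) < lR" using strip_gap_strict[OF ab(3), of "a + T"] T by simp
    then show False using per[of a] ab(3) unfolding strip_gap_def walls_def by auto
  qed
  \<comment> \<open>the last passage through the middle line before one period is over leads to the wrong line\<close>
  have cl: "closed {t. v \<bullet> g t = \<mu>}" using xcont[of UNIV] by (auto intro!: closed_Collect_eq continuous_intros)
  have xT: "v \<bullet> g (a + T) = v \<bullet> g a" using per by simp
  have again: "\<exists>u\<in>{b'..a + T}. v \<bullet> g u = \<mu>" if b': "b' \<le> a + T" "v \<bullet> g b' = v \<bullet> g b" for b'
    using x_ivt[of b' "a + T" \<mu>] x_ivt2[of b' "a + T" \<mu>] ends[OF ab(3)] b' xT mu by force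
  have "compact ({b..a + T} \<inter> {t. v \<bullet> g t = \<mu>})" by (intro compact_Int_closed compact_Icc cl)
  moreover have "{b..a + T} \<inter> {t. v \<bullet> g t = \<mu>} \<noteq> {}" using again[OF nT] by blast
  ultimately obtain m where m: "m \<in> {b..a + T} \<inter> {t. v \<bullet> g t = \<mu>}"
    "\<And>t. t \<in> {b..a + T} \<inter> {t. v \<bullet> g t = \<mu>} \<Longrightarrow> t \<le> m" by (meson compact_attains_sup)
  have xm: "lL < v \<bullet> g m" "v \<bullet> g m < lR" using m(1) mu by simp_all
  obtain a' b' where ab2: "a' < m" "m < b'" "Cgap a' b'" by (rule strip_gap_around[OF xm c])
  have xb': "v \<bullet> g b' = v \<bullet> g b" using ends[OF ab(3)] ends[OF ab2(3)] by auto
  have "b' \<le> a + T"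
  proof (rule ccontr)
    assume "\<not> b' \<le> a + T"
    then have "lL < v \<bullet> g (a + T) \<and> v \<bullet> g (a + T) < lR" using strip_gap_strict[OF ab2(3), of "a + T"] ab2(1) m(1) by simp
    then show False using per[of a] ab(3) unfolding strip_gap_def walls_def by auto
  qed
  then obtain u where u: "u \<in> {b'..a + T}" "v \<bullet> g u = \<mu>" using again xb' by blast
  then have "u \<le> m" using m(2)[of u] ab2(2) m(1) by simp
  then show False using u(1) ab2(2) by simp
qed

text \<open>
  A curve in one closed half plane, inside the strip or on one side of a line of the strip is not
  isolated. So the curve meets both lines and the strip.
\<close>

theorem isolated_cycle_is_three_zone:
  assumes admL: "\<And>A. \<forall>r\<in>A. v \<bullet> r \<le> lL \<Longrightarrow> adm XL A"
    and admC: "\<And>A. \<forall>r\<in>A. lL \<le> v \<bullet> r \<and> v \<bullet> r \<le> lR \<Longrightarrow> adm XC A"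
    and admR: "\<And>A. \<forall>r\<in>A. lR \<le> v \<bullet> r \<Longrightarrow> adm XR A"
    and iso: "isolated_loop adm (range g)"
  obtains p0 p1 p2 p3 Ta Tb Tc Td where "nondeg v XC" "three_zone_cycle v lL lR XL XC XR p0 p1 p2 p3 Ta Tb Tc Td"
    "exc v lL XL p0 Td" "exc (- v) (- lR) XR p2 Tb"
    "range g = (orbit XC p1 Ta \<union> orbit XR p2 Tb) \<union> (orbit XC p3 Tc \<union> orbit XL p0 Td)"
proof -
  interpret M: cycle "- v" "- lR" "- lL" XR XC XL g T by (rule mirror)
  have admR': "adm XR A" if "\<forall>r\<in>A. - v \<bullet> r \<le> - lR" for A by (rule admR) (use that in simp)
  have admC': "adm XC A" if "\<forall>r\<in>A. - lR \<le> - v \<bullet> r \<and> - v \<bullet> r \<le> - lL" for A by (rule admC) (use that in simp)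
  have "\<not> (\<forall>t. v \<bullet> g t \<le> lL)"
  proof
    assume a: "\<forall>t. v \<bullet> g t \<le> lL"
    have "\<not> isolated_loop adm (range g)"
      by (rule left_half_plane_not_isolated) (use a in blast, rule admL, assumption, rule admC, assumption)
    then show False using iso by blast
  qed
  then obtain t1 where t1: "lL < v \<bullet> g t1" by (meson not_le)
  have "\<not> (\<forall>t. - v \<bullet> g t \<le> - lR)"
  proof
    assume a: "\<forall>t. - v \<bullet> g t \<le> - lR"
    have "\<not> isolated_loop adm (range g)"
      by (rule M.left_half_plane_not_isolated) (use a in blast, rule admR', assumption, rule admC', assumption)
    then show False using iso by blast
  qed
  then obtain t2 where t2: "v \<bullet> g t2 < lR" by (auto simp: not_le)
  have "\<exists>w. lL < v \<bullet> g w \<and> v \<bullet> g w < lR"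
  proof (rule ccontr)
    assume n: "\<not> ?thesis"
    define \<mu> where "\<mu> = (lL + lR) / 2"
    have mu: "lL < \<mu>" "\<mu> < lR" using lr by (simp_all add: \<mu>_def)
    have "v \<bullet> g u \<noteq> \<mu>" for u using n mu by metis
    then have "v \<bullet> g t1 < \<mu> \<longleftrightarrow> v \<bullet> g t2 < \<mu>" by (rule x_between)
    moreover have "lR \<le> v \<bullet> g t1" "v \<bullet> g t2 \<le> lL" using n t1 t2 by (metis not_le)+
    ultimately show False using mu by linarith
  qed
  then obtain w where w: "lL < v \<bullet> g w" "v \<bullet> g w < lR" by blast
  have wm: "- lR < - v \<bullet> g w" "- v \<bullet> g w < - lL" using w by simp_all
  have "\<exists>c. c \<in> walls v lL lR g"
  proof (rule ccontr)
    assume "\<not> ?thesis"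
    then have nL: "v \<bullet> g t \<noteq> lL" and nR: "v \<bullet> g t \<noteq> lR" for t unfolding walls_def by auto
    have zone: "lL < v \<bullet> g t \<and> v \<bullet> g t < lR" for t
    proof -
      have "v \<bullet> g t < lL \<longleftrightarrow> v \<bullet> g w < lL" by (rule x_between) (rule nL)
      moreover have "v \<bullet> g t < lR \<longleftrightarrow> v \<bullet> g w < lR" by (rule x_between) (rule nR)
      ultimately show ?thesis using w nL[of t] by auto
    qed
    have "\<not> isolated_loop adm (range g)"
    proof (rule closed_flow_not_isolated[OF hC, where I = "{lL..lR}" and a = 0])
      show "g t = flow XC (t - 0) (g 0)" if "t \<in> {0..0 + T}" for t by (rule flow_in_middle[OF zone that])
      show "v \<bullet> g t \<in> {lL..lR}" for t using zone[of t] by simp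
    qed (use admC is_interval_cc in auto)
    then show False using iso by blast
  qed
  then obtain c where c: "c \<in> walls v lL lR g" by blast
  have nd: "nondeg v XC" by (rule strip_entered_nondeg[OF w c])
  have ndM: "nondeg (- v) XC" using nd by simp
  have "\<exists>t. v \<bullet> g t = lR"
  proof (rule ccontr)
    assume "\<not> ?thesis"
    then have nR: "v \<bullet> g t \<noteq> lR" for t by blast
    have "\<not> isolated_loop adm (range g)"
      by (rule one_sided_not_isolated[OF nd w(1) nR w(2)]) (rule admL, assumption, rule admC, assumption)
    then show False using iso by blast
  qed
  then obtain wR where wR: "v \<bullet> g wR = lR" by blast
  have "\<exists>t. v \<bullet> g t = lL"
  proof (rule ccontr)
    assume "\<not> ?thesis"
    then have nL: "- v \<bullet> g t \<noteq> - lL" for t by auto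
    have "\<not> isolated_loop adm (range g)"
      by (rule M.one_sided_not_isolated[OF ndM wm(1) nL wm(2)]) (rule admR', assumption, rule admC', assumption)
    then show False using iso by blast
  qed
  then obtain wL where wL: "v \<bullet> g wL = lL" by blast
  show ?thesis
    by (rule isolated_three_zone_cycle[OF nd wL wR _ _ _ iso]) (rule admL admC admR that[OF nd]; assumption)+
qed

end

section \<open>Loops are periodic orbits of the piecewise system\<close>

text \<open>
  The motions that follow one of the three fields in its closed zone. Perturbed orbits are
  composed of these motions only.
\<close>

definition zone_adm :: "plane \<Rightarrow> real \<Rightarrow> real \<Rightarrow> (plane \<Rightarrow> plane) \<Rightarrow> (plane \<Rightarrow> plane) \<Rightarrow> (plane \<Rightarrow> plane)
    \<Rightarrow> (plane \<Rightarrow> plane) \<Rightarrow> plane set \<Rightarrow> bool" where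
  "zone_adm v lL lR XL XC XR X S \<longleftrightarrow>
     (X = XL \<and> (\<forall>r\<in>S. v \<bullet> r \<le> lL)) \<or> (X = XC \<and> (\<forall>r\<in>S. lL \<le> v \<bullet> r \<and> v \<bullet> r \<le> lR)) \<or> (X = XR \<and> (\<forall>r\<in>S. lR \<le> v \<bullet> r))"

lemma partition_join:
  fixes \<tau>1 \<tau>2 :: "nat \<Rightarrow> real"
  assumes 1: "\<tau>1 0 = a" "\<tau>1 n = b" "\<forall>i<n. P (\<tau>1 i) (\<tau>1 (Suc i))"
    and 2: "\<tau>2 0 = b" "\<tau>2 m = c" "\<forall>i<m. P (\<tau>2 i) (\<tau>2 (Suc i))"
  shows "\<exists>k \<tau>. \<tau> 0 = a \<and> \<tau> k = c \<and> (\<forall>i<k. P (\<tau> i) (\<tau> (Suc i)))"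
proof -
  define \<tau> where "\<tau> i = (if i \<le> n then \<tau>1 i else \<tau>2 (i - n))" for i
  have t2: "\<tau> i = \<tau>2 (i - n)" if "n \<le> i" for i using that 1(2) 2(1) by (auto simp: \<tau>_def)
  have "P (\<tau> i) (\<tau> (Suc i))" if i: "i < n + m" for i
  proof (cases "i < n")
    case True
    then show ?thesis using 1(3) by (simp add: \<tau>_def)
  next
    case False
    then show ?thesis using 2(3) t2[of i] t2[of "Suc i"] i by (simp add: Suc_diff_le)
  qed
  moreover have "\<tau> 0 = a" "\<tau> (n + m) = c" using 1(1) t2[of "n + m"] 2(2) by (simp_all add: \<tau>_def)
  ultimately show ?thesis by blast
qed

lemma itinerary_partition:
  "itinerary adm \<gamma> a b \<Longrightarrow> \<exists>n \<tau>. \<tau> 0 = a \<and> \<tau> n = b \<and> (\<forall>i<n. \<tau> i < \<tau> (Suc i) \<and> arc_on adm \<gamma> (\<tau> i) (\<tau> (Suc i)))"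
proof (induction rule: itinerary.induct)
  case (single a b)
  then show ?case by (intro exI[of _ 1] exI[of _ "\<lambda>i. if i = 0 then a else b"]) simp
next
  case (trans a b c)
  then obtain n m \<tau>1 \<tau>2 where
    "\<tau>1 0 = a" "\<tau>1 n = b" "\<forall>i<n. \<tau>1 i < \<tau>1 (Suc i) \<and> arc_on adm \<gamma> (\<tau>1 i) (\<tau>1 (Suc i))"
    "\<tau>2 0 = b" "\<tau>2 m = c" "\<forall>i<m. \<tau>2 i < \<tau>2 (Suc i) \<and> arc_on adm \<gamma> (\<tau>2 i) (\<tau>2 (Suc i))" by metis
  then show ?case by (rule partition_join[where P = "\<lambda>x y. x < y \<and> arc_on adm \<gamma> x y"])
qed

context three_zones
begin

lemma closure_zones:
  assumes v: "v \<noteq> 0" and lr: "lL < lR"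
  shows "closure zoneL = {p. v \<bullet> p \<le> lL}" "closure zoneC = {p. lL \<le> v \<bullet> p \<and> v \<bullet> p \<le> lR}"
    "closure zoneR = {p. lR \<le> v \<bullet> p}"
proof -
  show "closure zoneL = {p. v \<bullet> p \<le> lL}" unfolding zoneL_def using v by (rule closure_halfspace_lt)
  have "closure {p. v \<bullet> p > lR} = {p. v \<bullet> p \<ge> lR}" using v by (rule closure_halfspace_gt)
  then show "closure zoneR = {p. lR \<le> v \<bullet> p}" unfolding zoneR_def by simp
  have cl: "closed {p. lL \<le> v \<bullet> p \<and> v \<bullet> p \<le> lR}"
    using closed_halfspace_ge[of lL v] closed_halfspace_le[of v lR] by (simp add: closed_Collect_conj)
  show "closure zoneC = {p. lL \<le> v \<bullet> p \<and> v \<bullet> p \<le> lR}"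
  proof
    show "closure zoneC \<subseteq> {p. lL \<le> v \<bullet> p \<and> v \<bullet> p \<le> lR}"
      by (rule closure_minimal[OF _ cl]) (auto simp: zoneC_def)
    show "{p. lL \<le> v \<bullet> p \<and> v \<bullet> p \<le> lR} \<subseteq> closure zoneC"
    proof
      fix p assume "p \<in> {p. lL \<le> v \<bullet> p \<and> v \<bullet> p \<le> lR}"
      then have p: "lL \<le> v \<bullet> p" "v \<bullet> p \<le> lR" by simp_all
      define q where "q = p + (((lL + lR) / 2 - v \<bullet> p) / (v \<bullet> v)) *\<^sub>R v"
      have q: "v \<bullet> q = (lL + lR) / 2" using v by (simp add: q_def inner_add_right)
      have "((\<lambda>s. p + s *\<^sub>R (q - p)) \<longlongrightarrow> p + 0 *\<^sub>R (q - p)) (at_right (0::real))"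
        by (intro tendsto_intros)
      then have lim: "((\<lambda>s. p + s *\<^sub>R (q - p)) \<longlongrightarrow> p) (at_right (0::real))" by simp
      have "\<forall>\<^sub>F s in at_right (0::real). p + s *\<^sub>R (q - p) \<in> closure zoneC"
      proof -
        have "p + s *\<^sub>R (q - p) \<in> closure zoneC" if s: "0 < s" "s < 1" for s :: real
        proof -
          have e: "v \<bullet> (p + s *\<^sub>R (q - p)) = (1 - s) * (v \<bullet> p) + s * ((lL + lR) / 2)"
            by (simp add: inner_add_right inner_diff_right q algebra_simps)
          have "(1 - s) * lL \<le> (1 - s) * (v \<bullet> p)" "(1 - s) * (v \<bullet> p) \<le> (1 - s) * lR"
            using p s by (intro mult_left_mono; simp)+
          moreover have "s * lL < s * ((lL + lR) / 2)" "s * ((lL + lR) / 2) < s * lR"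
            using lr s by (intro mult_strict_left_mono; simp)+
          moreover have "(1 - s) * lL + s * lL = lL" "(1 - s) * lR + s * lR = lR" by (simp_all add: algebra_simps)
          ultimately have "p + s *\<^sub>R (q - p) \<in> zoneC" unfolding zoneC_def mem_Collect_eq e by linarith
          then show ?thesis using closure_subset by blast
        qed
        then show ?thesis unfolding eventually_at_right_field by (intro exI[of _ 1]) simp
      qed
      then show "p \<in> closure zoneC"
        by (rule Lim_in_closed_set[OF closed_closure _ trivial_limit_at_right_real lim])
    qed
  qed
qed

lemma loop_periodic_orbit:
  assumes v: "v \<noteq> 0" and lr: "lL < lR" and l: "loop (zone_adm v lL lR XL XC XR) \<Gamma>"
  shows "periodic_orbit \<Gamma>"
proof -
  obtain \<gamma> T where it: "itinerary (zone_adm v lL lR XL XC XR) \<gamma> 0 T" and g: "continuous_on {0..T} \<gamma>" "inj_on \<gamma> {0..<T}"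
    "\<gamma> T = \<gamma> 0" "\<Gamma> = \<gamma> ` {0..T}" using l unfolding loop_def by blast
  have arc: "orbit_arc \<gamma> s e" if a: "arc_on (zone_adm v lL lR XL XC XR) \<gamma> s e" for s e
  proof -
    obtain X where X: "zone_adm v lL lR XL XC XR X (\<gamma> ` {s<..<e})"
      "\<forall>t\<in>{s<..<e}. (\<gamma> has_vector_derivative X (\<gamma> t)) (at t)" using a unfolding arc_on_def by blast
    from X(1) show ?thesis
      unfolding zone_adm_def
    proof (elim disjE conjE)
      assume "X = XL" "\<forall>r\<in>\<gamma> ` {s<..<e}. v \<bullet> r \<le> lL"
      then have "integral_arc (closure zoneL) XL \<gamma> s e"
        unfolding integral_arc_def closure_zones[OF v lr] using X(2) by simp
      then show ?thesis unfolding orbit_arc_def by blast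
    next
      assume "X = XC" "\<forall>r\<in>\<gamma> ` {s<..<e}. lL \<le> v \<bullet> r \<and> v \<bullet> r \<le> lR"
      then have "integral_arc (closure zoneC) XC \<gamma> s e"
        unfolding integral_arc_def closure_zones[OF v lr] using X(2) by simp
      then show ?thesis unfolding orbit_arc_def by blast
    next
      assume "X = XR" "\<forall>r\<in>\<gamma> ` {s<..<e}. lR \<le> v \<bullet> r"
      then have "integral_arc (closure zoneR) XR \<gamma> s e"
        unfolding integral_arc_def closure_zones[OF v lr] using X(2) by simp
      then show ?thesis unfolding orbit_arc_def by blast
    qed
  qed
  obtain n \<tau> where "\<tau> 0 = 0" "\<tau> n = T" "\<forall>i<n. \<tau> i < \<tau> (Suc i) \<and> arc_on (zone_adm v lL lR XL XC XR) \<gamma> (\<tau> i) (\<tau> (Suc i))"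
    using itinerary_partition[OF it] by blast
  then have "trajectory \<gamma> T" unfolding trajectory_def using g(1) arc by blast
  then show ?thesis unfolding periodic_orbit_def using g itinerary_less[OF it] by blast
qed

text \<open>
  Near an interior time the arc stays in one of the two sets, by continuity. As a continuous curve
  on a line it covers the segment between any two of its points.
\<close>

lemma no_sliding_arc:
  fixes s e :: real
  assumes v: "v \<noteq> 0" and X: "continuous_on UNIV X" and Y: "continuous_on UNIV Y"
    and se: "s < e" and cont: "continuous_on {s<..<e} \<gamma>" and inj: "inj_on \<gamma> {s<..<e}"
    and arc: "\<And>t. t \<in> {s<..<e} \<Longrightarrow> \<gamma> t \<in> sliding_set l X Y \<union> escaping_set l X Y"
    and sub: "\<gamma> ` {s<..<e} \<subseteq> \<Gamma>"
  shows "\<exists>A\<in>{sliding_set l X Y, escaping_set l X Y}. \<exists>p q. p \<noteq> q \<and> closed_segment p q \<subseteq> \<Gamma> \<inter> A"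
proof -
  define m where "m = (s + e) / 2"
  have m: "m \<in> {s<..<e}" using se by (simp add: m_def)
  have line: "v \<bullet> \<gamma> t = l" if "t \<in> {s<..<e}" for t
    using arc[OF that] unfolding sliding_set_def escaping_set_def line_def by auto
  have cX: "continuous_on {s<..<e} (\<lambda>t. X (\<gamma> t) \<bullet> v)" and cY: "continuous_on {s<..<e} (\<lambda>t. Y (\<gamma> t) \<bullet> v)"
    using continuous_on_compose2[OF X cont] continuous_on_compose2[OF Y cont] by (auto intro!: continuous_intros)
  have isX: "isCont (\<lambda>t. X (\<gamma> t) \<bullet> v) m" and isY: "isCont (\<lambda>t. Y (\<gamma> t) \<bullet> v) m"
    using cX cY m by (simp_all add: continuous_on_eq_continuous_at)
  \<comment> \<open>near the middle time the arc stays in one of the two sets\<close>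
  have "\<exists>A\<in>{sliding_set l X Y, escaping_set l X Y}. \<forall>\<^sub>F t in at_right m. \<gamma> t \<in> A"
  proof -
    have ev: "\<forall>\<^sub>F t in at_right m. t \<in> {s<..<e}"
      unfolding eventually_at_right_field using m by (intro exI[of _ e]) auto
    have limX: "((\<lambda>t. X (\<gamma> t) \<bullet> v) \<longlongrightarrow> X (\<gamma> m) \<bullet> v) (at_right m)"
      and limY: "((\<lambda>t. Y (\<gamma> t) \<bullet> v) \<longlongrightarrow> Y (\<gamma> m) \<bullet> v) (at_right m)"
      using isX isY by (simp_all add: isCont_def filterlim_at_split)
    from arc[OF m] show ?thesis
    proof
      assume "\<gamma> m \<in> sliding_set l X Y"
      then have "0 < X (\<gamma> m) \<bullet> v" "Y (\<gamma> m) \<bullet> v < 0" unfolding sliding_set_def by auto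
      from order_tendstoD(1)[OF limX this(1)] order_tendstoD(2)[OF limY this(2)] ev
      have "\<forall>\<^sub>F t in at_right m. \<gamma> t \<in> sliding_set l X Y"
        by eventually_elim (use line in \<open>auto simp: sliding_set_def line_def\<close>)
      then show ?thesis by blast
    next
      assume "\<gamma> m \<in> escaping_set l X Y"
      then have "X (\<gamma> m) \<bullet> v < 0" "0 < Y (\<gamma> m) \<bullet> v" unfolding escaping_set_def by auto
      from order_tendstoD(2)[OF limX this(1)] order_tendstoD(1)[OF limY this(2)] ev
      have "\<forall>\<^sub>F t in at_right m. \<gamma> t \<in> escaping_set l X Y"
        by eventually_elim (use line in \<open>auto simp: escaping_set_def line_def\<close>)
      then show ?thesis by blast
    qed
  qed
  then obtain A where A: "A \<in> {sliding_set l X Y, escaping_set l X Y}" "\<forall>\<^sub>F t in at_right m. \<gamma> t \<in> A" by blast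
  then obtain b where b: "m < b" "\<And>t. m < t \<Longrightarrow> t < b \<Longrightarrow> \<gamma> t \<in> A" unfolding eventually_at_right_field by blast
  have "m < min b e" using b(1) m by simp
  then obtain t2 where t2: "m < t2" "t2 < min b e" using dense by blast
  from dense[OF t2(1)] obtain t1 where t1: "m < t1" "t1 < t2" by blast
  have t: "m < t1" "t1 < t2" "t2 < b" "t2 < e" using t1 t2(2) by simp_all
  have ran: "u \<in> {s<..<e} \<and> \<gamma> u \<in> A" if "u \<in> {t1..t2}" for u using b(2)[of u] that t m by auto
  have ne: "\<gamma> t1 \<noteq> \<gamma> t2" using inj_onD[OF inj, of t1 t2] ran[of t1] ran[of t2] t by auto
  have "closed_segment (\<gamma> t1) (\<gamma> t2) \<subseteq> \<Gamma> \<inter> A"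
  proof
    fix p assume "p \<in> closed_segment (\<gamma> t1) (\<gamma> t2)"
    then obtain u where u: "0 \<le> u" "u \<le> 1" "p = (1 - u) *\<^sub>R \<gamma> t1 + u *\<^sub>R \<gamma> t2" unfolding closed_segment_def by blast
    have vp: "v \<bullet> p = l"
      using line[of t1] line[of t2] ran[of t1] ran[of t2] t by (simp add: u(3) inner_add_right algebra_simps)
    define f where "f x = perp v \<bullet> \<gamma> x" for x
    have fc: "continuous_on {t1..t2} f"
      unfolding f_def by (intro continuous_intros continuous_on_subset[OF cont]) (use ran in blast)
    have fp: "perp v \<bullet> p = (1 - u) * f t1 + u * f t2" by (simp add: u(3) f_def inner_add_right)
    have "\<exists>x\<in>{t1..t2}. f x = perp v \<bullet> p"
    proof (cases "f t1 \<le> f t2")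
      case True
      have "f t1 \<le> perp v \<bullet> p" "perp v \<bullet> p \<le> f t2"
        unfolding fp using u True convex_bound_le[of "f t1" "f t2" "f t2" "1 - u" u]
          mult_left_mono[OF True, of u] by (auto simp: algebra_simps)
      then show ?thesis using IVT'[OF _ _ _ fc] t by force
    next
      case False
      then have F: "f t2 \<le> f t1" by simp
      have "f t2 \<le> perp v \<bullet> p" "perp v \<bullet> p \<le> f t1"
        unfolding fp using u F convex_bound_le[of "f t1" "f t1" "f t2" "1 - u" u]
          mult_left_mono[OF F, of "1 - u"] by (auto simp: algebra_simps)
      then show ?thesis using IVT2'[OF _ _ _ fc] t by force
    qed
    then obtain x where x: "x \<in> {t1..t2}" "perp v \<bullet> \<gamma> x = perp v \<bullet> p" unfolding f_def by blast
    have "v \<bullet> \<gamma> x = v \<bullet> p" using line ran[OF x(1)] vp by simp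
    then have "p = \<gamma> x"
      using perp_decomposition[OF v, of p] perp_decomposition[OF v, of "\<gamma> x"] x(2) by metis
    then show "p \<in> \<Gamma> \<inter> A" using ran[OF x(1)] sub by blast
  qed
  with A(1) ne show ?thesis by blast
qed

end

section \<open>Periodic orbits are periodic curves with germs\<close>

lemma partition_locate:
  fixes \<tau> :: "nat \<Rightarrow> real"
  assumes "\<forall>i<n. \<tau> i < \<tau> (Suc i)"
  shows "\<tau> 0 \<le> a \<Longrightarrow> a < \<tau> n \<Longrightarrow> \<exists>i<n. \<tau> i \<le> a \<and> a < \<tau> (Suc i)"
    and "\<tau> 0 < a \<Longrightarrow> a \<le> \<tau> n \<Longrightarrow> \<exists>i<n. \<tau> i < a \<and> a \<le> \<tau> (Suc i)"
  using assms
proof (induction n)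
  case (Suc n)
  {
    case 1
    then show ?case using Suc by (cases "a < \<tau> n") (auto simp: less_Suc_eq)
  next
    case 2
    then show ?case using Suc by (cases "a \<le> \<tau> n") (auto simp: less_Suc_eq)
  }
qed auto

lemma integral_arc_flow:
  assumes X: "hfield X" and se: "s < e" and cont: "continuous_on {s..e} \<gamma>" and Z: "closed Z"
    and arc: "three_zones.integral_arc Z X \<gamma> s e" and a: "a \<in> {s..e}" and b: "b \<in> {s..e}"
  shows "\<gamma> b = flow X (b - a) (\<gamma> a)" "\<gamma> b \<in> Z"
proof -
  have arc': "\<gamma> t \<in> Z" "(\<gamma> has_vector_derivative X (\<gamma> t)) (at t)" if "t \<in> {s<..<e}" for t
    using arc that unfolding three_zones.integral_arc_def by blast+
  have fl: "\<gamma> u = flow X (u - s) (\<gamma> s)" if "u \<in> {s..e}" for u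
    by (rule solution_is_flow[OF X cont _ that]) (use arc'(2) in simp)
  have "flow X (b - a) (\<gamma> a) = flow X (b - a) (flow X (a - s) (\<gamma> s))" using fl[OF a] by simp
  also have "\<dots> = flow X (b - s) (\<gamma> s)" unfolding flow_add[OF X, symmetric] by simp
  finally show "\<gamma> b = flow X (b - a) (\<gamma> a)" using fl[OF b] by simp
  have "closure {s<..<e} = {s..e}" using se by simp
  moreover have "\<gamma> ` closure {s<..<e} \<subseteq> Z"
    by (rule image_closure_subset) (use cont Z arc'(1) se in auto)
  ultimately show "\<gamma> b \<in> Z" using b by auto
qed

text \<open>
  The closed version of an arc, in which the flow relates any two points of it, the ends included.
\<close>

definition zone_arc :: "plane \<Rightarrow> real \<Rightarrow> real \<Rightarrow> (plane \<Rightarrow> plane) \<Rightarrow> (plane \<Rightarrow> plane) \<Rightarrow> (plane \<Rightarrow> plane)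
    \<Rightarrow> (real \<Rightarrow> plane) \<Rightarrow> real \<Rightarrow> real \<Rightarrow> bool" where
  "zone_arc v lL lR XL XC XR \<gamma> s e \<longleftrightarrow>
     (\<forall>a\<in>{s..e}. \<forall>b\<in>{s..e}. \<gamma> b = flow XL (b - a) (\<gamma> a) \<and> v \<bullet> \<gamma> b \<le> lL) \<or>
     (\<forall>a\<in>{s..e}. \<forall>b\<in>{s..e}. \<gamma> b = flow XC (b - a) (\<gamma> a) \<and> lL \<le> v \<bullet> \<gamma> b \<and> v \<bullet> \<gamma> b \<le> lR) \<or>
     (\<forall>a\<in>{s..e}. \<forall>b\<in>{s..e}. \<gamma> b = flow XR (b - a) (\<gamma> a) \<and> lR \<le> v \<bullet> \<gamma> b)"

lemma zone_arc_germ: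
  assumes z: "zone_arc v lL lR XL XC XR \<gamma> s e" and a: "a \<in> {s..e}" and d: "0 < d"
    and h: "\<And>h. h \<in> {0..d} \<Longrightarrow> a + \<sigma> * h \<in> {s..e} \<and> g (t + \<sigma> * h) = \<gamma> (a + \<sigma> * h)"
  shows "germ v lL lR XL XC XR g \<sigma> t"
proof -
  have gt: "g t = \<gamma> a" using h[of 0] d by simp
  have tr: "\<forall>h\<in>{0..d}. g (t + \<sigma> * h) = flow X (\<sigma> * h) (g t) \<and> P (g (t + \<sigma> * h))"
    if P: "\<forall>a\<in>{s..e}. \<forall>b\<in>{s..e}. \<gamma> b = flow X (b - a) (\<gamma> a) \<and> P (\<gamma> b)" for X P
  proof
    fix k assume k: "k \<in> {0..d}"
    then have b: "a + \<sigma> * k \<in> {s..e}" and eq: "g (t + \<sigma> * k) = \<gamma> (a + \<sigma> * k)" using h by blast+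
    have "\<gamma> (a + \<sigma> * k) = flow X (a + \<sigma> * k - a) (\<gamma> a) \<and> P (\<gamma> (a + \<sigma> * k))" using P a b by blast
    then show "g (t + \<sigma> * k) = flow X (\<sigma> * k) (g t) \<and> P (g (t + \<sigma> * k))" unfolding eq gt add_diff_cancel_left' .
  qed
  from z show ?thesis
    unfolding zone_arc_def germ_def
    by (elim disjE) (drule tr, use d in blast)+
qed

context three_zones
begin

lemma orbit_arc_zone:
  assumes v: "v \<noteq> 0" and lr: "lL < lR" and X: "hfield XL" "hfield XC" "hfield XR"
    and se: "s < e" and cont: "continuous_on {s..e} \<gamma>" and inj: "inj_on \<gamma> {s<..<e}"
    and arc: "orbit_arc \<gamma> s e" and sub: "\<gamma> ` {s<..<e} \<subseteq> \<Gamma>"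
    and ns: "\<forall>A\<in>{sliding_set lL XL XC, escaping_set lL XL XC, sliding_set lR XC XR, escaping_set lR XC XR}.
      \<not> (\<exists>p q. p \<noteq> q \<and> closed_segment p q \<subseteq> \<Gamma> \<inter> A)"
  shows "zone_arc v lL lR XL XC XR \<gamma> s e"
proof -
  have c: "continuous_on {s<..<e} \<gamma>" using cont by (rule continuous_on_subset) auto
  have cf: "continuous_on UNIV XL" "continuous_on UNIV XC" "continuous_on UNIV XR" using hfield_continuous X by blast+
  note cz = closure_zones[OF v lr]
  note af = integral_arc_flow[OF _ se cont closed_closure]
  from arc show ?thesis
    unfolding orbit_arc_def
  proof (elim disjE)
    assume "integral_arc (closure zoneL) XL \<gamma> s e"
    then have "\<forall>a\<in>{s..e}. \<forall>b\<in>{s..e}. \<gamma> b = flow XL (b - a) (\<gamma> a) \<and> \<gamma> b \<in> closure zoneL" using af[OF X(1)] by blast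
    then show ?thesis unfolding zone_arc_def cz mem_Collect_eq by blast
  next
    assume "integral_arc (closure zoneC) XC \<gamma> s e"
    then have "\<forall>a\<in>{s..e}. \<forall>b\<in>{s..e}. \<gamma> b = flow XC (b - a) (\<gamma> a) \<and> \<gamma> b \<in> closure zoneC" using af[OF X(2)] by blast
    then show ?thesis unfolding zone_arc_def cz mem_Collect_eq by blast
  next
    assume "integral_arc (closure zoneR) XR \<gamma> s e"
    then have "\<forall>a\<in>{s..e}. \<forall>b\<in>{s..e}. \<gamma> b = flow XR (b - a) (\<gamma> a) \<and> \<gamma> b \<in> closure zoneR" using af[OF X(3)] by blast
    then show ?thesis unfolding zone_arc_def cz mem_Collect_eq by blast
  next
    assume "integral_arc (sliding_set lL XL XC \<union> escaping_set lL XL XC) (sliding_field XL XC) \<gamma> s e"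
    then have "\<And>t. t \<in> {s<..<e} \<Longrightarrow> \<gamma> t \<in> sliding_set lL XL XC \<union> escaping_set lL XL XC" unfolding integral_arc_def by blast
    from no_sliding_arc[OF v cf(1,2) se c inj this sub] ns show ?thesis by blast
  next
    assume "integral_arc (sliding_set lR XC XR \<union> escaping_set lR XC XR) (sliding_field XC XR) \<gamma> s e"
    then have "\<And>t. t \<in> {s<..<e} \<Longrightarrow> \<gamma> t \<in> sliding_set lR XC XR \<union> escaping_set lR XC XR" unfolding integral_arc_def by blast
    from no_sliding_arc[OF v cf(2,3) se c inj this sub] ns show ?thesis by blast
  qed
qed

text \<open>
  The trajectory is extended to a periodic curve. Since each time lies in an arc of the partition
  together with a right or left neighbourhood, the germs are arcs of the flows.
\<close>

lemma periodic_orbit_cycle: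
  assumes v: "v \<noteq> 0" and lr: "lL < lR" and X: "hfield XL" "hfield XC" "hfield XR"
    and po: "periodic_orbit \<Gamma>"
    and ns: "\<forall>A\<in>{sliding_set lL XL XC, escaping_set lL XL XC, sliding_set lR XC XR, escaping_set lR XC XR}.
      \<not> (\<exists>p q. p \<noteq> q \<and> closed_segment p q \<subseteq> \<Gamma> \<inter> A)"
  obtains g T where "cycle v lL lR XL XC XR g T" "range g = \<Gamma>"
proof -
  obtain \<gamma> T where T: "0 < T" and tr: "trajectory \<gamma> T" and cl: "\<gamma> T = \<gamma> 0" and inj: "inj_on \<gamma> {0..<T}"
    and G: "\<Gamma> = \<gamma> ` {0..T}" using po unfolding periodic_orbit_def by blast
  obtain n \<tau> where cont: "continuous_on {0..T} \<gamma>" and t0: "\<tau> 0 = (0::real)" and tn: "\<tau> n = T"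
    and ta: "\<forall>i<n. \<tau> i < \<tau> (Suc i) \<and> orbit_arc \<gamma> (\<tau> i) (\<tau> (Suc i))" using tr unfolding trajectory_def by blast
  have inc: "\<forall>i<n. \<tau> i < \<tau> (Suc i)" using ta by blast
  have lo: "0 \<le> \<tau> i" if "i \<le> n" for i
    using that
  proof (induction i)
    case (Suc i)
    then have "\<tau> i < \<tau> (Suc i)" "0 \<le> \<tau> i" using inc by auto
    then show ?case by simp
  qed (simp add: t0)
  have hi: "\<tau> i \<le> T" if "i \<le> n" for i
    using that
  proof (induction rule: inc_induct)
    case (step m)
    then have "\<tau> m < \<tau> (Suc m)" using inc by auto
    then show ?case using step by simp
  qed (simp add: tn)
  have zone: "zone_arc v lL lR XL XC XR \<gamma> (\<tau> i) (\<tau> (Suc i))" if i: "i < n" for i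
  proof (rule orbit_arc_zone[OF v lr X _ _ _ _ _ ns])
    have b: "0 \<le> \<tau> i" "\<tau> (Suc i) \<le> T" using lo hi i by simp_all
    show "\<tau> i < \<tau> (Suc i)" "orbit_arc \<gamma> (\<tau> i) (\<tau> (Suc i))" using ta i by blast+
    show "continuous_on {\<tau> i..\<tau> (Suc i)} \<gamma>" using cont by (rule continuous_on_subset) (use b in auto)
    show "inj_on \<gamma> {\<tau> i<..<\<tau> (Suc i)}" using inj by (rule inj_on_subset) (use b in auto)
    show "\<gamma> ` {\<tau> i<..<\<tau> (Suc i)} \<subseteq> \<Gamma>" unfolding G using b by (intro image_mono) auto
  qed
  define g where "g t = \<gamma> (t - of_int \<lfloor>t / T\<rfloor> * T)" for t
  have fl: "\<lfloor>t / T\<rfloor> = k" if "of_int k * T \<le> t" "t < of_int (k + 1) * T" for t k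
    using that T by (intro floor_unique) (simp_all add: pos_le_divide_eq pos_divide_less_eq)
  have geq: "g t = \<gamma> (t - of_int k * T)" if t: "of_int k * T \<le> t" "t \<le> of_int (k + 1) * T" for t k
  proof (cases "t = of_int (k + 1) * T")
    case True
    have "\<lfloor>t / T\<rfloor> = k + 1" by (rule fl) (use True T in \<open>simp_all add: algebra_simps\<close>)
    then have "g t = \<gamma> 0" unfolding g_def True by simp
    moreover have "t - of_int k * T = T" using True by (simp add: algebra_simps)
    ultimately show ?thesis using cl by simp
  next
    case False
    then show ?thesis using fl[of k t] t unfolding g_def by simp
  qed
  have decomp: "of_int \<lfloor>t / T\<rfloor> * T \<le> t \<and> t < of_int (\<lfloor>t / T\<rfloor> + 1) * T" for t
    using floor_divide_lower[OF T, of t] floor_divide_upper[OF T, of t] by simp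
  have cyc: "cycle v lL lR XL XC XR g T"
  proof
    show "g (t + T) = g t" for t
    proof -
      define k where "k = \<lfloor>t / T\<rfloor>"
      have k: "of_int k * T \<le> t" "t < of_int (k + 1) * T" using decomp[of t] by (simp_all add: k_def)
      have "g (t + T) = \<gamma> (t + T - of_int (k + 1) * T)" by (rule geq) (use k in \<open>simp_all add: algebra_simps\<close>)
      also have "\<dots> = g t" using geq[of k t] k by (simp add: algebra_simps)
      finally show ?thesis .
    qed
    show "\<exists>k::int. t = s + of_int k * T" if "g s = g t" for s t
    proof -
      define k l where "k = \<lfloor>s / T\<rfloor>" and "l = \<lfloor>t / T\<rfloor>"
      have k: "of_int k * T \<le> s" "s < of_int (k + 1) * T" "of_int l * T \<le> t" "t < of_int (l + 1) * T"
        using decomp[of s] decomp[of t] by (simp_all add: k_def l_def)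
      have "\<gamma> (s - of_int k * T) = \<gamma> (t - of_int l * T)" using that by (simp add: g_def k_def l_def)
      moreover have "s - of_int k * T \<in> {0..<T}" "t - of_int l * T \<in> {0..<T}" using k by (simp_all add: algebra_simps)
      ultimately have "s - of_int k * T = t - of_int l * T" by (rule inj_onD[OF inj])
      then have "t = s + of_int (l - k) * T" by (simp add: algebra_simps)
      then show ?thesis by blast
    qed
    have piece: "continuous_on {of_int k * T..of_int (k + 1) * T} g" for k
    proof -
      have "continuous_on {of_int k * T..of_int (k + 1) * T} (\<lambda>t. \<gamma> (t - of_int k * T))"
        by (rule continuous_on_compose2[OF cont]) (auto intro!: continuous_intros simp: algebra_simps)
      then show ?thesis by (rule continuous_on_eq) (rule geq[symmetric], simp_all)
    qed
    have "isCont g t" for t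
    proof -
      define k where "k = \<lfloor>t / T\<rfloor>"
      have k: "of_int k * T \<le> t" "t < of_int (k + 1) * T" using decomp[of t] by (simp_all add: k_def)
      have "continuous_on ({of_int (k - 1) * T..of_int k * T} \<union> {of_int k * T..of_int (k + 1) * T}) g"
        using piece[of "k - 1"] piece[of k] by (intro continuous_on_closed_Un) simp_all
      then have "continuous_on {of_int (k - 1) * T<..<of_int (k + 1) * T} g"
        by (rule continuous_on_subset) auto
      moreover have "t \<in> {of_int (k - 1) * T<..<of_int (k + 1) * T}" using k T by (simp add: algebra_simps)
      ultimately show ?thesis by (simp add: continuous_on_eq_continuous_at)
    qed
    then show "continuous_on UNIV g" by (simp add: continuous_on_eq_continuous_at)
    show "germ v lL lR XL XC XR g 1 t" for t
    proof -
      define k where "k = \<lfloor>t / T\<rfloor>"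
      define a where "a = t - of_int k * T"
      have k: "of_int k * T \<le> t" "t < of_int (k + 1) * T" using decomp[of t] by (simp_all add: k_def)
      then have "\<tau> 0 \<le> a" "a < \<tau> n" by (simp_all add: a_def t0 tn algebra_simps)
      from partition_locate(1)[OF inc this] obtain i where i: "i < n" "\<tau> i \<le> a" "a < \<tau> (Suc i)" by blast
      have sT: "\<tau> (Suc i) \<le> T" using hi i by simp
      show ?thesis
      proof (rule zone_arc_germ[OF zone[OF i(1)], of a "\<tau> (Suc i) - a"])
        show "a \<in> {\<tau> i..\<tau> (Suc i)}" "0 < \<tau> (Suc i) - a" using i by simp_all
        fix h assume h: "h \<in> {0..\<tau> (Suc i) - a}"
        have "g (t + 1 * h) = \<gamma> (t + 1 * h - of_int k * T)"
          by (rule geq) (use h k sT in \<open>simp_all add: a_def algebra_simps\<close>)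
        then show "a + 1 * h \<in> {\<tau> i..\<tau> (Suc i)} \<and> g (t + 1 * h) = \<gamma> (a + 1 * h)"
          using h i by (simp add: a_def algebra_simps)
      qed
    qed
    show "germ v lL lR XL XC XR g (- 1) t" for t
    proof -
      define k where "k = \<lceil>t / T\<rceil> - 1"
      define a where "a = t - of_int k * T"
      have "of_int k < t / T" "t / T \<le> of_int (k + 1)" unfolding k_def by linarith+
      then have k: "of_int k * T < t" "t \<le> of_int (k + 1) * T"
        using T by (simp_all only: pos_less_divide_eq pos_divide_le_eq)
      then have "\<tau> 0 < a" "a \<le> \<tau> n" by (simp_all add: a_def t0 tn algebra_simps)
      from partition_locate(2)[OF inc this] obtain i where i: "i < n" "\<tau> i < a" "a \<le> \<tau> (Suc i)" by blast
      have s0: "0 \<le> \<tau> i" using lo i by simp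
      show ?thesis
      proof (rule zone_arc_germ[OF zone[OF i(1)], of a "a - \<tau> i"])
        show "a \<in> {\<tau> i..\<tau> (Suc i)}" "0 < a - \<tau> i" using i by simp_all
        fix h assume h: "h \<in> {0..a - \<tau> i}"
        have "g (t + - 1 * h) = \<gamma> (t + - 1 * h - of_int k * T)"
          by (rule geq) (use h k s0 in \<open>simp_all add: a_def algebra_simps\<close>)
        then show "a + - 1 * h \<in> {\<tau> i..\<tau> (Suc i)} \<and> g (t + - 1 * h) = \<gamma> (a + - 1 * h)"
          using h i by (simp add: a_def algebra_simps)
      qed
    qed
  qed (use v lr X T in simp_all)
  have "range g = g ` {0..0 + T}" by (rule cycle.range_g[OF cyc])
  also have "\<dots> = \<gamma> ` {0..T}" using geq[of 0] by (intro image_cong) simp_all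
  finally have "range g = \<Gamma>" using G by simp
  with cyc show ?thesis by (rule that)
qed

text \<open>
  Isolation among all periodic orbits is passed on to the smaller class of loops without sliding,
  for which perturbations are constructed.
\<close>

lemma limit_cycle_isolated_loop:
  assumes "v \<noteq> 0" "lL < lR" "limit_cycle \<Gamma>"
  shows "isolated_loop (zone_adm v lL lR XL XC XR) \<Gamma>"
  using assms(3) loop_periodic_orbit[OF assms(1,2)] unfolding limit_cycle_def isolated_loop_def by blast

end

section \<open>Uniqueness of the crossing limit cycle\<close>

lemma cross_time_unique:
  assumes "l < m" "cross v l m X p S" "cross v l m X p T"
  shows "S = T"
proof -
  have False if "S < T" "cross v l m X p S" "cross v l m X p T" for S T
  proof -
    have "S \<in> {0<..<T}" "v \<bullet> flow X S p = m" using that unfolding cross_def by auto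
    then show False using that(3) unfolding cross_def by force
  qed
  then show ?thesis using assms by (metis linorder_neqE)
qed

lemma exc_time_unique:
  assumes "exc v l X p S" "exc v l X p T"
  shows "S = T"
proof -
  have False if "S < T" "exc v l X p S" "exc v l X p T" for S T
  proof -
    have "S \<in> {0<..<T}" "v \<bullet> flow X S p = l" using that unfolding exc_def by auto
    then show False using that(3) unfolding exc_def by force
  qed
  then show ?thesis using assms by (metis linorder_neqE)
qed

theorem theorem4:
  fixes v :: "real \<times> real" and lL lR :: real
    and XL XC XR :: "real \<times> real \<Rightarrow> real \<times> real"
  assumes "v \<noteq> 0" and "lL < lR"
    and "linear_hamiltonian XL" and "linear_hamiltonian XC" and "linear_hamiltonian XR"
    and "has_isolated_singular_point XL"
    and "has_isolated_singular_point XC"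
    and "has_isolated_singular_point XR"
    and "three_zones.discontinuous v lL lR XL XC XR"
  shows "\<exists>\<^sub>\<le>\<^sub>1\<Gamma>. three_zones.crossing_limit_cycle v lL lR XL XC XR \<Gamma>"
proof (rule Uniq_I)
  fix \<Gamma> \<Gamma>'
  assume G: "three_zones.crossing_limit_cycle v lL lR XL XC XR \<Gamma>"
    and G': "three_zones.crossing_limit_cycle v lL lR XL XC XR \<Gamma>'"
  note v = assms(1) and lr = assms(2)
  have lr': "- lR < - lL" and v': "- v \<noteq> 0" using lr v by simp_all
  have hL: "hfield XL" and hC: "hfield XC" and hR: "hfield XR"
    using linear_hamiltonian_hfield assms(3-8) by blast+
  let ?adm = "zone_adm v lL lR XL XC XR"
  have admL: "?adm XL A" if "\<forall>r\<in>A. v \<bullet> r \<le> lL" for A using that unfolding zone_adm_def by blast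
  have admC: "?adm XC A" if "\<forall>r\<in>A. lL \<le> v \<bullet> r \<and> v \<bullet> r \<le> lR" for A using that unfolding zone_adm_def by blast
  have admR: "?adm XR A" if "\<forall>r\<in>A. lR \<le> v \<bullet> r" for A using that unfolding zone_adm_def by blast
  have iso: "isolated_loop ?adm \<Delta>" if "three_zones.crossing_limit_cycle v lL lR XL XC XR \<Delta>" for \<Delta>
    using that three_zones.limit_cycle_isolated_loop[OF v lr] unfolding three_zones.crossing_limit_cycle_def by blast
  have shape: "\<exists>p0 p1 p2 p3 Ta Tb Tc Td. nondeg v XC \<and> three_zone_cycle v lL lR XL XC XR p0 p1 p2 p3 Ta Tb Tc Td
    \<and> exc v lL XL p0 Td \<and> exc (- v) (- lR) XR p2 Tb
    \<and> \<Delta> = (orbit XC p1 Ta \<union> orbit XR p2 Tb) \<union> (orbit XC p3 Tc \<union> orbit XL p0 Td)"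
    if D: "three_zones.crossing_limit_cycle v lL lR XL XC XR \<Delta>" for \<Delta>
  proof -
    obtain g T where "cycle v lL lR XL XC XR g T" and g: "range g = \<Delta>"
    proof (rule three_zones.periodic_orbit_cycle[OF v lr hL hC hR])
      show "three_zones.periodic_orbit v lL lR XL XC XR \<Delta>"
        using D unfolding three_zones.crossing_limit_cycle_def three_zones.limit_cycle_def by blast
      show "\<forall>A\<in>{three_zones.sliding_set v lL XL XC, three_zones.escaping_set v lL XL XC,
        three_zones.sliding_set v lR XC XR, three_zones.escaping_set v lR XC XR}.
        \<not> (\<exists>p q. p \<noteq> q \<and> closed_segment p q \<subseteq> \<Delta> \<inter> A)"
        using D unfolding three_zones.crossing_limit_cycle_def by blast
    qed
    interpret cycle v lL lR XL XC XR g T by fact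
    have "isolated_loop ?adm (range g)" using iso[OF D] g by simp
    from isolated_cycle_is_three_zone[OF admL admC admR this] show ?thesis unfolding g by metis
  qed
  obtain p0 p1 p2 p3 Ta Tb Tc Td where nd: "nondeg v XC" and cyc: "three_zone_cycle v lL lR XL XC XR p0 p1 p2 p3 Ta Tb Tc Td"
    and eL: "exc v lL XL p0 Td" and eR: "exc (- v) (- lR) XR p2 Tb"
    and GP: "\<Gamma> = (orbit XC p1 Ta \<union> orbit XR p2 Tb) \<union> (orbit XC p3 Tc \<union> orbit XL p0 Td)"
    using shape[OF G] by metis
  obtain q0 q1 q2 q3 Sa Sb Sc Sd where cyc': "three_zone_cycle v lL lR XL XC XR q0 q1 q2 q3 Sa Sb Sc Sd"
    and eL': "exc v lL XL q0 Sd" and eR': "exc (- v) (- lR) XR q2 Sb"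
    and GQ: "\<Gamma>' = (orbit XC q1 Sa \<union> orbit XR q2 Sb) \<union> (orbit XC q3 Sc \<union> orbit XL q0 Sd)"
    using shape[OF G'] by metis
  have c: "cross v lL lR XC p1 Ta" "flow XC Ta p1 = p2" "flow XR Tb p2 = p3"
      "cross (- v) (- lR) (- lL) XC p3 Tc" "flow XC Tc p3 = p0" "flow XL Td p0 = p1"
    using cyc unfolding three_zone_cycle_def by blast+
  have c': "cross v lL lR XC q1 Sa" "flow XC Sa q1 = q2" "flow XR Sb q2 = q3"
      "cross (- v) (- lR) (- lL) XC q3 Sc" "flow XC Sc q3 = q0" "flow XL Sd q0 = q1"
    using cyc' unfolding three_zone_cycle_def by blast+
  have on: "v \<bullet> p1 = lL" "v \<bullet> q1 = lL" using c(1) c'(1) unfolding cross_def by blast+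
  show "\<Gamma> = \<Gamma>'"
  proof (cases "v \<bullet> XC p1 = v \<bullet> XC q1")
    case True
    then have 1: "p1 = q1" using nondegD[OF nd] on by simp
    have a: "Ta = Sa" by (rule cross_time_unique[OF lr c(1)]) (use c'(1) 1 in simp)
    then have 2: "p2 = q2" using c(2) c'(2) 1 by simp
    have b: "Tb = Sb" by (rule exc_time_unique[OF eR]) (use eR' 2 in simp)
    then have 3: "p3 = q3" using c(3) c'(3) 2 by simp
    have d: "Tc = Sc" by (rule cross_time_unique[OF lr' c(4)]) (use c'(4) 3 in simp)
    then have 0: "p0 = q0" using c(5) c'(5) 3 by simp
    have e: "Td = Sd" by (rule exc_time_unique[OF eL]) (use eL' 0 in simp)
    show ?thesis unfolding GP GQ 0 1 2 3 a b d e ..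
  next
    case False
    define D where "D = disc XC * ((lR - v \<bullet> centre XC)\<^sup>2 - (lL - v \<bullet> centre XC)\<^sup>2)"
    note V = three_zone_velocities[OF hC lr cyc D_def] and V' = three_zone_velocities[OF hC lr cyc' D_def]
    have "p0 + p1 = q0 + q1" using exc_sum[OF hL v eL eL'] c(6) c'(6) by simp
    from field_sum[OF hC this] have s01: "v \<bullet> XC p0 + v \<bullet> XC p1 = v \<bullet> XC q0 + v \<bullet> XC q1" by (metis inner_add_right)
    have "p2 + p3 = q2 + q3" using exc_sum[OF hR v' eR eR'] c(3) c'(3) by simp
    from field_sum[OF hC this] have s23: "v \<bullet> XC p2 + v \<bullet> XC p3 = v \<bullet> XC q2 + v \<bullet> XC q3" by (metis inner_add_right)
    have sym: "(v \<bullet> XC p0 + v \<bullet> XC p1 = 0 \<and> v \<bullet> XC p2 + v \<bullet> XC p3 = 0)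
      \<or> (v \<bullet> XC p0 + v \<bullet> XC p1 = v \<bullet> XC p2 + v \<bullet> XC p3 \<and> D = 0)"
      by (rule two_solutions_symmetric[OF V V' s01 s23 False])
    obtain f0 f1 f2 f3 :: "real \<Rightarrow> real" where
      f: "(f0 \<longlongrightarrow> v \<bullet> XC p0) (at_right 0)" "(f1 \<longlongrightarrow> v \<bullet> XC p1) (at_right 0)"
        "(f2 \<longlongrightarrow> v \<bullet> XC p2) (at_right 0)" "(f3 \<longlongrightarrow> v \<bullet> XC p3) (at_right 0)"
      and F: "\<And>s. 0 < s \<Longrightarrow> v \<bullet> XC p1 < f1 s \<and> v \<bullet> XC p2 \<le> f2 s \<and> f3 s < v \<bullet> XC p3 \<and> f0 s \<le> v \<bullet> XC p0
       \<and> (f2 s)\<^sup>2 = (f1 s)\<^sup>2 + D \<and> (f3 s)\<^sup>2 = (f0 s)\<^sup>2 + D \<and> f0 s + f1 s = v \<bullet> XC p0 + v \<bullet> XC p1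
       \<and> f2 s + f3 s = v \<bullet> XC p2 + v \<bullet> XC p3"
      by (rule symmetric_family[OF V sym]) (rule that)
    \<comment> \<open>two solutions of the velocity equations make both loops members of continuous families\<close>
    have "\<not> isolated_loop ?adm \<Gamma>"
      unfolding GP
    proof (rule three_zone_not_isolated[OF hL hC hR v lr nd cyc D_def f])
      fix s :: real assume "0 < s"
      from F[OF this] V(1,3)
      show "v \<bullet> XC p1 < f1 s \<and> f3 s < v \<bullet> XC p3 \<and> 0 \<le> f2 s \<and> f0 s \<le> 0
        \<and> (f2 s)\<^sup>2 = (f1 s)\<^sup>2 + D \<and> (f3 s)\<^sup>2 = (f0 s)\<^sup>2 + D
        \<and> (exc v lL XL p0 Td \<longrightarrow> f0 s + f1 s = v \<bullet> XC p0 + v \<bullet> XC p1)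
        \<and> (exc (- v) (- lR) XR p2 Tb \<longrightarrow> f2 s + f3 s = v \<bullet> XC p2 + v \<bullet> XC p3)"
        by (elim conjE, intro conjI impI) (assumption | linarith)+
    qed (rule admL admC admR; assumption)+
    then show ?thesis using iso[OF G] by blast
  qed
qed

end
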